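(* Suppose that $1<\alpha<2$ and $D\subset\mathbb{R}$ is a bounded open interval. Then (both limits existing) $$\lim_{t\downarrow 0}\frac{|D|-Q^{(\alpha)}_{D}(t)}{t^{1/\alpha}}<\lim_{t\downarrow 0}\frac{|D|-\widetilde{Q}^{(\alpha)}_{D}(t)}{t^{1/\alpha}}.$$
   Context: $|D|$ is the Lebesgue measure (length) of $D$. $W$ is a Brownian motion in $\mathbb{R}$ with generator $\Delta=\frac{d^2}{dx^2}$ (not $\frac12\Delta$), and $\mathbb{P}_x$ is the law under which $W$ starts at $x$. $S^{(\alpha/2)}=(S^{(\alpha/2)}_t)_{t\ge0}$ is an $(\alpha/2)$-stable subordinator independent of $W$: a nondecreasing Lévy process with $S^{(\alpha/2)}_0=0$ and $\mathbb{E}[e^{-\lambda S^{(\alpha/2)}_t}]=e^{-t\lambda^{\alpha/2}}$ for $\lambda>0$, $t\ge0$. The subordinate Brownian motion $X^{(\alpha)}_t=W_{S^{(\alpha/2)}_t}$ is an isotropic (symmetric) $\alpha$-stable process. Let $\tau^{(\alpha)}_D=\inf\{t>0:X^{(\alpha)}_t\notin D\}$ and $\tau^{(2)}_D=\inf\{t>0:W_t\notin D\}$. The spectral heat content of $D$ with respect to $X^{(\alpha)}$ is $Q^{(\alpha)}_D(t)=\int_D\mathbb{P}_x(\tau_D^{(\alpha)}>t)\,dx$. Let $W^D$ be $W$ killed upon exiting $D$; the subordinate killed Brownian motion is $Y^{D,(\alpha)}_t=W^D_{S^{(\alpha/2)}_t}$, and its spectral heat content is $$\widetilde{Q}^{(\alpha)}_D(t)=\int_D\mathbb{P}_x(Y^{D,(\alpha)}_t\in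 D)\,dx=\int_D\mathbb{P}_x\left(\tau_D^{(2)}>S^{(\alpha/2)}_t\right)dx .$$ *)

theory Defs
  imports "HOL-Probability.Probability"
begin

text \<open>
  Stochastic processes are functions \<open>X :: real \<Rightarrow> 'a \<Rightarrow> real\<close>; only times \<open>t \<ge> 0\<close> matter.
  Path properties are required almost surely.
\<close>

definition indep_increments :: "'a measure \<Rightarrow> (real \<Rightarrow> 'a \<Rightarrow> real) \<Rightarrow> bool" where
  "indep_increments M X \<longleftrightarrow>
     (\<forall>(n::nat) (t :: nat \<Rightarrow> real). 0 \<le> t 0 \<and> (\<forall>i<n. t i < t (Suc i)) \<longrightarrow>
        prob_space.indep_vars M (\<lambda>_. borel) (\<lambda>i \<omega>. X (t (Suc i)) \<omega> - X (t i) \<omega>) {..<n})"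

text \<open>
  Brownian motion started at \<open>x\<close> with generator \<open>d\<^sup>2/dx\<^sup>2\<close> (not one half of it): the transition
  density is the fundamental solution of the heat equation with this operator, so that
  \<open>W t - W s\<close> has variance \<open>2 * (t - s)\<close>. The second argument of \<open>normal_density\<close> is the
  standard deviation.
\<close>

definition brownian_motion :: "'a measure \<Rightarrow> real \<Rightarrow> (real \<Rightarrow> 'a \<Rightarrow> real) \<Rightarrow> bool" where
  "brownian_motion M x W \<longleftrightarrow>
     (\<forall>t\<ge>0. W t \<in> borel_measurable M) \<and>
     (AE \<omega> in M. W 0 \<omega> = x) \<and>
     indep_increments M W \<and>
     (\<forall>s t. 0 \<le> s \<and> s < t \<longrightarrow>
        distributed M lborel (\<lambda>\<omega>. W t \<omega> - W s \<omega>) (normal_density 0 (sqrt (2 * (t - s))))) \<and>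
     (AE \<omega> in M. continuous_on {0..} (\<lambda>t. W t \<omega>))"

definition cadlag :: "(real \<Rightarrow> real) \<Rightarrow> bool" where
  "cadlag f \<longleftrightarrow> (\<forall>t\<ge>0. (f \<longlongrightarrow> f t) (at_right t)) \<and> (\<forall>t>0. \<exists>l. (f \<longlongrightarrow> l) (at_left t))"

definition levy_process :: "'a measure \<Rightarrow> (real \<Rightarrow> 'a \<Rightarrow> real) \<Rightarrow> bool" where
  "levy_process M X \<longleftrightarrow>
     (\<forall>t\<ge>0. X t \<in> borel_measurable M) \<and>
     (AE \<omega> in M. X 0 \<omega> = 0) \<and>
     indep_increments M X \<and>
     (\<forall>s t. 0 \<le> s \<and> s < t \<longrightarrow>
        distr M borel (\<lambda>\<omega>. X t \<omega> - X s \<omega>) = distr M borel (X (t - s))) \<and>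
     (AE \<omega> in M. cadlag (\<lambda>t. X t \<omega>))"

definition stable_subordinator :: "'a measure \<Rightarrow> real \<Rightarrow> (real \<Rightarrow> 'a \<Rightarrow> real) \<Rightarrow> bool" where
  "stable_subordinator M \<beta> S \<longleftrightarrow>
     levy_process M S \<and>
     (AE \<omega> in M. mono_on {0..} (\<lambda>t. S t \<omega>)) \<and>
     (\<forall>u>0. \<forall>t\<ge>0. (\<integral>\<omega>. exp (- u * S t \<omega>) \<partial>M) = exp (- t * u powr \<beta>))"

definition indep_processes ::
  "'a measure \<Rightarrow> (real \<Rightarrow> 'a \<Rightarrow> real) \<Rightarrow> (real \<Rightarrow> 'a \<Rightarrow> real) \<Rightarrow> bool" where
  "indep_processes M X Y \<longleftrightarrow>
     prob_space.indep_var M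
       (PiM {0..} (\<lambda>_. borel)) (\<lambda>\<omega>. \<lambda>t\<in>{0..}. X t \<omega>)
       (PiM {0..} (\<lambda>_. borel)) (\<lambda>\<omega>. \<lambda>t\<in>{0..}. Y t \<omega>)"

definition subordinate ::
  "(real \<Rightarrow> 'a \<Rightarrow> 'b) \<Rightarrow> (real \<Rightarrow> 'a \<Rightarrow> real) \<Rightarrow> real \<Rightarrow> 'a \<Rightarrow> 'b" where
  "subordinate X S t \<omega> = X (S t \<omega>) \<omega>"

text \<open>The infimum is taken in the extended reals, so a path that never leaves \<open>D\<close> has exit time
  \<open>\<infinity>\<close>.\<close>

definition exit_time :: "(real \<Rightarrow> 'a \<Rightarrow> real) \<Rightarrow> real set \<Rightarrow> 'a \<Rightarrow> ereal" where
  "exit_time X D \<omega> = Inf {ereal t | t. 0 < t \<and> X t \<omega> \<notin> D}"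

text \<open>The cemetery state of the killed process is \<open>None\<close>.\<close>

definition killed :: "(real \<Rightarrow> 'a \<Rightarrow> real) \<Rightarrow> real set \<Rightarrow> real \<Rightarrow> 'a \<Rightarrow> real option" where
  "killed X D t \<omega> = (if ereal t < exit_time X D \<omega> then Some (X t \<omega>) else None)"

text \<open>
  In the two spectral heat contents, \<open>P x\<close> is the law under which \<open>W\<close> starts at \<open>x\<close>. Exit events
  involve uncountably many times and need not belong to the \<open>\<sigma>\<close>-algebra of \<open>P x\<close> itself, whence the
  completion (\<open>measure\<close> is \<open>0\<close> on non-measurable sets); for the same reason the integral over \<open>D\<close>
  is with respect to the completed Lebesgue measure.
\<close>

definition spectral_heat_content ::
  "(real \<Rightarrow> 'a measure) \<Rightarrow> (real \<Rightarrow> 'a \<Rightarrow> real) \<Rightarrow> (real \<Rightarrow> 'a \<Rightarrow> real) \<Rightarrow> real set \<Rightarrow> real \<Rightarrow> real"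
  where
  "spectral_heat_content P W S D t =
     (LINT x:D|lebesgue.
        measure (completion (P x)) {\<omega> \<in> space (P x). exit_time (subordinate W S) D \<omega> > ereal t})"

definition killed_spectral_heat_content ::
  "(real \<Rightarrow> 'a measure) \<Rightarrow> (real \<Rightarrow> 'a \<Rightarrow> real) \<Rightarrow> (real \<Rightarrow> 'a \<Rightarrow> real) \<Rightarrow> real set \<Rightarrow> real \<Rightarrow> real"
  where
  "killed_spectral_heat_content P W S D t =
     (LINT x:D|lebesgue.
        measure (completion (P x)) {\<omega> \<in> space (P x). subordinate (killed W D) S t \<omega> \<in> Some ` D})"

end

theory Submission
  imports Defs
begin

text \<open>
  Let \<open>X t = W (S t)\<close> start at \<open>0\<close>. Started at \<open>x\<close> in \<open>(a, b)\<close>, the process has left the interval by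
  time \<open>t\<close> exactly when \<open>x + inf X \<le> a\<close> or \<open>b \<le> x + sup X\<close>, the extremes being taken over \<open>[0, t]\<close>;
  mere contact with the boundary, where the equivalence can fail, has positive probability for at most
  countably many \<open>x\<close>. The starting points with this property have total length \<open>min (b - a) (sup X - inf X)\<close>. Integrating over \<open>x\<close> before
  averaging over paths therefore turns the heat loss into the mean of \<open>min (b - a) r\<close>, where \<open>r\<close> is the
  range of \<open>X\<close> over \<open>[0, t]\<close>. For the killed process the same holds with the range of \<open>W\<close> over all of
  \<open>[0, S t]\<close>, because killing sees every point of the Brownian path. By self-similarity both ranges are
  \<open>t powr (1 / \<alpha>)\<close> times, in law, the ranges at time one (lemma \<open>heat_content_formula\<close>), so after
  division by \<open>t powr (1 / \<alpha>)\<close> the truncation disappears as \<open>t\<close> tends to \<open>0\<close> and the limits are the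
  mean ranges at time one (lemma \<open>truncated_mean_tendsto\<close>).

  It remains to compare the two mean ranges (lemma \<open>mean_visited_range_less\<close>). The range of \<open>X\<close> over
  \<open>[0, 1]\<close> is at most that of \<open>W\<close> over \<open>[0, S 1]\<close>. The latter is integrable: a chaining argument bounds
  the mean of \<open>sup \<bar>W\<bar>\<close> over \<open>[0, v]\<close> by a multiple of \<open>sqrt v\<close>, the tail of \<open>S 1\<close> decays like
  \<open>c powr (- \<alpha> / 2)\<close>, and \<open>\<alpha> / 2 > 1 / 2\<close>. The two ranges differ with positive probability: the
  subordinator crosses a long interval \<open>(u, S 1 - u)\<close> in a single jump with positive probability
  (lemma \<open>one_jump_probability\<close>), and independently \<open>W\<close> attains inside this interval a value larger
  than all its values near the two ends (lemma \<open>excursion_probability\<close>).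

  The laws \<open>P x\<close> for different \<open>x\<close> have no relation to each other beyond the properties of \<open>W\<close> and \<open>S\<close>.
  Translation and scaling are hence arguments about laws: the rescaled pair is again a Brownian motion
  from \<open>0\<close> with an independent stable subordinator, and these properties determine the law of the pair
  of paths (lemma \<open>pair_law_eq\<close>).
\<close>

section \<open>Uniqueness of laws\<close>

text \<open>Integrate the exponential series term by term; boundedness of the support dominates it by the
  series of \<open>exp \<bar>t\<bar>\<close>.\<close>

lemma char_sums_moments:
  assumes "real_distribution M" and bd: "AE x in M. \<bar>x\<bar> \<le> 1"
  shows "(\<lambda>n. (\<i> * of_real t) ^ n /\<^sub>R fact n * of_real (\<integral>x. x ^ n \<partial>M)) sums char M t"
proof -
  interpret real_distribution M by fact
  define f :: "nat \<Rightarrow> real \<Rightarrow> complex" where "f n x = (\<i> * of_real (t * x)) ^ n /\<^sub>R fact n" for n x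
  have meas[measurable]: "f n \<in> borel_measurable M" for n
    unfolding f_def by measurable
  have bdn: "AE x in M. norm (f n x) \<le> \<bar>t\<bar> ^ n /\<^sub>R fact n" for n
    using bd
  proof eventually_elim
    case (elim x)
    then have "\<bar>t * x\<bar> \<le> \<bar>t\<bar>" by (simp add: abs_mult mult_left_le)
    then have "\<bar>t * x\<bar> ^ n \<le> \<bar>t\<bar> ^ n" by (rule power_mono) simp
    then show ?case by (simp add: f_def norm_mult norm_power abs_mult divide_simps power_mult_distrib)
  qed
  have int: "integrable M (f n)" for n
    by (rule integrable_const_bound[OF bdn]) simp
  have exps: "(\<lambda>n. \<bar>t\<bar> ^ n /\<^sub>R fact n) sums exp \<bar>t\<bar>" by (rule exp_converges)
  have "(\<lambda>n. \<integral>x. f n x \<partial>M) sums (\<integral>x. (\<Sum>n. f n x) \<partial>M)"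
  proof (rule sums_integral[OF int])
    show "AE x in M. summable (\<lambda>n. norm (f n x))"
    proof (rule AE_I2)
      fix x
      have "norm (f n x) = \<bar>t * x\<bar> ^ n /\<^sub>R fact n" for n
        by (simp add: f_def norm_mult norm_power abs_mult power_mult_distrib)
      then show "summable (\<lambda>n. norm (f n x))"
        using exp_converges[of "\<bar>t * x\<bar>"] by (simp add: sums_iff)
    qed
    show "summable (\<lambda>n. \<integral>x. norm (f n x) \<partial>M)"
    proof (rule summable_comparison_test')
      show "summable (\<lambda>n. \<bar>t\<bar> ^ n /\<^sub>R fact n)" using exps by (simp add: sums_iff)
      fix n :: nat assume "n \<ge> 0"
      have "(\<integral>x. norm (f n x) \<partial>M) \<le> (\<integral>x. \<bar>t\<bar> ^ n /\<^sub>R fact n \<partial>M)"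
        by (rule integral_mono_AE) (use int bdn in auto)
      then show "norm (\<integral>x. norm (f n x) \<partial>M) \<le> \<bar>t\<bar> ^ n /\<^sub>R fact n"
        using prob_space by (simp add: space_eq_univ)
    qed
  qed
  moreover have "(\<Sum>n. f n x) = exp (\<i> * of_real (t * x))" for x
    using exp_converges[of "\<i> * of_real (t * x)"] by (simp add: sums_iff f_def)
  moreover have "(\<integral>x. f n x \<partial>M) = (\<i> * of_real t) ^ n /\<^sub>R fact n * of_real (\<integral>x. x ^ n \<partial>M)" for n
  proof -
    have "f n x = (\<i> * of_real t) ^ n /\<^sub>R fact n * of_real (x ^ n)" for x
      by (simp add: f_def power_mult_distrib scaleR_conv_of_real)
    then show ?thesis by (simp only: integral_mult_right_zero integral_complex_of_real)
  qed
  ultimately show ?thesis by (simp add: char_def)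
qed

lemma distribution_eq_moments:
  assumes "real_distribution M" "AE x in M. \<bar>x\<bar> \<le> 1"
    and "real_distribution N" "AE x in N. \<bar>x\<bar> \<le> 1"
    and eq: "\<And>n::nat. (\<integral>x. x ^ n \<partial>M) = (\<integral>x. x ^ n \<partial>N)"
  shows "M = N"
proof (rule Levy_uniqueness)
  show "char M = char N"
    using char_sums_moments[OF assms(1,2)] char_sums_moments[OF assms(3,4)]
    by (auto simp: eq intro: sums_unique2)
qed (use assms in auto)

text \<open>The Laplace transform of \<open>X\<close> at the positive integers lists the moments of \<open>exp (- X)\<close>, which lies
  in \<open>[0, 1]\<close>, and moments determine a law of bounded support.\<close>

lemma distr_eq_laplace:
  assumes "prob_space M" "prob_space N"
    and [measurable]: "X \<in> borel_measurable M" "Y \<in> borel_measurable N"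
    and X: "AE \<omega> in M. (0::real) \<le> X \<omega>" and Y: "AE \<omega> in N. (0::real) \<le> Y \<omega>"
    and eq: "\<And>u. 0 < u \<Longrightarrow> (\<integral>\<omega>. exp (- u * X \<omega>) \<partial>M) = (\<integral>\<omega>. exp (- u * Y \<omega>) \<partial>N)"
  shows "distr M borel X = distr N borel Y"
proof -
  interpret M: prob_space M by fact
  interpret N: prob_space N by fact
  let ?X = "\<lambda>\<omega>. exp (- X \<omega>)" and ?Y = "\<lambda>\<omega>. exp (- Y \<omega>)"
  have "distr M borel ?X = distr N borel ?Y"
  proof (rule distribution_eq_moments)
    show "real_distribution (distr M borel ?X)" "real_distribution (distr N borel ?Y)"
      by (simp_all add: M.real_distribution_distr N.real_distribution_distr)
    show "AE x in distr M borel ?X. \<bar>x\<bar> \<le> 1" "AE x in distr N borel ?Y. \<bar>x\<bar> \<le> 1"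
      using X Y by (auto simp: AE_distr_iff)
    fix n :: nat
    show "(\<integral>x. x ^ n \<partial>distr M borel ?X) = (\<integral>x. x ^ n \<partial>distr N borel ?Y)"
      using eq[of n] by (cases "n = 0")
        (simp_all del: power_0 add: integral_distr M.prob_space N.prob_space exp_of_nat_mult[symmetric])
  qed
  then have "distr (distr M borel ?X) borel (\<lambda>y. - ln y) = distr (distr N borel ?Y) borel (\<lambda>y. - ln y)"
    by simp
  then show ?thesis by (simp add: distr_distr comp_def)
qed

definition path_law :: "'a measure \<Rightarrow> (real \<Rightarrow> 'a \<Rightarrow> real) \<Rightarrow> (real \<Rightarrow> real) measure" where
  "path_law M X = distr M (PiM {0..} (\<lambda>_. borel)) (\<lambda>\<omega>. \<lambda>t\<in>{0..}. X t \<omega>)"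

text \<open>A cylinder set at finitely many times is a set of values of partial sums of the increments between
  these times, and the joint law of independent increments is the product of their laws.\<close>

lemma path_law_eq_increments:
  assumes "prob_space M" "prob_space N"
    and mX: "\<And>t. 0 \<le> t \<Longrightarrow> X t \<in> borel_measurable M"
    and mY: "\<And>t. 0 \<le> t \<Longrightarrow> Y t \<in> borel_measurable N"
    and X0: "AE \<omega> in M. X 0 \<omega> = 0" and Y0: "AE \<omega> in N. Y 0 \<omega> = 0"
    and iX: "indep_increments M X" and iY: "indep_increments N Y"
    and eq: "\<And>s t. 0 \<le> s \<Longrightarrow> s < t \<Longrightarrow>
      distr M borel (\<lambda>\<omega>. X t \<omega> - X s \<omega>) = distr N borel (\<lambda>\<omega>. Y t \<omega> - Y s \<omega>)"
  shows "path_law M X = path_law N Y"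
proof -
  interpret M: prob_space M by fact
  interpret N: prob_space N by fact
  let ?P = "PiM {0..} (\<lambda>_. borel) :: (real \<Rightarrow> real) measure"
  have pX[measurable]: "(\<lambda>\<omega>. \<lambda>t\<in>{0..}. X t \<omega>) \<in> measurable M ?P"
    by (rule measurable_restrict) (simp add: mX)
  have pY[measurable]: "(\<lambda>\<omega>. \<lambda>t\<in>{0..}. Y t \<omega>) \<in> measurable N ?P"
    by (rule measurable_restrict) (simp add: mY)
  show ?thesis
  proof (rule measure_eqI_PiM_infinite)
    show "finite_measure (path_law M X)"
      unfolding path_law_def using M.prob_space_distr[OF pX] by (simp add: prob_space.finite_measure)
    fix A :: "real \<Rightarrow> real set" and J :: "real set"
    assume J: "finite J" "J \<subseteq> {0..}" and A: "\<And>i. i \<in> J \<Longrightarrow> A i \<in> sets borel"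
    \<comment> \<open>The time \<open>0\<close> makes the increments sum to the values of the process; the time \<open>1\<close> ensures that there is an increment.\<close>
    define ts where "ts = sorted_list_of_set (insert 0 (insert 1 J))"
    define n where "n = length ts - 1"
    define t where "t i = ts ! i" for i
    have ts: "sorted ts" "distinct ts" "set ts = insert 0 (insert 1 J)"
      unfolding ts_def using J by (simp_all del: sorted_list_of_set_insert_remove)
    have len: "length ts = Suc n" "0 < n"
    proof -
      have "card (set ts) = length ts" using distinct_card[OF ts(2)] .
      moreover have "card {0, 1::real} \<le> card (set ts)"
        unfolding ts(3) by (rule card_mono) (auto simp: J)
      ultimately show "length ts = Suc n" "0 < n" by (auto simp: n_def)
    qed
    have inc: "t i < t (Suc i)" if "i < n" for i
      using sorted_wrt_nth_less[of "(<)" ts i "Suc i"] ts that len by (simp add: t_def strict_sorted_iff)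
    have nn: "0 \<le> t i" if "i \<le> n" for i
    proof -
      have "t i \<in> set ts" using that len by (simp add: t_def)
      then show ?thesis using J ts by auto
    qed
    have t0: "t 0 = 0"
    proof -
      obtain i where i: "i \<le> n" "t i = 0"
        using ts len by (metis in_set_conv_nth insertI1 less_Suc_eq_le t_def)
      have "t 0 \<le> t i" using sorted_nth_mono[OF ts(1), of 0 i] i len by (simp add: t_def)
      then show ?thesis using nn[of 0] i by simp
    qed
    define I where "I = {i \<in> {..n}. t i \<in> J}"
    define B where "B = {d \<in> space (PiM {..<n} (\<lambda>_. borel :: real measure)).
        \<forall>i\<in>I. (\<Sum>k<i. d k) \<in> A (t i)}"
    have Bm: "B \<in> sets (PiM {..<n} (\<lambda>_. borel))"
      unfolding B_def
    proof (rule sets.sets_Collect_finite_All)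
      fix i assume i: "i \<in> I"
      have "(\<lambda>d. \<Sum>k<i. d k) \<in> borel_measurable (PiM {..<n} (\<lambda>_. borel :: real measure))"
        by (intro borel_measurable_sum measurable_component_singleton) (use i in \<open>auto simp: I_def\<close>)
      from measurable_sets[OF this, of "A (t i)"]
      show "{d \<in> space (PiM {..<n} (\<lambda>_. borel :: real measure)). (\<Sum>k<i. d k) \<in> A (t i)}
          \<in> sets (PiM {..<n} (\<lambda>_. borel))"
        using A i by (simp add: I_def vimage_def Int_def conj_commute)
    qed (simp add: I_def)
    have key: "emeasure (path_law K Z) (prod_emb {0..} (\<lambda>_. borel) J (Pi\<^sub>E J A)) =
        emeasure (PiM {..<n} (\<lambda>i. distr K borel (\<lambda>\<omega>. Z (t (Suc i)) \<omega> - Z (t i) \<omega>))) B"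
      if "prob_space K" and mZ: "\<And>t. 0 \<le> t \<Longrightarrow> Z t \<in> borel_measurable K"
        and Z0: "AE \<omega> in K. Z 0 \<omega> = 0" and iZ: "indep_increments K Z" for K :: "'c measure" and Z
    proof -
      interpret K: prob_space K by fact
      let ?D = "\<lambda>i \<omega>. Z (t (Suc i)) \<omega> - Z (t i) \<omega>"
      have pZ: "(\<lambda>\<omega>. \<lambda>t\<in>{0..}. Z t \<omega>) \<in> measurable K ?P"
        by (rule measurable_restrict) (simp add: mZ)
      have mD: "?D i \<in> borel_measurable K" if "i < n" for i
        using mZ nn that by (auto intro!: borel_measurable_diff)
      have ind: "K.indep_vars (\<lambda>_. borel) ?D {..<n}"
        using iZ inc t0 unfolding indep_increments_def by auto
      have eqD: "distr K (PiM {..<n} (\<lambda>_. borel)) (\<lambda>\<omega>. \<lambda>i\<in>{..<n}. ?D i \<omega>) =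
         PiM {..<n} (\<lambda>i. distr K borel (?D i))"
        using ind len mD by (subst (asm) K.indep_vars_iff_distr_eq_PiM') auto
      have m2: "(\<lambda>\<omega>. \<lambda>i\<in>{..<n}. ?D i \<omega>) \<in> measurable K (PiM {..<n} (\<lambda>_. borel))"
        by (rule measurable_restrict) (simp add: mD)
      have "emeasure (path_law K Z) (prod_emb {0..} (\<lambda>_. borel) J (Pi\<^sub>E J A)) =
        emeasure K ((\<lambda>\<omega>. \<lambda>t\<in>{0..}. Z t \<omega>) -` prod_emb {0..} (\<lambda>_. borel) J (Pi\<^sub>E J A) \<inter> space K)"
        unfolding path_law_def by (rule emeasure_distr[OF pZ]) (use J A in \<open>auto intro!: sets_PiM_I\<close>)
      also have "\<dots> = emeasure K ((\<lambda>\<omega>. \<lambda>i\<in>{..<n}. ?D i \<omega>) -` B \<inter> space K)"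
      proof (rule emeasure_eq_AE)
        show "(\<lambda>\<omega>. \<lambda>t\<in>{0..}. Z t \<omega>) -` prod_emb {0..} (\<lambda>_. borel) J (Pi\<^sub>E J A) \<inter> space K \<in> sets K"
          by (rule measurable_sets[OF pZ]) (use J A in \<open>auto intro!: sets_PiM_I\<close>)
        show "(\<lambda>\<omega>. \<lambda>i\<in>{..<n}. ?D i \<omega>) -` B \<inter> space K \<in> sets K"
          by (rule measurable_sets[OF m2 Bm])
        show "AE \<omega> in K. (\<omega> \<in> (\<lambda>\<omega>. \<lambda>t\<in>{0..}. Z t \<omega>) -` prod_emb {0..} (\<lambda>_. borel) J (Pi\<^sub>E J A) \<inter> space K) =
            (\<omega> \<in> (\<lambda>\<omega>. \<lambda>i\<in>{..<n}. ?D i \<omega>) -` B \<inter> space K)"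
          using Z0
        proof eventually_elim
          case (elim \<omega>)
          have tel: "(\<Sum>k<i. ?D k \<omega>) = Z (t i) \<omega>" for i
            using sum_lessThan_telescope[of "\<lambda>i. Z (t i) \<omega>" i] elim by (simp add: t0)
          have part: "(\<Sum>k<i. (\<lambda>i\<in>{..<n}. ?D i \<omega>) k) = Z (t i) \<omega>" if "i \<in> I" for i
          proof -
            have "(\<Sum>k<i. (\<lambda>i\<in>{..<n}. ?D i \<omega>) k) = (\<Sum>k<i. ?D k \<omega>)"
              using that by (intro sum.cong) (auto simp: I_def)
            then show ?thesis by (simp only: tel)
          qed
          have "J = t ` I"
          proof
            show "J \<subseteq> t ` I"
            proof
              fix j assume j: "j \<in> J"
              then obtain i where "i < length ts" "ts ! i = j"
                using ts(3) by (metis in_set_conv_nth insertI2)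
              then show "j \<in> t ` I" using j len by (auto simp: I_def t_def)
            qed
          qed (auto simp: I_def)
          then have "(\<forall>j\<in>J. Z j \<omega> \<in> A j) \<longleftrightarrow> (\<forall>i\<in>I. Z (t i) \<omega> \<in> A (t i))" by auto
          moreover have "(\<lambda>t\<in>{0..}. Z t \<omega>) \<in> prod_emb {0..} (\<lambda>_. borel) J (Pi\<^sub>E J A) \<longleftrightarrow>
              (\<forall>j\<in>J. Z j \<omega> \<in> A j)"
            using J by (auto simp: prod_emb_def space_PiM PiE_iff subset_eq)
          moreover have "(\<lambda>i\<in>{..<n}. ?D i \<omega>) \<in> B \<longleftrightarrow> (\<forall>i\<in>I. Z (t i) \<omega> \<in> A (t i))"
            unfolding B_def using part by (auto simp: space_PiM PiE_iff)
          ultimately show ?case by simp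
        qed
      qed
      also have "\<dots> = emeasure (distr K (PiM {..<n} (\<lambda>_. borel)) (\<lambda>\<omega>. \<lambda>i\<in>{..<n}. ?D i \<omega>)) B"
        by (rule emeasure_distr[symmetric, OF m2 Bm])
      finally show ?thesis by (simp add: eqD)
    qed
    have "PiM {..<n} (\<lambda>i. distr M borel (\<lambda>\<omega>. X (t (Suc i)) \<omega> - X (t i) \<omega>)) =
       PiM {..<n} (\<lambda>i. distr N borel (\<lambda>\<omega>. Y (t (Suc i)) \<omega> - Y (t i) \<omega>))"
      by (intro PiM_cong refl eq) (use inc nn in auto)
    then show "emeasure (path_law M X) (prod_emb {0..} (\<lambda>_. borel) J (Pi\<^sub>E J A)) =
       emeasure (path_law N Y) (prod_emb {0..} (\<lambda>_. borel) J (Pi\<^sub>E J A))"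
      using key[OF assms(1) mX X0 iX] key[OF assms(2) mY Y0 iY] by simp
  qed (simp_all add: path_law_def)
qed

section \<open>Translation and scaling\<close>

lemma indep_increments_affine:
  assumes "prob_space M" "indep_increments M X" "0 < c" "0 \<le> d"
  shows "indep_increments M (\<lambda>u \<omega>. (X (d + c * u) \<omega> - y \<omega>) / k)"
  unfolding indep_increments_def
proof (intro allI impI)
  interpret prob_space M by fact
  fix n :: nat and t :: "nat \<Rightarrow> real"
  assume t: "0 \<le> t 0 \<and> (\<forall>i<n. t i < t (Suc i))"
  have "indep_vars (\<lambda>_. borel) (\<lambda>i \<omega>. X (d + c * t (Suc i)) \<omega> - X (d + c * t i) \<omega>) {..<n}"
    using assms(2)[unfolded indep_increments_def, rule_format, of "\<lambda>i. d + c * t i" n] t assms(3,4)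
    by simp
  then have "indep_vars (\<lambda>_. borel) (\<lambda>i \<omega>. (X (d + c * t (Suc i)) \<omega> - X (d + c * t i) \<omega>) / k) {..<n}"
    by (rule indep_vars_compose2) simp
  then show "indep_vars (\<lambda>_. borel) (\<lambda>i \<omega>. (X (d + c * t (Suc i)) \<omega> - y \<omega>) / k - (X (d + c * t i) \<omega> - y \<omega>) / k) {..<n}"
    by (simp add: diff_divide_distrib[symmetric])
qed

text \<open>Brownian scaling, combined with moving the starting point to the origin.\<close>

lemma brownian_motion_rescale:
  assumes "prob_space M" and W: "brownian_motion M x W" and c: "0 < c"
  shows "brownian_motion M 0 (\<lambda>u \<omega>. (W (c\<^sup>2 * u) \<omega> - x) / c)"
proof -
  interpret prob_space M by fact
  have m: "\<And>t. 0 \<le> t \<Longrightarrow> W t \<in> borel_measurable M" and W0: "AE \<omega> in M. W 0 \<omega> = x"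
    and ind: "indep_increments M W"
    and cont: "AE \<omega> in M. continuous_on {0..} (\<lambda>t. W t \<omega>)"
    and nrm: "\<And>s t. 0 \<le> s \<Longrightarrow> s < t \<Longrightarrow>
       distributed M lborel (\<lambda>\<omega>. W t \<omega> - W s \<omega>) (normal_density 0 (sqrt (2 * (t - s))))"
    using W by (auto simp: brownian_motion_def)
  show ?thesis
    unfolding brownian_motion_def
  proof (intro conjI allI impI)
    fix t :: real assume "0 \<le> t"
    then show "(\<lambda>\<omega>. (W (c\<^sup>2 * t) \<omega> - x) / c) \<in> borel_measurable M"
      using m[of "c\<^sup>2 * t"] by simp
  next
    show "AE \<omega> in M. (W (c\<^sup>2 * 0) \<omega> - x) / c = 0" using W0 by auto
  next
    show "indep_increments M (\<lambda>u \<omega>. (W (c\<^sup>2 * u) \<omega> - x) / c)"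
      using indep_increments_affine[OF assms(1) ind, of "c\<^sup>2" 0 "\<lambda>_. x" c] c by simp
  next
    fix s t :: real assume st: "0 \<le> s \<and> s < t"
    have "distributed M lborel (\<lambda>\<omega>. W (c\<^sup>2 * t) \<omega> - W (c\<^sup>2 * s) \<omega>)
        (normal_density 0 (sqrt (2 * (c\<^sup>2 * t - c\<^sup>2 * s))))"
      using nrm[of "c\<^sup>2 * s" "c\<^sup>2 * t"] st c by simp
    from normal_density_affine[OF this, of "1 / c" 0]
    have "distributed M lborel (\<lambda>\<omega>. 1 / c * (W (c\<^sup>2 * t) \<omega> - W (c\<^sup>2 * s) \<omega>))
        (normal_density 0 (\<bar>1 / c\<bar> * sqrt (2 * (c\<^sup>2 * t - c\<^sup>2 * s))))"
      using st c by simp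
    moreover have "\<bar>1 / c\<bar> * sqrt (2 * (c\<^sup>2 * t - c\<^sup>2 * s)) = sqrt (2 * (t - s))"
    proof -
      have "2 * (c\<^sup>2 * t - c\<^sup>2 * s) = c\<^sup>2 * (2 * (t - s))" by (simp add: algebra_simps)
      then have "sqrt (2 * (c\<^sup>2 * t - c\<^sup>2 * s)) = c * sqrt (2 * (t - s))"
        using c by (simp only: real_sqrt_mult) simp
      then show ?thesis using c by simp
    qed
    moreover have "(\<lambda>\<omega>. (W (c\<^sup>2 * t) \<omega> - x) / c - (W (c\<^sup>2 * s) \<omega> - x) / c) =
        (\<lambda>\<omega>. 1 / c * (W (c\<^sup>2 * t) \<omega> - W (c\<^sup>2 * s) \<omega>))"
      using c by (auto simp: fun_eq_iff field_simps)
    ultimately show "distributed M lborel (\<lambda>\<omega>. (W (c\<^sup>2 * t) \<omega> - x) / c - (W (c\<^sup>2 * s) \<omega> - x) / c)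
        (normal_density 0 (sqrt (2 * (t - s))))" by simp
  next
    show "AE \<omega> in M. continuous_on {0..} (\<lambda>t. (W (c\<^sup>2 * t) \<omega> - x) / c)"
      using cont
    proof eventually_elim
      case (elim \<omega>)
      have "continuous_on {0..} (\<lambda>t. W (c\<^sup>2 * t) \<omega>)"
        by (rule continuous_on_compose2[OF elim]) (auto intro!: continuous_intros)
      then show ?case using c by (auto intro!: continuous_intros)
    qed
  qed
qed

lemma brownian_motion_shift:
  assumes "prob_space M" and W: "brownian_motion M x W" and v: "0 \<le> v"
  shows "brownian_motion M 0 (\<lambda>u \<omega>. W (v + u) \<omega> - W v \<omega>)"
proof -
  interpret prob_space M by fact
  have m: "\<And>t. 0 \<le> t \<Longrightarrow> W t \<in> borel_measurable M"
    and ind: "indep_increments M W"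
    and cont: "AE \<omega> in M. continuous_on {0..} (\<lambda>t. W t \<omega>)"
    and nrm: "\<And>s t. 0 \<le> s \<Longrightarrow> s < t \<Longrightarrow>
       distributed M lborel (\<lambda>\<omega>. W t \<omega> - W s \<omega>) (normal_density 0 (sqrt (2 * (t - s))))"
    using W by (auto simp: brownian_motion_def)
  show ?thesis
    unfolding brownian_motion_def
  proof (intro conjI allI impI)
    fix t :: real assume "0 \<le> t"
    then show "(\<lambda>\<omega>. W (v + t) \<omega> - W v \<omega>) \<in> borel_measurable M"
      using m v by (intro borel_measurable_diff) auto
  next
    show "indep_increments M (\<lambda>u \<omega>. W (v + u) \<omega> - W v \<omega>)"
      using indep_increments_affine[OF assms(1) ind, of 1 v "W v" 1] v by simp
  next
    fix s t :: real assume st: "0 \<le> s \<and> s < t"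
    then show "distributed M lborel (\<lambda>\<omega>. W (v + t) \<omega> - W v \<omega> - (W (v + s) \<omega> - W v \<omega>))
        (normal_density 0 (sqrt (2 * (t - s))))"
      using nrm[of "v + s" "v + t"] v by simp
  next
    show "AE \<omega> in M. continuous_on {0..} (\<lambda>t. W (v + t) \<omega> - W v \<omega>)"
      using cont
    proof eventually_elim
      case (elim \<omega>)
      have "continuous_on {0..} (\<lambda>t. W (v + t) \<omega>)"
        by (rule continuous_on_compose2[OF elim]) (use v in \<open>auto intro!: continuous_intros\<close>)
      then show ?case by (auto intro!: continuous_intros)
    qed
  qed simp
qed

lemma cadlag_rescale:
  assumes f: "cadlag f" and t: "0 < t"
  shows "cadlag (\<lambda>u. f (t * u) / c)"
  unfolding cadlag_def
proof (intro conjI allI impI)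
  fix a :: real assume "0 \<le> a"
  then have "(f \<longlongrightarrow> f (t * a)) (at_right (t * a))"
    using f t by (simp add: cadlag_def)
  then have "((\<lambda>u. f (t * u)) \<longlongrightarrow> f (t * a)) (at_right a)"
    using filtermap_times_pos_at_right[OF t, of a]
    by (metis (no_types, lifting) ext filterlim_filtermap)
  then show "((\<lambda>u. f (t * u) / c) \<longlongrightarrow> f (t * a) / c) (at_right a)"
    unfolding divide_inverse by (rule tendsto_mult_right)
next
  fix a :: real assume "0 < a"
  then obtain l where "(f \<longlongrightarrow> l) (at_left (t * a))"
    using f t unfolding cadlag_def by (meson mult_pos_pos)
  moreover have "filterlim (\<lambda>u. t * u) (at_left (t * a)) (at_left a)"
    unfolding filterlim_at using t
    by (auto intro!: tendsto_intros simp: eventually_at_filter)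
  ultimately have "((\<lambda>u. f (t * u)) \<longlongrightarrow> l) (at_left a)"
    by (rule filterlim_compose)
  then have "((\<lambda>u. f (t * u) / c) \<longlongrightarrow> l / c) (at_left a)"
    unfolding divide_inverse by (rule tendsto_mult_right)
  then show "\<exists>l. ((\<lambda>u. f (t * u) / c) \<longlongrightarrow> l) (at_left a)" by blast
qed

lemma stable_subordinator_rescale:
  assumes "prob_space M" and S: "stable_subordinator M \<beta> S"
    and t: "0 < t" and c: "0 < c" "c powr \<beta> = t"
  shows "stable_subordinator M \<beta> (\<lambda>u \<omega>. S (t * u) \<omega> / c)"
proof -
  interpret prob_space M by fact
  have m: "\<And>t. 0 \<le> t \<Longrightarrow> S t \<in> borel_measurable M" and S0: "AE \<omega> in M. S 0 \<omega> = 0"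
    and ind: "indep_increments M S"
    and cad: "AE \<omega> in M. cadlag (\<lambda>t. S t \<omega>)"
    and stat: "\<And>s t. 0 \<le> s \<Longrightarrow> s < t \<Longrightarrow>
       distr M borel (\<lambda>\<omega>. S t \<omega> - S s \<omega>) = distr M borel (S (t - s))"
    and mono: "AE \<omega> in M. mono_on {0..} (\<lambda>t. S t \<omega>)"
    and lap: "\<And>u t. 0 < u \<Longrightarrow> 0 \<le> t \<Longrightarrow> (\<integral>\<omega>. exp (- u * S t \<omega>) \<partial>M) = exp (- t * u powr \<beta>)"
    using S by (auto simp: stable_subordinator_def levy_process_def)
  have "levy_process M (\<lambda>u \<omega>. S (t * u) \<omega> / c)"
    unfolding levy_process_def
  proof (intro conjI allI impI)
    fix u :: real assume "0 \<le> u"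
    then show "(\<lambda>\<omega>. S (t * u) \<omega> / c) \<in> borel_measurable M"
      using m[of "t * u"] t by simp
  next
    show "AE \<omega> in M. S (t * 0) \<omega> / c = 0" using S0 by auto
  next
    show "indep_increments M (\<lambda>u \<omega>. S (t * u) \<omega> / c)"
      using indep_increments_affine[OF assms(1) ind, of t 0 "\<lambda>_. 0" c] t by simp
  next
    fix r u :: real assume ru: "0 \<le> r \<and> r < u"
    have eq: "distr M borel (\<lambda>\<omega>. S (t * u) \<omega> - S (t * r) \<omega>) = distr M borel (S (t * (u - r)))"
      using stat[of "t * r" "t * u"] ru t by (simp add: algebra_simps)
    have [measurable]: "S (t * u) \<in> borel_measurable M" "S (t * r) \<in> borel_measurable M"
      "S (t * (u - r)) \<in> borel_measurable M"
      using m ru t by auto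
    have "distr (distr M borel (\<lambda>\<omega>. S (t * u) \<omega> - S (t * r) \<omega>)) borel (\<lambda>y. y / c) =
        distr (distr M borel (S (t * (u - r)))) borel (\<lambda>y. y / c)"
      by (simp only: eq)
    then show "distr M borel (\<lambda>\<omega>. S (t * u) \<omega> / c - S (t * r) \<omega> / c) =
        distr M borel (\<lambda>\<omega>. S (t * (u - r)) \<omega> / c)"
      by (simp add: distr_distr comp_def diff_divide_distrib)
  next
    show "AE \<omega> in M. cadlag (\<lambda>u. S (t * u) \<omega> / c)"
      using cad by eventually_elim (rule cadlag_rescale[OF _ t])
  qed
  moreover have "AE \<omega> in M. mono_on {0..} (\<lambda>u. S (t * u) \<omega> / c)"
    using mono by eventually_elim
      (use t c in \<open>auto simp: mono_on_def intro!: divide_right_mono\<close>)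
  moreover have "(\<integral>\<omega>. exp (- u * (S (t * r) \<omega> / c)) \<partial>M) = exp (- r * u powr \<beta>)"
    if "0 < u" "0 \<le> r" for u r
  proof -
    have "(\<integral>\<omega>. exp (- u * (S (t * r) \<omega> / c)) \<partial>M) = (\<integral>\<omega>. exp (- (u / c) * S (t * r) \<omega>) \<partial>M)"
      by simp
    also have "\<dots> = exp (- (t * r) * (u / c) powr \<beta>)"
      using that t c by (intro lap) auto
    also have "(u / c) powr \<beta> = u powr \<beta> / t"
      using that c by (simp add: powr_divide)
    finally show ?thesis using t by simp
  qed
  ultimately show ?thesis by (simp add: stable_subordinator_def)
qed

lemma indep_processes_rescale:
  assumes "prob_space M" and ind: "indep_processes M W S" and t: "0 \<le> t" and d: "0 \<le> d"
  shows "indep_processes M (\<lambda>u \<omega>. (W (d * u) \<omega> - x) / k) (\<lambda>u \<omega>. S (t * u) \<omega> / c)"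
proof -
  interpret prob_space M by fact
  let ?P = "PiM {0..} (\<lambda>_. borel) :: (real \<Rightarrow> real) measure"
  let ?f = "\<lambda>w. \<lambda>u\<in>{0::real..}. (w (d * u) - x) / k"
  let ?g = "\<lambda>s. \<lambda>u\<in>{0::real..}. s (t * u) / c"
  have "?f \<in> measurable ?P ?P" "?g \<in> measurable ?P ?P"
    by (intro measurable_restrict borel_measurable_divide borel_measurable_diff
        measurable_component_singleton borel_measurable_const; use t d in simp)+
  from indep_var_compose[OF ind[unfolded indep_processes_def] this]
  have "indep_var ?P (?f \<circ> (\<lambda>\<omega>. \<lambda>t\<in>{0..}. W t \<omega>)) ?P (?g \<circ> (\<lambda>\<omega>. \<lambda>t\<in>{0..}. S t \<omega>))" .
  also have "?f \<circ> (\<lambda>\<omega>. \<lambda>t\<in>{0..}. W t \<omega>) = (\<lambda>\<omega>. \<lambda>u\<in>{0..}. (W (d * u) \<omega> - x) / k)"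
    using d by (auto simp: fun_eq_iff restrict_def)
  also have "?g \<circ> (\<lambda>\<omega>. \<lambda>t\<in>{0..}. S t \<omega>) = (\<lambda>\<omega>. \<lambda>u\<in>{0..}. S (t * u) \<omega> / c)"
    using t by (auto simp: fun_eq_iff restrict_def)
  finally show ?thesis by (simp add: indep_processes_def restrict_def)
qed

text \<open>The pairs of processes to which every pair in the problem is reduced by translation and scaling.\<close>

definition standard_pair :: "'a measure \<Rightarrow> real \<Rightarrow> (real \<Rightarrow> 'a \<Rightarrow> real) \<Rightarrow> (real \<Rightarrow> 'a \<Rightarrow> real) \<Rightarrow> bool" where
  "standard_pair M \<beta> W S \<longleftrightarrow> prob_space M \<and> brownian_motion M 0 W \<and>
     stable_subordinator M \<beta> S \<and> indep_processes M W S"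

definition pair_law :: "'a measure \<Rightarrow> (real \<Rightarrow> 'a \<Rightarrow> real) \<Rightarrow> (real \<Rightarrow> 'a \<Rightarrow> real) \<Rightarrow>
    ((real \<Rightarrow> real) \<times> (real \<Rightarrow> real)) measure" where
  "pair_law M W S = distr M (PiM {0..} (\<lambda>_. borel) \<Otimes>\<^sub>M PiM {0..} (\<lambda>_. borel))
     (\<lambda>\<omega>. (\<lambda>t\<in>{0..}. W t \<omega>, \<lambda>t\<in>{0..}. S t \<omega>))"

text \<open>Being started at \<open>0\<close> and monotone, a subordinator is nonnegative; this is what makes its Laplace
  transform determine its law.\<close>

lemma subordinator_nonneg:
  assumes S: "stable_subordinator M \<beta> S" and t: "0 \<le> t"
  shows "AE \<omega> in M. 0 \<le> S t \<omega>"
proof -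
  have "AE \<omega> in M. S 0 \<omega> = 0" "AE \<omega> in M. mono_on {0..} (\<lambda>t. S t \<omega>)"
    using S by (auto simp: stable_subordinator_def levy_process_def)
  then show ?thesis
    by eventually_elim (use t in \<open>force simp: mono_on_def\<close>)
qed

lemma path_law_brownian_eq:
  assumes "prob_space M" "prob_space N" "brownian_motion M 0 W" "brownian_motion N 0 W'"
  shows "path_law M W = path_law N W'"
proof (rule path_law_eq_increments[OF assms(1,2)])
  fix s t :: real assume st: "0 \<le> s" "s < t"
  have "distr K borel (\<lambda>\<omega>. Z t \<omega> - Z s \<omega>) = density lborel (normal_density 0 (sqrt (2 * (t - s))))"
    if "brownian_motion K 0 Z" for K :: "'d measure" and Z
  proof -
    have "distributed K lborel (\<lambda>\<omega>. Z t \<omega> - Z s \<omega>) (normal_density 0 (sqrt (2 * (t - s))))"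
      using that st by (auto simp: brownian_motion_def)
    then have "distr K lborel (\<lambda>\<omega>. Z t \<omega> - Z s \<omega>) = density lborel (normal_density 0 (sqrt (2 * (t - s))))"
      by (simp add: distributed_def)
    moreover have "distr K lborel (\<lambda>\<omega>. Z t \<omega> - Z s \<omega>) = distr K borel (\<lambda>\<omega>. Z t \<omega> - Z s \<omega>)"
      by (rule distr_cong) auto
    ultimately show ?thesis by simp
  qed
  from this[OF assms(3)] this[OF assms(4)]
  show "distr M borel (\<lambda>\<omega>. W t \<omega> - W s \<omega>) = distr N borel (\<lambda>\<omega>. W' t \<omega> - W' s \<omega>)" by simp
qed (use assms in \<open>auto simp: brownian_motion_def\<close>)

lemma path_law_subordinator_eq:
  assumes "prob_space M" "prob_space N"
    and S: "stable_subordinator M \<beta> S" "stable_subordinator N \<beta> S'"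
  shows "path_law M S = path_law N S'"
proof (rule path_law_eq_increments[OF assms(1,2)])
  fix s t :: real assume st: "0 \<le> s" "s < t"
  have "distr M borel (S (t - s)) = distr N borel (S' (t - s))"
  proof (rule distr_eq_laplace[OF assms(1,2)])
    show "AE \<omega> in M. 0 \<le> S (t - s) \<omega>" "AE \<omega> in N. 0 \<le> S' (t - s) \<omega>"
      using st by (auto intro!: subordinator_nonneg S)
  qed (use S st in \<open>auto simp: stable_subordinator_def levy_process_def\<close>)
  moreover have "distr M borel (\<lambda>\<omega>. S t \<omega> - S s \<omega>) = distr M borel (S (t - s))"
      "distr N borel (\<lambda>\<omega>. S' t \<omega> - S' s \<omega>) = distr N borel (S' (t - s))"
    using S st by (auto simp: stable_subordinator_def levy_process_def)
  ultimately show "distr M borel (\<lambda>\<omega>. S t \<omega> - S s \<omega>) = distr N borel (\<lambda>\<omega>. S' t \<omega> - S' s \<omega>)"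
    by simp
qed (use S in \<open>auto simp: stable_subordinator_def levy_process_def\<close>)

lemma pair_law_indep:
  assumes "prob_space M" "indep_processes M W S"
  shows "pair_law M W S = path_law M W \<Otimes>\<^sub>M path_law M S"
  using assms prob_space.indep_var_distribution_eq[OF assms(1), of "PiM {0..} (\<lambda>_. borel)"
      "\<lambda>\<omega>. \<lambda>t\<in>{0..}. W t \<omega>" "PiM {0..} (\<lambda>_. borel)" "\<lambda>\<omega>. \<lambda>t\<in>{0..}. S t \<omega>"]
  by (simp add: indep_processes_def pair_law_def path_law_def)

lemma pair_law_eq:
  assumes "standard_pair M \<beta> W S" "standard_pair N \<beta> W' S'"
  shows "pair_law M W S = pair_law N W' S'"
  using assms unfolding standard_pair_def
  by (metis pair_law_indep path_law_brownian_eq path_law_subordinator_eq)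

text \<open>Self-similarity: \<open>W (S (t * u)) = x + \<rho> * W' (S' u)\<close> for the rescaled pair \<open>W'\<close>, \<open>S'\<close>. The condition on
  \<open>\<rho>\<close> says that \<open>\<rho>\<^sup>2 powr \<beta> = t\<close>, which is the scaling relation of the subordinator.\<close>

lemma standard_pair_rescale:
  assumes "prob_space M" "brownian_motion M x W" "stable_subordinator M \<beta> S" "indep_processes M W S"
    and "0 < \<beta>" "0 < t" "\<rho> = t powr (1 / (2 * \<beta>))"
  shows "standard_pair M \<beta> (\<lambda>u \<omega>. (W (\<rho>\<^sup>2 * u) \<omega> - x) / \<rho>) (\<lambda>u \<omega>. S (t * u) \<omega> / \<rho>\<^sup>2)"
proof -
  have "\<rho>\<^sup>2 powr \<beta> = t"
    using assms by (simp add: powr_powr powr_numeral[symmetric] del: powr_numeral)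
  then show ?thesis unfolding standard_pair_def
    using assms by (intro conjI brownian_motion_rescale stable_subordinator_rescale indep_processes_rescale) auto
qed

section \<open>Extremes of a path along random times\<close>

abbreviation path_space :: "(real \<Rightarrow> real) measure" where
  "path_space \<equiv> PiM {0..} (\<lambda>_. borel)"

definition dyadic_ceil :: "nat \<Rightarrow> real \<Rightarrow> real" where
  "dyadic_ceil n u = real (nat \<lceil>2 ^ n * u\<rceil>) / 2 ^ n"

lemma dyadic_ceil_nonneg: "0 \<le> dyadic_ceil n u"
  by (simp add: dyadic_ceil_def)

lemma inverse_power2_tendsto_0: "(\<lambda>n. c / 2 ^ n :: real) \<longlonglongrightarrow> 0"
  using tendsto_mult_right_zero[OF LIMSEQ_power_zero[of "1/2::real"], of c]
  by (simp add: power_divide)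

lemma dyadic_ceil_tendsto:
  assumes "0 \<le> u" shows "(\<lambda>n. dyadic_ceil n u) \<longlonglongrightarrow> u"
proof (rule tendsto_sandwich)
  have "real (nat \<lceil>2 ^ n * u\<rceil>) = of_int \<lceil>2 ^ n * u\<rceil>" for n
    using assms by (simp add: of_nat_nat)
  then have eq: "dyadic_ceil n u = of_int \<lceil>2 ^ n * u\<rceil> / 2 ^ n" for n
    by (simp add: dyadic_ceil_def)
  show "\<forall>\<^sub>F n in sequentially. u \<le> dyadic_ceil n u"
    by (auto simp: eq field_simps intro!: always_eventually)
  have "of_int \<lceil>2 ^ n * u\<rceil> \<le> 2 ^ n * u + 1" for n by linarith
  then show "\<forall>\<^sub>F n in sequentially. dyadic_ceil n u \<le> u + 1 / 2 ^ n"
    by (auto simp: eq field_simps intro!: always_eventually)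
  show "(\<lambda>n. u + 1 / 2 ^ n) \<longlonglongrightarrow> u"
    using tendsto_add[OF tendsto_const inverse_power2_tendsto_0[of 1], of u] by simp
qed simp

text \<open>The map taking \<open>(w, u)\<close> to \<open>w u\<close> is not measurable for the product sigma-algebra on paths. Reading \<open>w\<close> at
  the countably many dyadic points near \<open>u\<close> is, and it gives the same value on continuous paths.\<close>

definition path_at :: "(real \<Rightarrow> real) \<Rightarrow> real \<Rightarrow> real" where
  "path_at w u = lim (\<lambda>n. w (dyadic_ceil n u))"

lemma path_at_eq:
  assumes "continuous_on {0..} w" "0 \<le> u" shows "path_at w u = w u"
  unfolding path_at_def
proof (rule limI)
  show "(\<lambda>n. w (dyadic_ceil n u)) \<longlonglongrightarrow> w u"
    by (rule continuous_on_tendsto_compose[OF assms(1) dyadic_ceil_tendsto])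
      (use assms in \<open>auto simp: dyadic_ceil_nonneg\<close>)
qed

lemma path_at_restrict: "path_at (restrict w {0..}) u = path_at w u"
  by (simp add: path_at_def dyadic_ceil_nonneg)

lemma measurable_path_at [measurable]:
  assumes f: "f \<in> measurable M path_space" and [measurable]: "g \<in> borel_measurable M"
  shows "(\<lambda>x. path_at (f x) (g x)) \<in> borel_measurable M"
  unfolding path_at_def dyadic_ceil_def
proof (rule borel_measurable_lim_metric)
  fix n
  have fi: "(\<lambda>x. f x (real i / 2 ^ n)) \<in> borel_measurable M" for i
    using measurable_compose[OF f measurable_component_singleton[of "real i / 2 ^ n" "{0..}" "\<lambda>_. borel"]]
    by simp
  show "(\<lambda>x. f x (real (nat \<lceil>2 ^ n * g x\<rceil>) / 2 ^ n)) \<in> borel_measurable M"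
    by (rule measurable_compose_countable[where f="\<lambda>i x. f x (real i / 2 ^ n)" and g="\<lambda>x. nat \<lceil>2 ^ n * g x\<rceil>", OF fi])
      measurable
qed

definition dyadic_unit :: "nat \<times> nat \<Rightarrow> real" where
  "dyadic_unit p = min 1 (real (fst p) / 2 ^ snd p)"

lemma dyadic_unit_bounds: "0 \<le> dyadic_unit p" "dyadic_unit p \<le> 1"
  by (simp_all add: dyadic_unit_def)

lemma dyadic_unit_one: "dyadic_unit (1, 0) = 1"
  by (simp add: dyadic_unit_def)

text \<open>Approximation from the right, so that right continuity of the subordinator applies.\<close>

lemma dyadic_unit_dense:
  assumes "0 \<le> u" "u < 1"
  obtains p where "filterlim (\<lambda>n. dyadic_unit (p n)) (at_right u) sequentially"
proof
  define p where "p n = (nat \<lfloor>2 ^ n * u\<rfloor> + 1, n)" for n :: nat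
  have "real (nat \<lfloor>2 ^ n * u\<rfloor>) = of_int \<lfloor>2 ^ n * u\<rfloor>" for n
    using assms by (simp add: of_nat_nat)
  then have eq: "dyadic_unit (p n) = min 1 ((of_int \<lfloor>2 ^ n * u\<rfloor> + 1) / 2 ^ n)" for n
    by (simp add: dyadic_unit_def p_def add.commute)
  have "2 ^ n * u < of_int \<lfloor>2 ^ n * u\<rfloor> + 1" for n by linarith
  then have gt: "u < dyadic_unit (p n)" for n
    using assms by (simp add: eq field_simps)
  have "(\<lambda>n. dyadic_unit (p n)) \<longlonglongrightarrow> u"
  proof (rule tendsto_sandwich)
    show "\<forall>\<^sub>F n in sequentially. u \<le> dyadic_unit (p n)"
      using gt by (auto intro!: always_eventually less_imp_le)
    have "of_int \<lfloor>2 ^ n * u\<rfloor> + 1 \<le> 2 ^ n * u + 1" for n by linarith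
    then have "(of_int \<lfloor>2 ^ n * u\<rfloor> + 1) / 2 ^ n \<le> u + 1 / 2 ^ n" for n
      by (simp add: field_simps)
    then have "dyadic_unit (p n) \<le> u + 1 / 2 ^ n" for n
      unfolding eq by (rule min.coboundedI2)
    then show "\<forall>\<^sub>F n in sequentially. dyadic_unit (p n) \<le> u + 1 / 2 ^ n"
      by (auto intro!: always_eventually)
    show "(\<lambda>n. u + 1 / 2 ^ n) \<longlonglongrightarrow> u"
      using tendsto_add[OF tendsto_const inverse_power2_tendsto_0[of 1], of u] by simp
  qed simp
  then show "filterlim (\<lambda>n. dyadic_unit (p n)) (at_right u) sequentially"
    using gt by (auto simp: filterlim_at intro!: always_eventually dest: less_imp_neq)
qed

text \<open>The sign \<open>\<sigma>\<close> lets the infimum be treated as a supremum with \<open>\<sigma> = - 1\<close>. The supremum is taken in the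
  extended reals, where it is measurable without a boundedness condition on the path.\<close>

definition signed_sup :: "real \<Rightarrow> (real \<Rightarrow> real) \<Rightarrow> (nat \<times> nat \<Rightarrow> real) \<Rightarrow> real" where
  "signed_sup \<sigma> w h = real_of_ereal (SUP p. ereal (\<sigma> * path_at w (h p)))"

lemma measurable_signed_sup:
  assumes [measurable]: "f \<in> measurable M path_space" "\<And>p. (\<lambda>x. g x p) \<in> borel_measurable M"
  shows "(\<lambda>x. signed_sup \<sigma> (f x) (g x)) \<in> borel_measurable M"
  unfolding signed_sup_def by measurable

lemma signed_sup_least_upper:
  assumes w: "continuous_on {0..} w" and h: "\<And>p. 0 \<le> h p" "\<And>p. h p \<le> K"
  shows "\<sigma> * w (h p) \<le> signed_sup \<sigma> w h"
    and "(\<And>p. \<sigma> * w (h p) \<le> y) \<Longrightarrow> signed_sup \<sigma> w h \<le> y"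
proof -
  have "compact ((\<lambda>u. \<sigma> * w u) ` {0..K})"
    by (intro compact_continuous_image continuous_intros continuous_on_subset[OF w]) auto
  then have "bdd_above ((\<lambda>u. \<sigma> * w u) ` {0..K})"
    by (intro bounded_imp_bdd_above compact_imp_bounded)
  then obtain B where B: "\<And>u. u \<in> {0..K} \<Longrightarrow> \<sigma> * w u \<le> B"
    unfolding bdd_above_def by (meson imageI)
  have eq: "signed_sup \<sigma> w h = real_of_ereal (SUP p. ereal (\<sigma> * w (h p)))"
    using h by (simp add: signed_sup_def path_at_eq[OF w])
  define z where "z = (SUP p. ereal (\<sigma> * w (h p)))"
  have up: "ereal (\<sigma> * w (h p)) \<le> z" for p unfolding z_def by (rule SUP_upper) simp
  have le: "z \<le> ereal y" if "\<And>p. \<sigma> * w (h p) \<le> y" for y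
    unfolding z_def by (rule SUP_least) (simp add: that)
  have "z \<le> ereal B" using B h by (intro le) auto
  then have z: "ereal (real_of_ereal z) = z" using up[of p] by (cases z) auto
  show "\<sigma> * w (h p) \<le> signed_sup \<sigma> w h"
    using up[of p] z unfolding eq z_def[symmetric] by (metis ereal_less_eq(3))
  show "(\<And>p. \<sigma> * w (h p) \<le> y) \<Longrightarrow> signed_sup \<sigma> w h \<le> y"
    using le[of y] z unfolding eq z_def[symmetric] by (metis ereal_less_eq(3))
qed

text \<open>The pair of infimum and supremum of \<open>w\<close> along the times \<open>g s\<close>, as a measurable function of the pair of
  paths.\<close>

definition extremes :: "((real \<Rightarrow> real) \<Rightarrow> nat \<times> nat \<Rightarrow> real) \<Rightarrow>
    (real \<Rightarrow> real) \<times> (real \<Rightarrow> real) \<Rightarrow> real \<times> real" where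
  "extremes g = (\<lambda>(w, s). (- signed_sup (- 1) w (g s), signed_sup 1 w (g s)))"

text \<open>Along these times \<open>w\<close> runs through the values of the subordinate process at dyadic times of \<open>[0, 1]\<close>,
  whereas along \<open>elapsed_times\<close> it runs through a dense subset of \<open>[0, s 1]\<close>.\<close>

definition visited_times :: "(real \<Rightarrow> real) \<Rightarrow> nat \<times> nat \<Rightarrow> real" where
  "visited_times s p = s (dyadic_unit p)"

definition elapsed_times :: "(real \<Rightarrow> real) \<Rightarrow> nat \<times> nat \<Rightarrow> real" where
  "elapsed_times s p = dyadic_unit p * s 1"

lemma extremes_restrict:
  assumes "g = visited_times \<or> g = elapsed_times"
  shows "extremes g (restrict w {0..}, restrict s {0..}) = extremes g (w, s)"
proof -
  have "g (restrict s {0..}) = g s"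
    using assms by (auto simp: visited_times_def elapsed_times_def dyadic_unit_bounds fun_eq_iff)
  then show ?thesis by (simp add: extremes_def signed_sup_def path_at_restrict)
qed

lemma measurable_extremes:
  assumes "g = visited_times \<or> g = elapsed_times"
  shows "extremes g \<in> borel_measurable (path_space \<Otimes>\<^sub>M path_space)"
proof -
  have ev: "(\<lambda>x. snd x t) \<in> borel_measurable (path_space \<Otimes>\<^sub>M path_space)" if "0 \<le> t" for t :: real
    by (rule measurable_compose[OF measurable_snd]) (use that in \<open>auto intro!: measurable_component_singleton\<close>)
  have g: "(\<lambda>x. g (snd x) p) \<in> borel_measurable (path_space \<Otimes>\<^sub>M path_space)" for p
    using assms ev[of "dyadic_unit p"] ev[of 1]
    by (auto simp: visited_times_def elapsed_times_def dyadic_unit_bounds)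
  have "(\<lambda>x. signed_sup \<sigma> (fst x) (g (snd x))) \<in> borel_measurable (path_space \<Otimes>\<^sub>M path_space)" for \<sigma>
    by (rule measurable_signed_sup) (simp_all add: g)
  then show ?thesis
    unfolding extremes_def split_beta' by (intro borel_measurable_Pair borel_measurable_uminus) auto
qed

text \<open>The path properties that hold almost surely and suffice for every pathwise argument below.\<close>

definition regular_pair :: "(real \<Rightarrow> real) \<Rightarrow> (real \<Rightarrow> real) \<Rightarrow> bool" where
  "regular_pair w s \<longleftrightarrow> continuous_on {0..} w \<and> w 0 = 0 \<and> s 0 = 0 \<and> mono_on {0..} s \<and>
     (\<forall>t\<ge>0. (s \<longlongrightarrow> s t) (at_right t))"

lemma regular_pair_bounds:
  assumes "regular_pair w s" "0 \<le> u" shows "0 \<le> s u" and "u \<le> v \<Longrightarrow> s u \<le> s v"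
  using assms mono_onD[of "{0..}" s 0 u] mono_onD[of "{0..}" s u v] by (auto simp: regular_pair_def)

lemma path_times_bounds:
  assumes "regular_pair w s" "g = visited_times \<or> g = elapsed_times"
  shows "0 \<le> g s p" "g s p \<le> s 1"
  using assms dyadic_unit_bounds[of p] regular_pair_bounds(1)[OF assms(1), of 1]
    regular_pair_bounds(1)[OF assms(1), of "dyadic_unit p"]
    regular_pair_bounds(2)[OF assms(1), of "dyadic_unit p" 1]
  by (auto simp: visited_times_def elapsed_times_def mult_left_le_one_le)

lemma extremes_bounds:
  assumes "regular_pair w s" "g = visited_times \<or> g = elapsed_times"
  shows "fst (extremes g (w, s)) \<le> w (g s p)" "w (g s p) \<le> snd (extremes g (w, s))"
    and "(\<And>p. y \<le> w (g s p)) \<Longrightarrow> y \<le> fst (extremes g (w, s))"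
    and "(\<And>p. w (g s p) \<le> y) \<Longrightarrow> snd (extremes g (w, s)) \<le> y"
proof -
  have w: "continuous_on {0..} w" using assms by (simp add: regular_pair_def)
  note * = signed_sup_least_upper[where h="g s" and K="s 1", OF w path_times_bounds[OF assms]]
  show "fst (extremes g (w, s)) \<le> w (g s p)" "w (g s p) \<le> snd (extremes g (w, s))"
    using *(1)[where \<sigma>="-1" and p=p] *(1)[where \<sigma>=1 and p=p] by (simp_all add: extremes_def)
  show "y \<le> fst (extremes g (w, s))" if "\<And>p. y \<le> w (g s p)"
    using *(2)[where \<sigma>="-1" and y="-y"] that by (simp add: extremes_def)
  show "snd (extremes g (w, s)) \<le> y" if "\<And>p. w (g s p) \<le> y"
    using *(2)[where \<sigma>=1 and y=y] that by (simp add: extremes_def)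
qed

text \<open>Right continuity of \<open>s\<close> and continuity of \<open>w\<close> extend the bound from dyadic times to all of \<open>[0, 1]\<close>.\<close>

lemma visited_extremes_bound:
  assumes reg: "regular_pair w s" and u: "u \<in> {0..1}"
  shows "w (s u) \<in> {fst (extremes visited_times (w, s))..snd (extremes visited_times (w, s))}"
proof (cases "u = 1")
  case True
  then show ?thesis
    using extremes_bounds(1,2)[OF reg, of visited_times "(1, 0)"] by (simp add: visited_times_def dyadic_unit_one[simplified])
next
  case False
  then obtain p where p: "filterlim (\<lambda>n. dyadic_unit (p n)) (at_right u) sequentially"
    using dyadic_unit_dense[of u] u by auto
  have w: "continuous_on {0..} w" and r: "(s \<longlongrightarrow> s u) (at_right u)"
    using reg u by (auto simp: regular_pair_def)
  have "(\<lambda>n. w (s (dyadic_unit (p n)))) \<longlonglongrightarrow> w (s u)"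
    by (rule continuous_on_tendsto_compose[OF w filterlim_compose[OF r p]])
      (use u in \<open>auto intro!: regular_pair_bounds(1)[OF reg] always_eventually simp: dyadic_unit_bounds\<close>)
  moreover have "w (s (dyadic_unit (p n))) \<in> {fst (extremes visited_times (w, s))..snd (extremes visited_times (w, s))}" for n
    using extremes_bounds(1,2)[OF reg, of visited_times "p n"] by (simp add: visited_times_def)
  ultimately show ?thesis
    by (rule closed_sequentially[OF closed_atLeastAtMost, rotated])
qed

lemma elapsed_extremes_bound:
  assumes reg: "regular_pair w s" and v: "v \<in> {0..s 1}"
  shows "w v \<in> {fst (extremes elapsed_times (w, s))..snd (extremes elapsed_times (w, s))}"
proof (cases "v = s 1")
  case True
  then show ?thesis
    using extremes_bounds(1,2)[OF reg, of elapsed_times "(1, 0)"] by (simp add: elapsed_times_def dyadic_unit_one[simplified])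
next
  case False
  then have s1: "0 < s 1" "v < s 1" using v by auto
  define u where "u = v / s 1"
  have u: "0 \<le> u" "u < 1" "v = u * s 1" using s1 v by (auto simp: u_def)
  then obtain p where p: "filterlim (\<lambda>n. dyadic_unit (p n)) (at_right u) sequentially"
    using dyadic_unit_dense[of u] by auto
  then have "(\<lambda>n. dyadic_unit (p n) * s 1) \<longlonglongrightarrow> v"
    unfolding u by (intro tendsto_mult_right) (auto simp: filterlim_at)
  moreover have w: "continuous_on {0..} w"
    using reg by (auto simp: regular_pair_def)
  ultimately have "(\<lambda>n. w (dyadic_unit (p n) * s 1)) \<longlonglongrightarrow> w v"
    by (intro continuous_on_tendsto_compose[OF w]) (use s1 v in \<open>auto simp: dyadic_unit_bounds\<close>)
  moreover have "w (dyadic_unit (p n) * s 1) \<in> {fst (extremes elapsed_times (w, s))..snd (extremes elapsed_times (w, s))}" for n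
    using extremes_bounds(1,2)[OF reg, of elapsed_times "p n"] by (simp add: elapsed_times_def)
  ultimately show ?thesis
    by (rule closed_sequentially[OF closed_atLeastAtMost, rotated])
qed

lemma AE_regular_pair:
  assumes "standard_pair M \<beta> W S"
  shows "AE \<omega> in M. regular_pair (\<lambda>t. W t \<omega>) (\<lambda>t. S t \<omega>)"
proof -
  have "AE \<omega> in M. continuous_on {0..} (\<lambda>t. W t \<omega>)" "AE \<omega> in M. W 0 \<omega> = 0"
    "AE \<omega> in M. S 0 \<omega> = 0" "AE \<omega> in M. cadlag (\<lambda>t. S t \<omega>)" "AE \<omega> in M. mono_on {0..} (\<lambda>t. S t \<omega>)"
    using assms by (auto simp: standard_pair_def brownian_motion_def stable_subordinator_def levy_process_def)
  then show ?thesis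
    by eventually_elim (auto simp: regular_pair_def cadlag_def)
qed

definition extremes_law :: "'a measure \<Rightarrow> (real \<Rightarrow> 'a \<Rightarrow> real) \<Rightarrow> (real \<Rightarrow> 'a \<Rightarrow> real) \<Rightarrow>
    ((real \<Rightarrow> real) \<Rightarrow> nat \<times> nat \<Rightarrow> real) \<Rightarrow> (real \<times> real) measure" where
  "extremes_law M W S g = distr M borel (\<lambda>\<omega>. extremes g (\<lambda>t. W t \<omega>, \<lambda>t. S t \<omega>))"

lemma standard_pair_measurable:
  assumes "standard_pair M \<beta> W S"
  shows "(\<lambda>\<omega>. (\<lambda>t\<in>{0..}. W t \<omega>, \<lambda>t\<in>{0..}. S t \<omega>)) \<in> measurable M (path_space \<Otimes>\<^sub>M path_space)"
  by (intro measurable_Pair measurable_restrict)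
    (use assms in \<open>auto simp: standard_pair_def brownian_motion_def stable_subordinator_def levy_process_def\<close>)

lemma extremes_random_variable:
  assumes "standard_pair M \<beta> W S" "g = visited_times \<or> g = elapsed_times"
  shows "(\<lambda>\<omega>. extremes g (\<lambda>t. W t \<omega>, \<lambda>t. S t \<omega>)) \<in> borel_measurable M"
    and "extremes_law M W S g = distr (pair_law M W S) borel (extremes g)"
proof -
  have eq: "extremes g \<circ> (\<lambda>\<omega>. (\<lambda>t\<in>{0..}. W t \<omega>, \<lambda>t\<in>{0..}. S t \<omega>)) =
      (\<lambda>\<omega>. extremes g (\<lambda>t. W t \<omega>, \<lambda>t. S t \<omega>))"
    by (auto simp: fun_eq_iff extremes_restrict[OF assms(2)])
  note m = standard_pair_measurable[OF assms(1)] measurable_extremes[OF assms(2)]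
  show "(\<lambda>\<omega>. extremes g (\<lambda>t. W t \<omega>, \<lambda>t. S t \<omega>)) \<in> borel_measurable M"
    unfolding eq[symmetric] by (rule measurable_comp[OF m])
  show "extremes_law M W S g = distr (pair_law M W S) borel (extremes g)"
    unfolding extremes_law_def pair_law_def by (subst distr_distr[OF m(2,1)]) (simp add: eq)
qed

text \<open>The extremes are a measurable function of the two paths, so their law is determined by that of the
  pair.\<close>

lemma extremes_law_eq:
  assumes "standard_pair M \<beta> W S" "standard_pair N \<beta> W' S'" "g = visited_times \<or> g = elapsed_times"
  shows "extremes_law M W S g = extremes_law N W' S' g"
  using extremes_random_variable(2)[OF assms(1,3)] extremes_random_variable(2)[OF assms(2,3)]
    pair_law_eq[OF assms(1,2)] by simp

section \<open>Heat loss as a truncated mean range\<close>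

text \<open>An exit event need not be measurable; it has the right measure under the completion as soon as it
  agrees almost surely with a measurable event.\<close>

lemma measure_completion_sandwich:
  assumes "V \<in> sets M" "H \<subseteq> space M" and ae: "AE \<omega> in M. \<omega> \<in> H \<longleftrightarrow> \<omega> \<in> V"
  shows "measure (completion M) H = measure M V"
proof -
  have ae': "AE \<omega> in completion M. \<omega> \<in> V \<longleftrightarrow> \<omega> \<in> H"
    by (rule AE_completion) (use ae in eventually_elim, auto)
  have H: "H \<in> sets (completion M)"
    by (rule completion.in_sets_AE[OF ae']) (use assms in auto)
  have "measure (completion M) H = measure (completion M) V"
    by (rule measure_eq_AE) (use ae' H assms in auto)
  then show ?thesis using assms by simp
qed

text \<open>A law on the line has at most countably many atoms. This disposes of paths that touch the boundary
  of the interval without crossing it, where the exit event depends on finer path behaviour.\<close>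

lemma AE_translates_miss_atoms:
  fixes \<mu> :: "'b measure" and f :: "'b \<Rightarrow> real"
  assumes "prob_space \<mu>" and [measurable]: "f \<in> borel_measurable \<mu>" and \<rho>: "0 < \<rho>"
  shows "AE x in lborel. AE r in \<mu>. x + \<rho> * f r \<noteq> (c :: real)"
proof -
  interpret prob_space \<mu> by fact
  interpret D: real_distribution "distr \<mu> borel f"
    by (simp add: real_distribution_distr)
  define A where "A = {y. measure (distr \<mu> borel f) {y} > 0}"
  have "countable ((\<lambda>y. c - \<rho> * y) ` A)"
    using D.countable_atoms by (simp add: A_def)
  then have "AE x in lborel. x \<notin> (\<lambda>y. c - \<rho> * y) ` A"
    by (intro AE_not_in countable_imp_null_set_lborel)
  then show ?thesis
  proof eventually_elim
    case (elim x)
    have "(c - x) / \<rho> \<notin> A"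
    proof
      assume "(c - x) / \<rho> \<in> A"
      then have "c - \<rho> * ((c - x) / \<rho>) \<in> (\<lambda>y. c - \<rho> * y) ` A" by blast
      then show False using elim \<rho> by simp
    qed
    then have "measure (distr \<mu> borel f) {(c - x) / \<rho>} = 0"
      by (simp add: A_def zero_less_measure_iff)
    then have "prob (f -` {(c - x) / \<rho>} \<inter> space \<mu>) = 0"
      by (simp add: measure_distr)
    then have "AE r in \<mu>. r \<notin> f -` {(c - x) / \<rho>} \<inter> space \<mu>"
      by (subst prob_eq_0[symmetric]) auto
    then show ?case
      using AE_space by eventually_elim (use \<rho> in \<open>auto simp: field_simps\<close>)
  qed
qed

text \<open>Fubini: for fixed extremes \<open>r\<close>, the starting points \<open>x\<close> with \<open>a < x + \<rho> * fst r\<close> and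
  \<open>x + \<rho> * snd r < b\<close> form an interval of length \<open>b - a - \<rho> * (snd r - fst r)\<close>, or no point at all.\<close>

lemma integral_containment_probability:
  fixes \<mu> :: "(real \<times> real) measure"
  assumes "prob_space \<mu>" and sets: "sets \<mu> = sets borel" and ab: "a < b" and \<rho>: "0 < \<rho>"
    and sgn: "AE r in \<mu>. fst r \<le> 0 \<and> 0 \<le> snd r"
  shows "(\<lambda>x. measure \<mu> {r. a < x + \<rho> * fst r \<and> x + \<rho> * snd r < b}) \<in> borel_measurable lborel" (is ?m)
    and "b - a - (\<integral>x. indicator {a<..<b} x * measure \<mu> {r. a < x + \<rho> * fst r \<and> x + \<rho> * snd r < b} \<partial>lborel)
       = (\<integral>r. min (b - a) (\<rho> * (snd r - fst r)) \<partial>\<mu>)" (is ?i)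
proof -
  interpret prob_space \<mu> by fact
  interpret L: pair_sigma_finite lborel \<mu> ..
  have sp: "space \<mu> = UNIV" using sets_eq_imp_space_eq[OF sets] by simp
  have [measurable]: "fst \<in> borel_measurable \<mu>" "snd \<in> borel_measurable \<mu>"
    by (simp_all add: measurable_cong_sets[OF sets refl] borel_prod[symmetric])
  define Q where "Q = {p \<in> space (lborel \<Otimes>\<^sub>M \<mu>). a < fst p + \<rho> * fst (snd p) \<and> fst p + \<rho> * snd (snd p) < b}"
  have Q[measurable]: "Q \<in> sets (lborel \<Otimes>\<^sub>M \<mu>)"
    unfolding Q_def by measurable
  have Qx: "Pair x -` Q = {r. a < x + \<rho> * fst r \<and> x + \<rho> * snd r < b}" for x
    by (auto simp: Q_def space_pair_measure sp)
  have f: "(\<lambda>x. emeasure \<mu> {r. a < x + \<rho> * fst r \<and> x + \<rho> * snd r < b}) \<in> borel_measurable lborel"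
    using measurable_emeasure_Pair[OF Q] by (simp add: Qx)
  show ?m
    using f unfolding measure_def by (intro measurable_compose[OF f]) simp
  define R where "R = {p \<in> space (lborel \<Otimes>\<^sub>M \<mu>). fst p \<in> {a<..<b} \<and> p \<in> Q}"
  have R[measurable]: "R \<in> sets (lborel \<Otimes>\<^sub>M \<mu>)"
    unfolding R_def by measurable
  have e1: "(\<integral>x. indicator {a<..<b} x * measure \<mu> {r. a < x + \<rho> * fst r \<and> x + \<rho> * snd r < b} \<partial>lborel)
      = enn2real (emeasure (lborel \<Otimes>\<^sub>M \<mu>) R)"
  proof -
    have "emeasure (lborel \<Otimes>\<^sub>M \<mu>) R = (\<integral>\<^sup>+x. emeasure \<mu> (Pair x -` R) \<partial>lborel)"
      by (rule emeasure_pair_measure_alt[OF R])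
    also have "\<dots> = (\<integral>\<^sup>+x. ennreal (indicator {a<..<b} x * measure \<mu> {r. a < x + \<rho> * fst r \<and> x + \<rho> * snd r < b}) \<partial>lborel)"
    proof (rule nn_integral_cong)
      fix x
      have "Pair x -` R = (if x \<in> {a<..<b} then {r. a < x + \<rho> * fst r \<and> x + \<rho> * snd r < b} else {})"
        by (auto simp: R_def Q_def space_pair_measure sp)
      then show "emeasure \<mu> (Pair x -` R) = ennreal (indicator {a<..<b} x * measure \<mu> {r. a < x + \<rho> * fst r \<and> x + \<rho> * snd r < b})"
        by (simp add: emeasure_eq_measure)
    qed
    finally show ?thesis
      using \<open>?m\<close> by (subst integral_eq_nn_integral) auto
  qed
  have e2: "(\<integral>r. max 0 (b - a - \<rho> * (snd r - fst r)) \<partial>\<mu>) = enn2real (emeasure (lborel \<Otimes>\<^sub>M \<mu>) R)"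
  proof -
    have "emeasure (lborel \<Otimes>\<^sub>M \<mu>) R = (\<integral>\<^sup>+r. emeasure lborel ((\<lambda>x. (x, r)) -` R) \<partial>\<mu>)"
      by (rule L.emeasure_pair_measure_alt2[OF R])
    also have "\<dots> = (\<integral>\<^sup>+r. ennreal (max 0 (b - a - \<rho> * (snd r - fst r))) \<partial>\<mu>)"
    proof (rule nn_integral_cong_AE)
      show "AE r in \<mu>. emeasure lborel ((\<lambda>x. (x, r)) -` R) = ennreal (max 0 (b - a - \<rho> * (snd r - fst r)))"
        using sgn
      proof eventually_elim
        case (elim r)
        then have "\<rho> * fst r \<le> 0" "0 \<le> \<rho> * snd r"
          using \<rho> by (auto simp: mult_le_0_iff)
        then have "(\<lambda>x. (x, r)) -` R = {a - \<rho> * fst r<..<b - \<rho> * snd r}"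
          by (auto simp: R_def Q_def space_pair_measure sp)
        then show ?case by (auto simp: emeasure_lborel_Ioo max_def algebra_simps)
      qed
    qed
    finally show ?thesis
      by (subst integral_eq_nn_integral) auto
  qed
  have "(\<integral>r. min (b - a) (\<rho> * (snd r - fst r)) \<partial>\<mu>) = (\<integral>r. b - a - max 0 (b - a - \<rho> * (snd r - fst r)) \<partial>\<mu>)"
    by (rule Bochner_Integration.integral_cong) (auto simp: min_def max_def)
  also have "\<dots> = b - a - (\<integral>r. max 0 (b - a - \<rho> * (snd r - fst r)) \<partial>\<mu>)"
  proof -
    have "integrable \<mu> (\<lambda>r. max 0 (b - a - \<rho> * (snd r - fst r)))"
    proof (rule integrable_const_bound[where B="b - a"])
      show "AE r in \<mu>. norm (max 0 (b - a - \<rho> * (snd r - fst r))) \<le> b - a"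
        using sgn by eventually_elim (use \<rho> ab in \<open>auto simp: max_def\<close>)
    qed measurable
    then show ?thesis by (simp add: prob_space)
  qed
  finally show ?i by (simp only: e1 e2)
qed

text \<open>The event \<open>H x\<close> of staying inside is squeezed between containment of the range in the open interval
  and in its closure. These two agree almost surely for almost every \<open>x\<close>, which also yields the
  measurability of the integrand over \<open>x\<close>.\<close>

lemma heat_loss_eq_truncated_range:
  fixes P :: "real \<Rightarrow> 'a measure" and R :: "real \<Rightarrow> 'a \<Rightarrow> real \<times> real"
  assumes ab: "a < b" and \<rho>: "0 < \<rho>" and P: "\<And>x. prob_space (P x)"
    and R[measurable]: "\<And>x. R x \<in> borel_measurable (P x)" and law: "\<And>x. distr (P x) borel (R x) = \<mu>"
    and sgn: "AE r in \<mu>. fst r \<le> 0 \<and> 0 \<le> snd r"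
    and H: "\<And>x. H x \<subseteq> space (P x)"
    and inner: "\<And>x. x \<in> {a<..<b} \<Longrightarrow> AE \<omega> in P x. a < x + \<rho> * fst (R x \<omega>) \<and> x + \<rho> * snd (R x \<omega>) < b \<longrightarrow> \<omega> \<in> H x"
    and outer: "\<And>x. x \<in> {a<..<b} \<Longrightarrow> AE \<omega> in P x. \<omega> \<in> H x \<longrightarrow> a \<le> x + \<rho> * fst (R x \<omega>) \<and> x + \<rho> * snd (R x \<omega>) \<le> b"
  shows "measure lebesgue {a<..<b} - (LINT x:{a<..<b}|lebesgue. measure (completion (P x)) (H x))
    = (\<integral>r. min (b - a) (\<rho> * (snd r - fst r)) \<partial>\<mu>)"
proof -
  have \<mu>: "prob_space \<mu>" "sets \<mu> = sets borel"
    using prob_space.prob_space_distr[OF P R, of 0] law[of 0] by auto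
  have fs: "fst \<in> borel_measurable \<mu>" "snd \<in> borel_measurable \<mu>"
    by (simp_all add: measurable_cong_sets[OF \<mu>(2) refl] borel_prod[symmetric])
  let ?U = "\<lambda>x. {r. a < x + \<rho> * fst r \<and> x + \<rho> * snd r < b}"
  let ?f = "\<lambda>x. indicator {a<..<b} x *\<^sub>R measure \<mu> (?U x) :: real"
  let ?h = "\<lambda>x. indicator {a<..<b} x *\<^sub>R measure (completion (P x)) (H x) :: real"
  note I = integral_containment_probability[OF \<mu> ab \<rho> sgn]
  have fm: "?f \<in> borel_measurable lborel"
    using I(1) by simp
  have U: "?U x \<in> sets borel" for x
  proof -
    have "{r \<in> space \<mu>. a < x + \<rho> * fst r \<and> x + \<rho> * snd r < b} \<in> sets \<mu>"
      using fs by measurable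
    then show ?thesis using \<mu>(2) sets_eq_imp_space_eq[OF \<mu>(2)] by simp
  qed
  have "AE x in lborel. ?f x = ?h x"
    using AE_translates_miss_atoms[OF \<mu>(1) fs(1) \<rho>, of a] AE_translates_miss_atoms[OF \<mu>(1) fs(2) \<rho>, of b]
  proof eventually_elim
    case (elim x)
    show ?case
    proof (cases "x \<in> {a<..<b}")
      case True
      have t: "AE \<omega> in P x. x + \<rho> * fst (R x \<omega>) \<noteq> a" "AE \<omega> in P x. x + \<rho> * snd (R x \<omega>) \<noteq> b"
        using elim unfolding law[of x, symmetric] by (auto intro: AE_distrD[OF R])
      have "AE \<omega> in P x. \<omega> \<in> H x \<longleftrightarrow> \<omega> \<in> R x -` ?U x \<inter> space (P x)"
        using t inner[OF True] outer[OF True] AE_space by eventually_elim auto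
      then have "measure (completion (P x)) (H x) = measure (P x) (R x -` ?U x \<inter> space (P x))"
        by (intro measure_completion_sandwich H measurable_sets[OF R U])
      also have "\<dots> = measure \<mu> (?U x)"
        unfolding law[of x, symmetric] by (rule measure_distr[symmetric, OF R U])
      finally show ?thesis by simp
    qed simp
  qed
  then have ae: "AE x in lebesgue. ?f x = ?h x" by (rule AE_completion)
  have fl: "?f \<in> borel_measurable lebesgue"
    using fm by (rule measurable_completion)
  have "(LINT x:{a<..<b}|lebesgue. measure (completion (P x)) (H x)) = (\<integral>x. ?f x \<partial>lebesgue)"
    unfolding set_lebesgue_integral_def
    using borel_measurable_AE[OF fl ae] fl ae by (intro integral_cong_AE) auto
  also have "\<dots> = (\<integral>x. ?f x \<partial>lborel)" by (rule integral_completion[OF fm])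
  finally show ?thesis using I(2) ab by simp
qed

lemma exit_time_gt_imp:
  assumes "ereal t < exit_time X D \<omega>" "0 < u" "u \<le> t" shows "X u \<omega> \<in> D"
proof (rule ccontr)
  assume "X u \<omega> \<notin> D"
  then have "exit_time X D \<omega> \<le> ereal u"
    unfolding exit_time_def using assms(2) by (intro Inf_lower) auto
  then show False using assms(1,3)
    by (meson ereal_less_eq(3) leD order_trans)
qed

text \<open>Openness of \<open>D\<close> and right continuity at \<open>t\<close> keep the process inside for a little longer than \<open>t\<close>, which
  gives the strict inequality.\<close>

lemma exit_time_gtI:
  assumes "\<And>u. 0 < u \<Longrightarrow> u \<le> t \<Longrightarrow> X u \<omega> \<in> D" and lim: "((\<lambda>u. X u \<omega>) \<longlongrightarrow> X t \<omega>) (at_right t)"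
    and "open D" "X t \<omega> \<in> D"
  shows "ereal t < exit_time X D \<omega>"
proof -
  have "\<forall>\<^sub>F u in at_right t. X u \<omega> \<in> D"
    using topological_tendstoD[OF lim assms(3,4)] .
  then obtain c where c: "t < c" "\<And>u. t < u \<Longrightarrow> u < c \<Longrightarrow> X u \<omega> \<in> D"
    by (auto simp: eventually_at_right_field)
  have "ereal c \<le> exit_time X D \<omega>"
    unfolding exit_time_def
  proof (rule Inf_greatest)
    fix z assume "z \<in> {ereal t |t. 0 < t \<and> X t \<omega> \<notin> D}"
    then obtain u where "z = ereal u" "0 < u" "X u \<omega> \<notin> D" by auto
    then show "ereal c \<le> z" using assms(1)[of u] c(2)[of u] by (cases "u \<le> t"; cases "u < c") auto
  qed
  then show ?thesis using c(1) by (meson less_ereal.simps(1) order_less_le_trans)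
qed

lemma subordinate_killed_in_iff:
  "subordinate (killed W D) S t \<omega> \<in> Some ` D \<longleftrightarrow>
     ereal (S t \<omega>) < exit_time W D \<omega> \<and> W (S t \<omega>) \<omega> \<in> D"
  by (auto simp: subordinate_def killed_def)

lemma regular_pair_unscale:
  assumes reg: "regular_pair (\<lambda>u. (w (\<rho>\<^sup>2 * u) - x) / \<rho>) (\<lambda>u. s (t * u) / \<rho>\<^sup>2)"
    and \<rho>: "0 < \<rho>" and t: "0 < t"
  shows "w 0 = x" "continuous_on {0..} w" "0 \<le> \<tau> \<Longrightarrow> 0 \<le> s \<tau>"
    "0 \<le> \<tau> \<Longrightarrow> (s \<longlongrightarrow> s \<tau>) (at_right \<tau>)"
proof -
  let ?w = "\<lambda>u. (w (\<rho>\<^sup>2 * u) - x) / \<rho>" and ?s = "\<lambda>u. s (t * u) / \<rho>\<^sup>2"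
  have w: "w = (\<lambda>v. x + \<rho> * ?w (1 / \<rho>\<^sup>2 * v))" and s: "s = (\<lambda>\<tau>. ?s (1 / t * \<tau>) / (1 / \<rho>\<^sup>2))"
    using \<rho> t by (auto simp: fun_eq_iff)
  have c: "continuous_on {0..} ?w" using reg by (simp add: regular_pair_def)
  show "w 0 = x" using reg \<rho> by (simp add: regular_pair_def)
  have "continuous_on {0..} (\<lambda>v. ?w (1 / \<rho>\<^sup>2 * v))"
    by (rule continuous_on_compose2[OF c]) (use \<rho> in \<open>auto intro!: continuous_intros\<close>)
  then have "continuous_on {0..} (\<lambda>v. x + \<rho> * ?w (1 / \<rho>\<^sup>2 * v))"
    by (intro continuous_on_add continuous_on_const continuous_on_mult_left)
  then show "continuous_on {0..} w" by (simp only: w[symmetric])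
  show "0 \<le> s \<tau>" if "0 \<le> \<tau>"
    using regular_pair_bounds(1)[OF reg, of "\<tau> / t"] that \<rho> t by (simp add: zero_le_divide_iff)
  show "(s \<longlongrightarrow> s \<tau>) (at_right \<tau>)" if "0 \<le> \<tau>"
  proof -
    have r: "(?s \<longlongrightarrow> ?s (\<tau> / t)) (at_right (\<tau> / t))"
    proof -
      have "0 \<le> \<tau> / t" using that t by simp
      then show ?thesis using reg unfolding regular_pair_def by blast
    qed
    have "filterlim (\<lambda>u. u / t) (at_right (\<tau> / t)) (at_right \<tau>)"
      unfolding filterlim_at using t
      by (auto intro!: tendsto_intros simp: eventually_at_filter divide_strict_right_mono)
    from filterlim_compose[OF r this]
    have "((\<lambda>u. \<rho>\<^sup>2 * ?s (u / t)) \<longlongrightarrow> \<rho>\<^sup>2 * ?s (\<tau> / t)) (at_right \<tau>)"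
      by (intro tendsto_mult_left)
    then show ?thesis using \<rho> t by simp
  qed
qed

lemma affine_in_interval:
  fixes x y :: real
  assumes "0 < \<rho>" "x + \<rho> * y \<in> {a<..<b}"
  shows "(a - x) / \<rho> \<le> y" "y \<le> (b - x) / \<rho>"
  using assms by (auto simp: field_simps)

text \<open>Whether the subordinate process has left the interval by time \<open>t\<close> can be read off its extremes, up to
  contact with the boundary.\<close>

lemma visited_extremes_exit:
  assumes reg: "regular_pair (\<lambda>u. (W (\<rho>\<^sup>2 * u) \<omega> - x) / \<rho>) (\<lambda>u. S (t * u) \<omega> / \<rho>\<^sup>2)"
    and \<rho>: "0 < \<rho>" and t: "0 < t" and x: "x \<in> {a<..<b}"
    and e: "e = extremes visited_times (\<lambda>u. (W (\<rho>\<^sup>2 * u) \<omega> - x) / \<rho>, \<lambda>u. S (t * u) \<omega> / \<rho>\<^sup>2)"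
  shows "a < x + \<rho> * fst e \<Longrightarrow> x + \<rho> * snd e < b \<Longrightarrow> ereal t < exit_time (subordinate W S) {a<..<b} \<omega>"
    and "ereal t < exit_time (subordinate W S) {a<..<b} \<omega> \<Longrightarrow> a \<le> x + \<rho> * fst e \<and> x + \<rho> * snd e \<le> b"
proof -
  let ?w = "\<lambda>u. (W (\<rho>\<^sup>2 * u) \<omega> - x) / \<rho>" and ?s = "\<lambda>u. S (t * u) \<omega> / \<rho>\<^sup>2"
  have X: "subordinate W S (t * u) \<omega> = x + \<rho> * ?w (?s u)" for u
    using \<rho> by (simp add: subordinate_def)
  note un = regular_pair_unscale[OF reg \<rho> t]
  {
    assume in_D: "a < x + \<rho> * fst e" "x + \<rho> * snd e < b"
    have D: "subordinate W S \<tau> \<omega> \<in> {a<..<b}" if "0 \<le> \<tau>" "\<tau> \<le> t" for \<tau>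
    proof -
      have "?w (?s (\<tau> / t)) \<in> {fst e..snd e}"
        unfolding e by (rule visited_extremes_bound[OF reg]) (use that t in auto)
      then have "\<rho> * fst e \<le> \<rho> * ?w (?s (\<tau> / t))" "\<rho> * ?w (?s (\<tau> / t)) \<le> \<rho> * snd e"
        by (auto simp only: atLeastAtMost_iff intro!: mult_left_mono[OF _ less_imp_le[OF \<rho>]])
      then have "x + \<rho> * ?w (?s (\<tau> / t)) \<in> {a<..<b}" using in_D by simp
      then show ?thesis using X[of "\<tau> / t"] t by simp
    qed
    show "ereal t < exit_time (subordinate W S) {a<..<b} \<omega>"
    proof (rule exit_time_gtI)
      have "\<forall>\<^sub>F \<tau> in at_right t. S \<tau> \<omega> \<in> {0..}"
        using un(3) t by (auto simp: eventually_at_filter intro!: always_eventually)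
      then show "((\<lambda>u. subordinate W S u \<omega>) \<longlongrightarrow> subordinate W S t \<omega>) (at_right t)"
        unfolding subordinate_def
        by (intro continuous_on_tendsto_compose[OF un(2) un(4)]) (use un(3) t in auto)
    qed (use D t in auto)
  }
  assume ex: "ereal t < exit_time (subordinate W S) {a<..<b} \<omega>"
  have D: "x + \<rho> * ?w (visited_times ?s p) \<in> {a<..<b}" for p
  proof (cases "dyadic_unit p = 0")
    case True
    have "?w 0 = 0" "?s 0 = 0" using reg unfolding regular_pair_def by blast+
    then have "?w (visited_times ?s p) = 0" by (simp only: visited_times_def True)
    then show ?thesis using x by (simp only: mult_zero_right add_0_right)
  next
    case False
    then have "subordinate W S (t * dyadic_unit p) \<omega> \<in> {a<..<b}"
      using dyadic_unit_bounds[of p] t by (intro exit_time_gt_imp[where X="subordinate W S", OF ex]) auto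
    then show ?thesis unfolding X visited_times_def by simp
  qed
  have "(a - x) / \<rho> \<le> fst e" "snd e \<le> (b - x) / \<rho>"
    unfolding e using extremes_bounds(3,4)[OF reg, of visited_times] affine_in_interval[OF \<rho> D] by blast+
  then show "a \<le> x + \<rho> * fst e \<and> x + \<rho> * snd e \<le> b"
    using \<rho> by (auto simp: field_simps)
qed

text \<open>The killed process is alive at time \<open>t\<close> only if the Brownian path has stayed inside during all of
  \<open>[0, S t]\<close>, so here the extremes of the uninterrupted Brownian path decide.\<close>

lemma elapsed_extremes_exit:
  assumes reg: "regular_pair (\<lambda>u. (W (\<rho>\<^sup>2 * u) \<omega> - x) / \<rho>) (\<lambda>u. S (t * u) \<omega> / \<rho>\<^sup>2)"
    and \<rho>: "0 < \<rho>" and t: "0 < t" and x: "x \<in> {a<..<b}"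
    and e: "e = extremes elapsed_times (\<lambda>u. (W (\<rho>\<^sup>2 * u) \<omega> - x) / \<rho>, \<lambda>u. S (t * u) \<omega> / \<rho>\<^sup>2)"
  shows "a < x + \<rho> * fst e \<Longrightarrow> x + \<rho> * snd e < b \<Longrightarrow> subordinate (killed W {a<..<b}) S t \<omega> \<in> Some ` {a<..<b}"
    and "subordinate (killed W {a<..<b}) S t \<omega> \<in> Some ` {a<..<b} \<Longrightarrow> a \<le> x + \<rho> * fst e \<and> x + \<rho> * snd e \<le> b"
proof -
  let ?w = "\<lambda>u. (W (\<rho>\<^sup>2 * u) \<omega> - x) / \<rho>" and ?s = "\<lambda>u. S (t * u) \<omega> / \<rho>\<^sup>2"
  have X: "W (\<rho>\<^sup>2 * u) \<omega> = x + \<rho> * ?w u" for u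
    using \<rho> by simp
  note un = regular_pair_unscale[OF reg \<rho> t]
  have St: "0 \<le> S t \<omega>" using un(3) t by simp
  {
    assume in_D: "a < x + \<rho> * fst e" "x + \<rho> * snd e < b"
    have D: "W v \<omega> \<in> {a<..<b}" if "0 \<le> v" "v \<le> S t \<omega>" for v
    proof -
      have "?w (v / \<rho>\<^sup>2) \<in> {fst e..snd e}"
        unfolding e by (rule elapsed_extremes_bound[OF reg]) (use that \<rho> in \<open>auto simp: divide_right_mono\<close>)
      then have "\<rho> * fst e \<le> \<rho> * ?w (v / \<rho>\<^sup>2)" "\<rho> * ?w (v / \<rho>\<^sup>2) \<le> \<rho> * snd e"
        by (auto simp only: atLeastAtMost_iff intro!: mult_left_mono[OF _ less_imp_le[OF \<rho>]])
      then have "x + \<rho> * ?w (v / \<rho>\<^sup>2) \<in> {a<..<b}" using in_D by simp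
      then show ?thesis using X[of "v / \<rho>\<^sup>2"] \<rho> by simp
    qed
    have "ereal (S t \<omega>) < exit_time W {a<..<b} \<omega>"
    proof (rule exit_time_gtI)
      have "((\<lambda>u. W u \<omega>) \<longlongrightarrow> W (S t \<omega>) \<omega>) (at (S t \<omega>) within {0..})"
        using un(2) St by (auto simp: continuous_on_def)
      then show "((\<lambda>u. W u \<omega>) \<longlongrightarrow> W (S t \<omega>) \<omega>) (at_right (S t \<omega>))"
        by (rule tendsto_within_subset) (use St in auto)
    qed (use D St in auto)
    then show "subordinate (killed W {a<..<b}) S t \<omega> \<in> Some ` {a<..<b}"
      using D[of "S t \<omega>"] St by (simp add: subordinate_killed_in_iff del: greaterThanLessThan_iff)
  }
  assume "subordinate (killed W {a<..<b}) S t \<omega> \<in> Some ` {a<..<b}"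
  then have ex: "ereal (S t \<omega>) < exit_time W {a<..<b} \<omega>" by (simp add: subordinate_killed_in_iff)
  have D: "x + \<rho> * ?w (elapsed_times ?s p) \<in> {a<..<b}" for p
  proof (cases "elapsed_times ?s p = 0")
    case True
    have "?w 0 = 0" using reg unfolding regular_pair_def by blast
    then have "?w (elapsed_times ?s p) = 0" by (simp only: True)
    then show ?thesis using x by (simp only: mult_zero_right add_0_right)
  next
    case False
    have eq: "\<rho>\<^sup>2 * elapsed_times ?s p = dyadic_unit p * S t \<omega>"
      using \<rho> by (simp add: elapsed_times_def)
    have "W (\<rho>\<^sup>2 * elapsed_times ?s p) \<omega> \<in> {a<..<b}"
    proof (rule exit_time_gt_imp[OF ex])
      show "0 < \<rho>\<^sup>2 * elapsed_times ?s p"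
        using False \<rho> path_times_bounds(1)[OF reg, of elapsed_times p] by simp
      show "\<rho>\<^sup>2 * elapsed_times ?s p \<le> S t \<omega>"
        unfolding eq using St dyadic_unit_bounds[of p] by (simp add: mult_left_le_one_le)
    qed
    then show ?thesis by (simp only: X[symmetric])
  qed
  have "(a - x) / \<rho> \<le> fst e" "snd e \<le> (b - x) / \<rho>"
    unfolding e using extremes_bounds(3,4)[OF reg, of elapsed_times] affine_in_interval[OF \<rho> D] by blast+
  then show "a \<le> x + \<rho> * fst e \<and> x + \<rho> * snd e \<le> b"
    using \<rho> by (auto simp: field_simps)
qed

lemma extremes_law_sign:
  assumes "standard_pair M \<beta> W S" "g = visited_times \<or> g = elapsed_times"
  shows "AE r in extremes_law M W S g. fst r \<le> 0 \<and> 0 \<le> snd r"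
  unfolding extremes_law_def
proof (subst AE_distr_iff)
  have "{r \<in> space (borel \<Otimes>\<^sub>M borel). fst r \<le> (0::real) \<and> (0::real) \<le> snd r} \<in> sets (borel \<Otimes>\<^sub>M borel)"
    by measurable
  then show "{r \<in> space borel. fst r \<le> (0::real) \<and> (0::real) \<le> snd r} \<in> sets borel"
    unfolding borel_prod .
  show "AE \<omega> in M. fst (extremes g (\<lambda>t. W t \<omega>, \<lambda>t. S t \<omega>)) \<le> 0 \<and> 0 \<le> snd (extremes g (\<lambda>t. W t \<omega>, \<lambda>t. S t \<omega>))"
    using AE_regular_pair[OF assms(1)]
  proof eventually_elim
    case (elim \<omega>)
    have z: "g (\<lambda>t. S t \<omega>) (0, 0) = 0"
      using assms(2) elim by (auto simp: visited_times_def elapsed_times_def dyadic_unit_def regular_pair_def)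
    have "W 0 \<omega> = 0" using elim by (simp add: regular_pair_def)
    then show ?case using extremes_bounds(1,2)[OF elim assms(2), of "(0, 0)"] by (simp add: z)
  qed
qed (rule extremes_random_variable(1)[OF assms])

text \<open>For each starting point and each \<open>t\<close> the rescaled pair has the law of the pair started at the origin,
  so one law of extremes serves all \<open>x\<close> and \<open>t\<close>.\<close>

lemma heat_content_formula:
  fixes P :: "real \<Rightarrow> 'a measure"
  assumes \<alpha>: "0 < \<alpha>" and ab: "a < b" and P: "\<And>x. prob_space (P x)"
    and W: "\<And>x. brownian_motion (P x) x W" and S: "\<And>x. stable_subordinator (P x) (\<alpha> / 2) S"
    and ind: "\<And>x. indep_processes (P x) W S" and t: "0 < t"
  shows "measure lebesgue {a<..<b} - spectral_heat_content P W S {a<..<b} t =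
      (\<integral>r. min (b - a) (t powr (1 / \<alpha>) * (snd r - fst r)) \<partial>extremes_law (P 0) W S visited_times)"
    and "measure lebesgue {a<..<b} - killed_spectral_heat_content P W S {a<..<b} t =
      (\<integral>r. min (b - a) (t powr (1 / \<alpha>) * (snd r - fst r)) \<partial>extremes_law (P 0) W S elapsed_times)"
proof -
  define \<rho> where "\<rho> = t powr (1 / \<alpha>)"
  have \<rho>: "0 < \<rho>" using t by (simp add: \<rho>_def)
  let ?W = "\<lambda>x u \<omega>. (W (\<rho>\<^sup>2 * u) \<omega> - x) / \<rho>" and ?S = "\<lambda>u \<omega>. S (t * u) \<omega> / \<rho>\<^sup>2"
  have std: "standard_pair (P x) (\<alpha> / 2) (?W x) ?S" for x
    by (rule standard_pair_rescale[OF P W S ind]) (use \<alpha> t in \<open>auto simp: \<rho>_def\<close>)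
  have std0: "standard_pair (P 0) (\<alpha> / 2) W S"
    using P W S ind by (auto simp: standard_pair_def)
  let ?R = "\<lambda>g x \<omega>. extremes g (\<lambda>u. ?W x u \<omega>, \<lambda>u. ?S u \<omega>)"
  have law: "distr (P x) borel (?R g x) = extremes_law (P 0) W S g" if "g = visited_times \<or> g = elapsed_times" for g x
    using extremes_law_eq[OF std[of x] std0 that] by (simp add: extremes_law_def)
  show "measure lebesgue {a<..<b} - spectral_heat_content P W S {a<..<b} t =
      (\<integral>r. min (b - a) (t powr (1 / \<alpha>) * (snd r - fst r)) \<partial>extremes_law (P 0) W S visited_times)"
    unfolding spectral_heat_content_def \<rho>_def[symmetric]
  proof (rule heat_loss_eq_truncated_range[OF ab \<rho> P, where R="?R visited_times"])
    fix x
    show "?R visited_times x \<in> borel_measurable (P x)"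
      by (rule extremes_random_variable(1)[OF std]) simp
    show "distr (P x) borel (?R visited_times x) = extremes_law (P 0) W S visited_times"
      by (rule law) simp
    assume x: "x \<in> {a<..<b}"
    show "AE \<omega> in P x. a < x + \<rho> * fst (?R visited_times x \<omega>) \<and> x + \<rho> * snd (?R visited_times x \<omega>) < b \<longrightarrow>
       \<omega> \<in> {\<omega> \<in> space (P x). ereal t < exit_time (subordinate W S) {a<..<b} \<omega>}"
      using AE_regular_pair[OF std[of x]] AE_space
    proof eventually_elim
      case (elim \<omega>)
      show ?case using visited_extremes_exit(1)[where W=W and S=S, OF elim(1) \<rho> t x refl] elim(2) by blast
    qed
    show "AE \<omega> in P x. \<omega> \<in> {\<omega> \<in> space (P x). ereal t < exit_time (subordinate W S) {a<..<b} \<omega>} \<longrightarrow>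
       a \<le> x + \<rho> * fst (?R visited_times x \<omega>) \<and> x + \<rho> * snd (?R visited_times x \<omega>) \<le> b"
      using AE_regular_pair[OF std[of x]]
    proof eventually_elim
      case (elim \<omega>)
      show ?case using visited_extremes_exit(2)[where W=W and S=S, OF elim \<rho> t x refl] by blast
    qed
  qed (use extremes_law_sign[OF std0] in auto)
  show "measure lebesgue {a<..<b} - killed_spectral_heat_content P W S {a<..<b} t =
      (\<integral>r. min (b - a) (t powr (1 / \<alpha>) * (snd r - fst r)) \<partial>extremes_law (P 0) W S elapsed_times)"
    unfolding killed_spectral_heat_content_def \<rho>_def[symmetric]
  proof (rule heat_loss_eq_truncated_range[OF ab \<rho> P, where R="?R elapsed_times"])
    fix x
    show "?R elapsed_times x \<in> borel_measurable (P x)"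
      by (rule extremes_random_variable(1)[OF std]) simp
    show "distr (P x) borel (?R elapsed_times x) = extremes_law (P 0) W S elapsed_times"
      by (rule law) simp
    assume x: "x \<in> {a<..<b}"
    show "AE \<omega> in P x. a < x + \<rho> * fst (?R elapsed_times x \<omega>) \<and> x + \<rho> * snd (?R elapsed_times x \<omega>) < b \<longrightarrow>
       \<omega> \<in> {\<omega> \<in> space (P x). subordinate (killed W {a<..<b}) S t \<omega> \<in> Some ` {a<..<b}}"
      using AE_regular_pair[OF std[of x]] AE_space
    proof eventually_elim
      case (elim \<omega>)
      show ?case using elapsed_extremes_exit(1)[where W=W and S=S, OF elim(1) \<rho> t x refl] elim(2) by blast
    qed
    show "AE \<omega> in P x. \<omega> \<in> {\<omega> \<in> space (P x). subordinate (killed W {a<..<b}) S t \<omega> \<in> Some ` {a<..<b}} \<longrightarrow>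
       a \<le> x + \<rho> * fst (?R elapsed_times x \<omega>) \<and> x + \<rho> * snd (?R elapsed_times x \<omega>) \<le> b"
      using AE_regular_pair[OF std[of x]]
    proof eventually_elim
      case (elim \<omega>)
      show ?case using elapsed_extremes_exit(2)[where W=W and S=S, OF elim \<rho> t x refl] by blast
    qed
  qed (use extremes_law_sign[OF std0] in auto)
qed

section \<open>Chaining bound for the Brownian maximum\<close>

text \<open>With ratio \<open>q = 2 powr (- 1 / 4)\<close> the fourth moments of the \<open>2 ^ m\<close> increments of level \<open>m\<close> add up to
  \<open>12 * v\<^sup>2 / 2 ^ m = 12 * chain_scale v m ^ 4\<close>, so that both summands of \<open>chain_term\<close> have means of the
  same geometric order.\<close>

definition chain_scale :: "real \<Rightarrow> nat \<Rightarrow> real" where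
  "chain_scale v m = sqrt v * (2 powr (- 1 / 4)) ^ m"

definition chain_term :: "real \<Rightarrow> (real \<Rightarrow> real) \<Rightarrow> nat \<Rightarrow> real" where
  "chain_term v w m = chain_scale v m +
     (\<Sum>k<2 ^ m. (w (v * (real (Suc k) / 2 ^ m)) - w (v * (real k / 2 ^ m))) ^ 4) / chain_scale v m ^ 3"

text \<open>For a continuous path from \<open>0\<close>, a majorant of \<open>\<bar>w\<bar>\<close> on \<open>[0, v]\<close>: level \<open>m\<close> contributes a bound on the largest increment of \<open>w\<close> between
  neighbouring points of the dyadic grid of that level.\<close>

definition chain_bound :: "real \<Rightarrow> (real \<Rightarrow> real) \<Rightarrow> ennreal" where
  "chain_bound v w = (\<Sum>m. ennreal (chain_term v w m))"

lemma chain_scale_pos: "0 < v \<Longrightarrow> 0 < chain_scale v m"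
  by (simp add: chain_scale_def)

lemma chain_term_nonneg: "0 < v \<Longrightarrow> 0 \<le> chain_term v w m"
  unfolding chain_term_def using chain_scale_pos[of v m]
  by (auto intro!: add_nonneg_nonneg divide_nonneg_nonneg sum_nonneg)

lemma abs_le_add_power4:
  fixes x e :: real assumes "0 < e" shows "\<bar>x\<bar> \<le> e + x ^ 4 / e ^ 3"
proof (cases "\<bar>x\<bar> \<le> e")
  case True
  have "0 \<le> x ^ 4 / e ^ 3" using assms by simp
  then show ?thesis using True by linarith
next
  case False
  then have "e ^ 3 \<le> \<bar>x\<bar> ^ 3" using assms by (intro power_mono) auto
  then have "\<bar>x\<bar> * e ^ 3 \<le> \<bar>x\<bar> * \<bar>x\<bar> ^ 3" by (intro mult_left_mono) auto
  also have "\<dots> = x ^ 4" by (simp add: power_even_abs[of 4 x, symmetric] eval_nat_numeral)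
  finally have "\<bar>x\<bar> \<le> x ^ 4 / e ^ 3" using assms by (simp add: field_simps)
  then show ?thesis using assms by linarith
qed

lemma increment_le_chain_term:
  assumes "0 < v" "k < 2 ^ m"
  shows "\<bar>w (v * (real (Suc k) / 2 ^ m)) - w (v * (real k / 2 ^ m))\<bar> \<le> chain_term v w m"
proof -
  let ?d = "\<lambda>k. w (v * (real (Suc k) / 2 ^ m)) - w (v * (real k / 2 ^ m))"
  note e = chain_scale_pos[OF assms(1), of m]
  have "\<bar>?d k\<bar> \<le> chain_scale v m + ?d k ^ 4 / chain_scale v m ^ 3"
    by (rule abs_le_add_power4[OF e])
  also have "?d k ^ 4 \<le> (\<Sum>k<2 ^ m. ?d k ^ 4)"
    by (rule member_le_sum) (use assms in auto)
  then have "chain_scale v m + ?d k ^ 4 / chain_scale v m ^ 3 \<le> chain_term v w m"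
    unfolding chain_term_def using e by (intro add_left_mono divide_right_mono) auto
  finally show ?thesis .
qed

text \<open>Chaining: a point of the grid of level \<open>m + 1\<close> either belongs to the grid of level \<open>m\<close> or has its
  left neighbour there, so each level costs one increment.\<close>

lemma dyadic_le_chain_sum:
  assumes v: "0 < v" and w0: "w 0 = 0"
  shows "k \<le> 2 ^ m \<Longrightarrow> \<bar>w (v * (real k / 2 ^ m))\<bar> \<le> (\<Sum>i\<le>m. chain_term v w i)"
proof (induction m arbitrary: k)
  case 0
  then have "k = 0 \<or> k = 1" by auto
  then show ?case
    using increment_le_chain_term[OF v, of 0 0 w] chain_term_nonneg[OF v, of w 0] w0 by auto
next
  case (Suc m)
  have half: "real (2 * j) / 2 ^ Suc m = real j / 2 ^ m" for j by simp
  show ?case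
  proof (cases "even k")
    case True
    then obtain j where j: "k = 2 * j" by (elim evenE)
    then have "\<bar>w (v * (real k / 2 ^ Suc m))\<bar> \<le> (\<Sum>i\<le>m. chain_term v w i)"
      using Suc.IH[of j] Suc.prems half[of j] by simp
    then show ?thesis using chain_term_nonneg[OF v, of w "Suc m"] by simp
  next
    case False
    then obtain j where j: "k = Suc (2 * j)" by (metis oddE Suc_eq_plus1)
    then have "2 * j < 2 ^ Suc m" "j \<le> 2 ^ m" using Suc.prems by auto
    then have "\<bar>w (v * (real k / 2 ^ Suc m)) - w (v * (real (2 * j) / 2 ^ Suc m))\<bar> \<le> chain_term v w (Suc m)"
      "\<bar>w (v * (real j / 2 ^ m))\<bar> \<le> (\<Sum>i\<le>m. chain_term v w i)"
      using increment_le_chain_term[OF v, of "2 * j" "Suc m" w] Suc.IH[of j] j by auto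
    then show ?thesis unfolding half sum.atMost_Suc by linarith
  qed
qed

lemma abs_le_chain_bound:
  assumes v: "0 < v" and w0: "w 0 = 0" and w: "continuous_on {0..} w" and u: "0 \<le> u" "u \<le> v"
  shows "ennreal \<bar>w u\<bar> \<le> chain_bound v w"
proof -
  have dy: "ennreal \<bar>w (v * (real k / 2 ^ m))\<bar> \<le> chain_bound v w" if "k \<le> 2 ^ m" for k m
  proof -
    have "ennreal \<bar>w (v * (real k / 2 ^ m))\<bar> \<le> ennreal (\<Sum>i\<le>m. chain_term v w i)"
      by (intro ennreal_leI dyadic_le_chain_sum[where w=w, OF v w0] that)
    also have "\<dots> = (\<Sum>i\<le>m. ennreal (chain_term v w i))"
      by (rule sum_ennreal[symmetric]) (rule chain_term_nonneg[OF v])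
    also have "\<dots> \<le> chain_bound v w"
      unfolding chain_bound_def by (rule sum_le_suminf) auto
    finally show ?thesis .
  qed
  have unit: "ennreal \<bar>w (v * dyadic_unit p)\<bar> \<le> chain_bound v w" for p
  proof (cases "fst p \<le> 2 ^ snd p")
    case True
    then have "dyadic_unit p = real (fst p) / 2 ^ snd p"
      by (simp add: dyadic_unit_def min_def)
    then show ?thesis using dy[OF True] by simp
  next
    case False
    then have "dyadic_unit p = real 1 / 2 ^ 0"
      by (simp add: dyadic_unit_def min_def field_simps)
    then show ?thesis using dy[of 1 0] by simp
  qed
  show ?thesis
  proof (cases "u = v")
    case True
    then show ?thesis using dy[of 1 0] by simp
  next
    case False
    then obtain p where p: "filterlim (\<lambda>n. dyadic_unit (p n)) (at_right (u / v)) sequentially"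
      using dyadic_unit_dense[of "u / v"] u v by auto
    then have "(\<lambda>n. v * dyadic_unit (p n)) \<longlonglongrightarrow> v * (u / v)"
      by (intro tendsto_mult_left) (auto simp: filterlim_at)
    then have "(\<lambda>n. v * dyadic_unit (p n)) \<longlonglongrightarrow> u" using v by simp
    then have "(\<lambda>n. w (v * dyadic_unit (p n))) \<longlonglongrightarrow> w u"
      by (rule continuous_on_tendsto_compose[OF w])
        (use u v in \<open>auto intro!: always_eventually simp: dyadic_unit_bounds\<close>)
    then have "(\<lambda>n. ennreal \<bar>w (v * dyadic_unit (p n))\<bar>) \<longlonglongrightarrow> ennreal \<bar>w u\<bar>"
      by (intro tendsto_ennrealI tendsto_rabs)
    then show ?thesis by (rule LIMSEQ_le_const2) (use unit in auto)
  qed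
qed

lemma measurable_chain_bound_process:
  assumes v: "0 < v" and f: "\<And>t. 0 \<le> t \<Longrightarrow> (\<lambda>x. f x t) \<in> borel_measurable M"
  shows "(\<lambda>x. chain_bound v (f x)) \<in> borel_measurable M"
  unfolding chain_bound_def chain_term_def
  by (intro borel_measurable_suminf_order measurable_compose[OF _ measurable_ennreal] borel_measurable_add
      borel_measurable_divide borel_measurable_sum borel_measurable_power borel_measurable_diff
      f borel_measurable_const) (use v in auto)

lemma measurable_chain_bound: "0 < v \<Longrightarrow> chain_bound v \<in> borel_measurable path_space"
  by (rule measurable_chain_bound_process) auto

lemma chain_bound_restrict: "0 < v \<Longrightarrow> chain_bound v (restrict w {0..}) = chain_bound v w"
  by (simp add: chain_bound_def chain_term_def)

lemma brownian_increment_power4: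
  assumes W: "brownian_motion M x W" and st: "0 \<le> s" "s < t"
  shows "(\<integral>\<^sup>+\<omega>. ennreal ((W t \<omega> - W s \<omega>) ^ 4) \<partial>M) = ennreal (12 * (t - s)\<^sup>2)"
proof -
  define \<sigma> where "\<sigma> = sqrt (2 * (t - s))"
  have \<sigma>: "0 < \<sigma>" using st by (simp add: \<sigma>_def)
  have D: "distributed M lborel (\<lambda>\<omega>. W t \<omega> - W s \<omega>) (normal_density 0 \<sigma>)"
    using W st by (auto simp: brownian_motion_def \<sigma>_def)
  have "integrable lborel (\<lambda>y. normal_density 0 \<sigma> y * y ^ 4)"
    using integrable_normal_moment[OF \<sigma>, of 0 4] by simp
  then have i: "integrable M (\<lambda>\<omega>. (W t \<omega> - W s \<omega>) ^ 4)"
    by (subst distributed_integrable[OF D, symmetric]) auto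
  have "(\<integral>\<omega>. (W t \<omega> - W s \<omega>) ^ 4 \<partial>M) = (\<integral>y. normal_density 0 \<sigma> y * y ^ 4 \<partial>lborel)"
    by (rule distributed_integral[OF D, symmetric]) auto
  also have "\<dots> = 3 * (\<sigma>\<^sup>2)\<^sup>2"
    using integral_normal_moment_even[OF \<sigma>, of 0 2] \<sigma>
    by (simp add: fact_numeral field_simps power2_eq_square)
  also have "\<dots> = 12 * (t - s)\<^sup>2"
    using st by (simp add: \<sigma>_def power2_eq_square algebra_simps)
  finally show ?thesis by (subst nn_integral_eq_integral[OF i]) auto
qed

definition chain_const :: real where
  "chain_const = 13 / (1 - 2 powr (- 1 / 4))"

lemma chain_const_pos: "0 < chain_const"
proof -
  have "(2::real) powr (- 1 / 4) < 1" by (simp add: powr_less_one)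
  then show ?thesis by (simp add: chain_const_def)
qed

text \<open>The increments of level \<open>m\<close> have variance \<open>2 * v / 2 ^ m\<close>. Fourth moments are needed: second moments
  would give the same contribution from every level.\<close>

lemma expected_chain_bound:
  assumes "prob_space M" and W: "brownian_motion M x W" and v: "0 < v"
  shows "(\<integral>\<^sup>+\<omega>. chain_bound v (\<lambda>t. W t \<omega>) \<partial>M) \<le> ennreal (chain_const * sqrt v)"
proof -
  interpret prob_space M by fact
  define q where "q = (2::real) powr (- 1 / 4)"
  have q: "0 < q" "q < 1" "q ^ 4 = 1 / 2"
  proof -
    show "0 < q" "q < 1" by (auto simp: q_def powr_less_one)
    have "q ^ 4 = q powr real 4" using \<open>0 < q\<close> by (rule powr_realpow[symmetric])
    also have "\<dots> = 2 powr (- 1 / 4 * real 4)" by (simp only: q_def powr_powr)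
    finally show "q ^ 4 = 1 / 2" by (simp add: powr_minus_divide)
  qed
  have m: "\<And>t. 0 \<le> t \<Longrightarrow> W t \<in> borel_measurable M"
    using W by (auto simp: brownian_motion_def)
  define d where "d m k \<omega> = W (v * (real (Suc k) / 2 ^ m)) \<omega> - W (v * (real k / 2 ^ m)) \<omega>" for m k \<omega>
  have md: "d m k \<in> borel_measurable M" for m k
    unfolding d_def using v by (intro borel_measurable_diff m) auto
  have tm: "(\<integral>\<^sup>+\<omega>. ennreal (chain_term v (\<lambda>t. W t \<omega>) m) \<partial>M) = ennreal (13 * sqrt v * q ^ m)" for m
  proof -
    define e where "e = chain_scale v m"
    have e: "0 < e" "e = sqrt v * q ^ m"
      using chain_scale_pos[OF v, of m] by (auto simp: e_def chain_scale_def q_def)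
    have d4: "(\<integral>\<^sup>+\<omega>. ennreal ((d m k \<omega>) ^ 4) \<partial>M) = ennreal (12 * (v / 2 ^ m)\<^sup>2)" for k
    proof -
      have "v * (real (Suc k) / 2 ^ m) - v * (real k / 2 ^ m) = v / 2 ^ m"
        by (simp add: field_simps)
      then show ?thesis
        using brownian_increment_power4[OF W, of "v * (real k / 2 ^ m)" "v * (real (Suc k) / 2 ^ m)"] v
        unfolding d_def by (simp add: divide_strict_right_mono)
    qed
    have "(\<integral>\<^sup>+\<omega>. ennreal (chain_term v (\<lambda>t. W t \<omega>) m) \<partial>M) =
        (\<integral>\<^sup>+\<omega>. ennreal e + (\<Sum>k<2 ^ m. ennreal ((d m k \<omega>) ^ 4)) * ennreal (1 / e ^ 3) \<partial>M)"
    proof (rule nn_integral_cong)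
      fix \<omega>
      have "chain_term v (\<lambda>t. W t \<omega>) m = e + (\<Sum>k<2 ^ m. (d m k \<omega>) ^ 4) * (1 / e ^ 3)"
        by (simp add: chain_term_def e_def d_def)
      then show "ennreal (chain_term v (\<lambda>t. W t \<omega>) m) =
          ennreal e + (\<Sum>k<2 ^ m. ennreal ((d m k \<omega>) ^ 4)) * ennreal (1 / e ^ 3)"
        using e(1) by (simp add: ennreal_plus ennreal_mult sum_nonneg sum_ennreal del: times_divide_eq_right mult_1_right)
    qed
    also have "\<dots> = ennreal e + (\<Sum>k<(2::nat) ^ m. ennreal (12 * (v / 2 ^ m)\<^sup>2)) * ennreal (1 / e ^ 3)"
      using md by (simp add: nn_integral_add nn_integral_multc nn_integral_sum emeasure_space_1 d4 del: sum_ennreal)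
    also have "(\<Sum>k<(2::nat) ^ m. ennreal (12 * (v / 2 ^ m)\<^sup>2)) = ennreal (\<Sum>k<(2::nat) ^ m. 12 * (v / 2 ^ m)\<^sup>2)"
      by (rule sum_ennreal) simp
    also have "(\<Sum>k<(2::nat) ^ m. 12 * (v / 2 ^ m)\<^sup>2) = 12 * v\<^sup>2 * (1 / 2) ^ m"
      by (simp add: power2_eq_square power_divide)
    also have "ennreal e + ennreal (12 * v\<^sup>2 * (1 / 2) ^ m) * ennreal (1 / e ^ 3) =
        ennreal (e + 12 * v\<^sup>2 * (1 / 2) ^ m * (1 / e ^ 3))"
      using e(1) by (simp add: ennreal_plus ennreal_mult del: times_divide_eq_right mult_1_right)
    also have "12 * v\<^sup>2 * (1 / 2) ^ m * (1 / e ^ 3) = 12 * e"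
    proof -
      have "v\<^sup>2 = sqrt v ^ 4"
        using v by (simp add: power4_eq_xxxx power2_eq_square)
      moreover have "(1 / 2) ^ m = (q ^ m) ^ 4"
        unfolding q(3)[symmetric] by (simp add: power_mult[symmetric] mult.commute)
      ultimately have "v\<^sup>2 * (1 / 2) ^ m = e ^ 4"
        by (simp add: e(2) power_mult_distrib)
      then have "12 * v\<^sup>2 * (1 / 2) ^ m * (1 / e ^ 3) = 12 * (e ^ 4 / e ^ 3)" by simp
      also have "e ^ 4 / e ^ 3 = e" using e(1) by (simp add: power_eq_if)
      finally show ?thesis .
    qed
    finally show ?thesis by (simp add: e(2) algebra_simps)
  qed
  have tmm: "(\<lambda>\<omega>. ennreal (chain_term v (\<lambda>t. W t \<omega>) m)) \<in> borel_measurable M" for m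
    unfolding chain_term_def d_def[symmetric]
    by (intro measurable_compose[OF _ measurable_ennreal] borel_measurable_add
        borel_measurable_divide borel_measurable_sum borel_measurable_power md borel_measurable_const)
  have "(\<integral>\<^sup>+\<omega>. chain_bound v (\<lambda>t. W t \<omega>) \<partial>M) = (\<Sum>m. ennreal (13 * sqrt v * q ^ m))"
    unfolding chain_bound_def by (subst nn_integral_suminf[OF tmm]) (simp add: tm)
  also have "\<dots> = ennreal (13 * sqrt v * (1 / (1 - q)))"
    using sums_mult[OF geometric_sums[of q], of "13 * sqrt v"] q v
    by (intro suminf_ennreal_eq) auto
  finally show ?thesis by (simp add: chain_const_def q_def mult.commute)
qed

section \<open>Integrability of the Brownian range\<close>

lemma nn_integral_indep_processes:
  assumes "prob_space M" and ind: "indep_processes M W S"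
    and f: "f \<in> borel_measurable path_space" and g: "g \<in> borel_measurable path_space"
  shows "(\<integral>\<^sup>+\<omega>. f (\<lambda>t\<in>{0..}. W t \<omega>) * g (\<lambda>t\<in>{0..}. S t \<omega>) \<partial>M) =
    (\<integral>\<^sup>+\<omega>. f (\<lambda>t\<in>{0..}. W t \<omega>) \<partial>M) * (\<integral>\<^sup>+\<omega>. g (\<lambda>t\<in>{0..}. S t \<omega>) \<partial>M)"
proof -
  interpret prob_space M by fact
  have pW: "(\<lambda>\<omega>. \<lambda>t\<in>{0..}. W t \<omega>) \<in> measurable M path_space"
    and pS: "(\<lambda>\<omega>. \<lambda>t\<in>{0..}. S t \<omega>) \<in> measurable M path_space"
    using ind unfolding indep_processes_def by (auto dest: indep_var_rv1 indep_var_rv2)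
  interpret S: prob_space "path_law M S" unfolding path_law_def by (rule prob_space_distr[OF pS])
  have f': "f \<in> borel_measurable (path_law M W)" and g': "g \<in> borel_measurable (path_law M S)"
    using f g by (simp_all add: path_law_def)
  have fg: "(\<lambda>x. f (fst x) * g (snd x)) \<in> borel_measurable (path_law M W \<Otimes>\<^sub>M path_law M S)"
    using f' g' by measurable
  have fg': "(\<lambda>x. f (fst x) * g (snd x)) \<in> borel_measurable (path_space \<Otimes>\<^sub>M path_space)"
    using f g by measurable
  have "(\<integral>\<^sup>+\<omega>. f (\<lambda>t\<in>{0..}. W t \<omega>) * g (\<lambda>t\<in>{0..}. S t \<omega>) \<partial>M) =
      (\<integral>\<^sup>+x. f (fst x) * g (snd x) \<partial>pair_law M W S)"
    unfolding pair_law_def by (subst nn_integral_distr[OF measurable_Pair[OF pW pS]]) (use fg' in simp_all)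
  also have "\<dots> = (\<integral>\<^sup>+w. \<integral>\<^sup>+s. f w * g s \<partial>path_law M S \<partial>path_law M W)"
    unfolding pair_law_indep[OF assms(1) ind] by (subst S.nn_integral_fst[OF fg, symmetric]) simp
  also have "\<dots> = (\<integral>\<^sup>+w. f w \<partial>path_law M W) * (\<integral>\<^sup>+s. g s \<partial>path_law M S)"
    using f' g' by (simp add: nn_integral_cmult nn_integral_multc)
  also have "(\<integral>\<^sup>+w. f w \<partial>path_law M W) = (\<integral>\<^sup>+\<omega>. f (\<lambda>t\<in>{0..}. W t \<omega>) \<partial>M)"
    unfolding path_law_def by (rule nn_integral_distr[OF pW]) (simp add: f)
  also have "(\<integral>\<^sup>+s. g s \<partial>path_law M S) = (\<integral>\<^sup>+\<omega>. g (\<lambda>t\<in>{0..}. S t \<omega>) \<partial>M)"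
    unfolding path_law_def by (rule nn_integral_distr[OF pS]) (simp add: g)
  finally show ?thesis .
qed

lemma subordinator_laplace:
  assumes "stable_subordinator M \<beta> S" "0 < u" "0 \<le> t"
  shows "(\<integral>\<omega>. exp (- (u * S t \<omega>)) \<partial>M) = exp (- (t * u powr \<beta>))"
proof -
  have "\<forall>u>0. \<forall>t\<ge>0. (\<integral>\<omega>. exp (- u * S t \<omega>) \<partial>M) = exp (- t * u powr \<beta>)"
    using assms(1) unfolding stable_subordinator_def by blast
  from this[rule_format, OF assms(2,3)] show ?thesis by simp
qed

lemma integrable_subordinator_laplace:
  assumes "prob_space M" and S: "stable_subordinator M \<beta> S" and ut: "0 < u" "0 \<le> t"
  shows "integrable M (\<lambda>\<omega>. exp (- (u * S t \<omega>)))"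
proof -
  interpret prob_space M by fact
  have [measurable]: "S t \<in> borel_measurable M"
    using S ut by (auto simp: stable_subordinator_def levy_process_def)
  show ?thesis
    by (rule integrable_const_bound[where B=1]) (use subordinator_nonneg[OF S ut(2)] ut in auto)
qed

text \<open>Markov's inequality for \<open>1 - exp (- S 1 / c)\<close>, which is at least \<open>1 - exp (- 1)\<close> when \<open>c \<le> S 1\<close>.\<close>

lemma subordinator_tail:
  assumes "prob_space M" and S: "stable_subordinator M \<beta> S" and c: "0 < c"
  shows "measure M {\<omega> \<in> space M. c \<le> S 1 \<omega>} \<le> c powr (- \<beta>) / (1 - exp (- 1))"
proof -
  interpret prob_space M by fact
  have [measurable]: "S 1 \<in> borel_measurable M"
    using S by (auto simp: stable_subordinator_def levy_process_def)
  have nn: "AE \<omega> in M. 0 \<le> S 1 \<omega>" by (rule subordinator_nonneg[OF S]) simp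
  let ?A = "{\<omega> \<in> space M. c \<le> S 1 \<omega>}"
  have lap: "(\<integral>\<omega>. exp (- (1 / c * S 1 \<omega>)) \<partial>M) = exp (- (c powr (- \<beta>)))"
    using subordinator_laplace[OF S, of "1 / c" 1] c by (simp add: powr_divide powr_minus_divide)
  have int: "integrable M (\<lambda>\<omega>. exp (- (1 / c * S 1 \<omega>)))"
    by (rule integrable_subordinator_laplace[OF assms(1) S]) (use c in auto)
  have "(1 - exp (- 1)) * measure M ?A = (\<integral>\<omega>. (1 - exp (- 1)) * indicator ?A \<omega> \<partial>M)"
    by simp
  also have "\<dots> \<le> (\<integral>\<omega>. 1 - exp (- (1 / c * S 1 \<omega>)) \<partial>M)"
  proof (rule integral_mono_AE)
    show "AE \<omega> in M. (1 - exp (- 1)) * indicator ?A \<omega> \<le> 1 - exp (- (1 / c * S 1 \<omega>))"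
      using nn by eventually_elim (use c in \<open>auto simp: indicator_def field_simps\<close>)
    show "integrable M (\<lambda>\<omega>. (1 - exp (- 1)) * indicator ?A \<omega> :: real)"
    proof (rule integrable_const_bound[where B=1])
      show "AE \<omega> in M. norm ((1 - exp (- 1)) * indicator ?A \<omega> :: real) \<le> 1"
        by (rule AE_I2) (auto simp: indicator_def abs_if)
    qed measurable
  qed (use int in auto)
  also have "\<dots> = 1 - exp (- (c powr (- \<beta>)))"
    using int lap by (simp add: prob_space)
  also have "\<dots> \<le> c powr (- \<beta>)" using exp_ge_add_one_self[of "- (c powr (- \<beta>))"] by linarith
  finally show ?thesis by (simp add: field_simps)
qed

text \<open>Decomposing according to the powers of \<open>4\<close> between which \<open>s 1\<close> lies separates the two paths in each
  summand, so that independence applies to each of them.\<close>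

lemma range_le_chain_sum:
  assumes reg: "regular_pair w s"
  shows "ennreal (snd (extremes elapsed_times (w, s)) - fst (extremes elapsed_times (w, s))) \<le>
     2 * (chain_bound 1 w + (\<Sum>j. chain_bound (4 ^ Suc j) w * indicator {4 ^ j..} (s 1)))"
proof -
  let ?K = "chain_bound 1 w + (\<Sum>j. chain_bound (4 ^ Suc j) w * indicator {4 ^ j..} (s 1))"
  let ?e = "extremes elapsed_times (w, s)"
  have w: "w 0 = 0" "continuous_on {0..} w" using reg by (auto simp: regular_pair_def)
  have bd: "ennreal \<bar>w u\<bar> \<le> ?K" if u: "0 \<le> u" "u \<le> s 1" for u
  proof (cases "s 1 < 1")
    case True
    then have "ennreal \<bar>w u\<bar> \<le> chain_bound 1 w"
      using u by (intro abs_le_chain_bound w) auto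
    also have "\<dots> \<le> ?K" by simp
    finally show ?thesis .
  next
    case False
    then have "\<exists>j. s 1 < 4 ^ Suc j" by (meson power_Suc_less_one real_arch_pow less_trans lessI one_less_numeral_iff power_strict_increasing semiring_norm(76,78))
    \<comment> \<open>The index with \<open>4 ^ j \<le> s 1 < 4 ^ Suc j\<close>.\<close>
    define j where "j = (LEAST j. s 1 < 4 ^ Suc j)"
    have j: "s 1 < 4 ^ Suc j" unfolding j_def by (rule LeastI_ex) fact
    have j': "4 ^ j \<le> s 1"
    proof (cases j)
      case 0 then show ?thesis using False by simp
    next
      case (Suc i)
      then have "\<not> s 1 < 4 ^ Suc i" unfolding j_def by (intro not_less_Least) simp
      then show ?thesis using Suc by simp
    qed
    have "ennreal \<bar>w u\<bar> \<le> chain_bound (4 ^ Suc j) w * indicator {4 ^ j..} (s 1)"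
      using u j j' abs_le_chain_bound[OF _ w, of "4 ^ Suc j" u] by simp
    also have "\<dots> \<le> (\<Sum>j. chain_bound (4 ^ Suc j) w * indicator {4 ^ j..} (s 1))"
    proof -
      define F where "F i = chain_bound (4 ^ Suc i) w * indicator {4 ^ i..} (s 1)" for i
      have "F j \<le> (\<Sum>i. F i)" using sum_le_suminf[of F "{j}"] by simp
      then show ?thesis by (simp only: F_def)
    qed
    also have "\<dots> \<le> ?K" by simp
    finally show ?thesis .
  qed
  show ?thesis
  proof (cases "?K = \<top>")
    case True
    show ?thesis unfolding True by (simp add: ennreal_mult_top)
  next
    case False
    then obtain B where B: "?K = ennreal B" "0 \<le> B" by (cases ?K) auto
    have "\<bar>w u\<bar> \<le> B" if "0 \<le> u" "u \<le> s 1" for u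
      using bd[OF that] B(2) unfolding B(1) by (simp add: ennreal_le_iff)
    then have "\<bar>w (elapsed_times s p)\<bar> \<le> B" for p
      using path_times_bounds[OF reg, of elapsed_times p] by blast
    then have "- B \<le> w (elapsed_times s p)" "w (elapsed_times s p) \<le> B" for p
      by (auto simp: abs_le_iff minus_le_iff)
    then have "- B \<le> fst ?e" "snd ?e \<le> B"
      using extremes_bounds(3,4)[OF reg, of elapsed_times] by blast+
    then have "ennreal (snd ?e - fst ?e) \<le> ennreal (2 * B)" by (intro ennreal_leI) linarith
    also have "\<dots> = 2 * ?K" unfolding B(1) using B(2) by (simp add: ennreal_mult)
    finally show ?thesis .
  qed
qed

text \<open>The summand with index \<open>j\<close> has mean of order \<open>(4 ^ j) powr (- \<beta>) * sqrt (4 ^ j)\<close>, a convergent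
  geometric series precisely when \<open>\<beta> > 1 / 2\<close>.\<close>

lemma integrable_brownian_range:
  assumes std: "standard_pair M \<beta> W S" and \<beta>: "1 / 2 < \<beta>"
  shows "integrable M (\<lambda>\<omega>. snd (extremes elapsed_times (\<lambda>t. W t \<omega>, \<lambda>t. S t \<omega>)) -
     fst (extremes elapsed_times (\<lambda>t. W t \<omega>, \<lambda>t. S t \<omega>)))" (is "integrable M ?R")
proof (rule integrableI_nonneg)
  have M: "prob_space M" and W: "brownian_motion M 0 W" and S: "stable_subordinator M \<beta> S"
    and ind: "indep_processes M W S"
    using std by (auto simp: standard_pair_def)
  interpret prob_space M by fact
  have ext[measurable]: "(\<lambda>\<omega>. extremes elapsed_times (\<lambda>t. W t \<omega>, \<lambda>t. S t \<omega>)) \<in> measurable M (borel \<Otimes>\<^sub>M borel)"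
    using extremes_random_variable(1)[OF std, of elapsed_times] by (simp add: borel_prod)
  show "?R \<in> borel_measurable M" by measurable
  show "AE \<omega> in M. 0 \<le> ?R \<omega>"
    using AE_regular_pair[OF std]
  proof eventually_elim
    case (elim \<omega>)
    then show ?case using extremes_bounds(1,2)[OF elim, of elapsed_times undefined] by simp
  qed
  let ?W = "\<lambda>\<omega>. \<lambda>t\<in>{0..}. W t \<omega>" and ?S = "\<lambda>\<omega>. \<lambda>t\<in>{0..}. S t \<omega>"
  let ?K = "\<lambda>\<omega>. chain_bound 1 (?W \<omega>) + (\<Sum>j. chain_bound (4 ^ Suc j) (?W \<omega>) * indicator {4 ^ j..} (?S \<omega> 1))"
  have pW: "?W \<in> measurable M path_space" and pS: "?S \<in> measurable M path_space"
    using ind unfolding indep_processes_def by (auto dest: indep_var_rv1 indep_var_rv2)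
  have gm: "(\<lambda>s. indicator {4 ^ j..} (s 1) :: ennreal) \<in> borel_measurable path_space" for j :: nat
    by (rule measurable_compose[OF measurable_component_singleton]) auto
  have cm: "(\<lambda>\<omega>. chain_bound v (?W \<omega>)) \<in> borel_measurable M" if "0 < v" for v
    by (rule measurable_compose[OF pW measurable_chain_bound[OF that]])
  have im: "(\<lambda>\<omega>. indicator {4 ^ j..} (?S \<omega> 1) :: ennreal) \<in> borel_measurable M" for j :: nat
    by (rule measurable_compose[OF pS gm])
  define r where "r = 2 * (4::real) powr (- \<beta>)"
  have r: "0 \<le> r" "r < 1"
  proof -
    have "(4::real) powr (- \<beta>) < 4 powr (- (1 / 2))" using \<beta> by (intro powr_less_mono) auto
    also have "\<dots> = 1 / 2" by (simp add: powr_minus powr_half_sqrt)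
    finally show "0 \<le> r" "r < 1" by (auto simp: r_def)
  qed
  define C where "C = 2 * chain_const / (1 - exp (- 1))"
  have C: "0 \<le> C" unfolding C_def using chain_const_pos by simp
  have cb: "(\<integral>\<^sup>+\<omega>. chain_bound v (?W \<omega>) \<partial>M) \<le> ennreal (chain_const * sqrt v)" if "0 < v" for v
    using expected_chain_bound[OF M W that] by (simp add: chain_bound_restrict[OF that])
  have summand: "(\<integral>\<^sup>+\<omega>. chain_bound (4 ^ Suc j) (?W \<omega>) * indicator {4 ^ j..} (?S \<omega> 1) \<partial>M) \<le> ennreal (C * r ^ j)" for j
  proof -
    have "(\<integral>\<^sup>+\<omega>. chain_bound (4 ^ Suc j) (?W \<omega>) * indicator {4 ^ j..} (?S \<omega> 1) \<partial>M) =
        (\<integral>\<^sup>+\<omega>. chain_bound (4 ^ Suc j) (?W \<omega>) \<partial>M) * (\<integral>\<^sup>+\<omega>. indicator {4 ^ j..} (?S \<omega> 1) \<partial>M)"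
      by (rule nn_integral_indep_processes[OF M ind measurable_chain_bound gm]) simp
    also have "(\<integral>\<^sup>+\<omega>. indicator {4 ^ j..} (?S \<omega> 1) \<partial>M) = (\<integral>\<^sup>+\<omega>. indicator {\<omega> \<in> space M. 4 ^ j \<le> S 1 \<omega>} \<omega> \<partial>M)"
      by (rule nn_integral_cong) (auto simp: indicator_def)
    also have "\<dots> = ennreal (measure M {\<omega> \<in> space M. 4 ^ j \<le> S 1 \<omega>})"
    proof -
      have "S 1 \<in> borel_measurable M" using S by (auto simp: stable_subordinator_def levy_process_def)
      then show ?thesis by (simp add: emeasure_eq_measure)
    qed
    also have "(\<integral>\<^sup>+\<omega>. chain_bound (4 ^ Suc j) (?W \<omega>) \<partial>M) * ennreal (measure M {\<omega> \<in> space M. 4 ^ j \<le> S 1 \<omega>}) \<le>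
        ennreal (chain_const * sqrt (4 ^ Suc j)) * ennreal ((4 ^ j) powr (- \<beta>) / (1 - exp (- 1)))"
      by (intro mult_mono ennreal_leI subordinator_tail[OF M S] cb) auto
    also have "\<dots> = ennreal (chain_const * sqrt (4 ^ Suc j) * ((4 ^ j) powr (- \<beta>) / (1 - exp (- 1))))"
      using chain_const_pos by (intro ennreal_mult[symmetric]) auto
    also have "chain_const * sqrt (4 ^ Suc j) * ((4 ^ j) powr (- \<beta>) / (1 - exp (- 1))) = C * r ^ j"
    proof -
      have "sqrt (4 ^ Suc j) = 2 * 2 ^ j"
        by (simp add: real_sqrt_mult real_sqrt_power)
      moreover have "(4 ^ j) powr (- \<beta>) = (4 powr (- \<beta>)) ^ j"
        by (simp add: powr_realpow[symmetric] powr_powr mult.commute)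
      ultimately show ?thesis by (simp add: C_def r_def power_mult_distrib)
    qed
    finally show ?thesis .
  qed
  have "(\<integral>\<^sup>+\<omega>. ennreal (?R \<omega>) \<partial>M) \<le> (\<integral>\<^sup>+\<omega>. 2 * ?K \<omega> \<partial>M)"
  proof (rule nn_integral_mono_AE)
    show "AE \<omega> in M. ennreal (?R \<omega>) \<le> 2 * ?K \<omega>"
      using AE_regular_pair[OF std]
    proof eventually_elim
      case (elim \<omega>)
      show ?case using range_le_chain_sum[OF elim] by (simp add: chain_bound_restrict)
    qed
  qed
  also have "\<dots> = 2 * ((\<integral>\<^sup>+\<omega>. chain_bound 1 (?W \<omega>) \<partial>M) +
      (\<Sum>j. \<integral>\<^sup>+\<omega>. chain_bound (4 ^ Suc j) (?W \<omega>) * indicator {4 ^ j..} (?S \<omega> 1) \<partial>M))"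
    using cm im by (simp add: nn_integral_cmult nn_integral_add nn_integral_suminf borel_measurable_suminf_order del: power_Suc restrict_apply)
  also have "\<dots> \<le> 2 * (ennreal (chain_const * sqrt 1) + (\<Sum>j. ennreal (C * r ^ j)))"
    using cb[of 1] summand by (intro mult_left_mono add_mono suminf_le) auto
  also have "(\<Sum>j. ennreal (C * r ^ j)) = ennreal (C * (1 / (1 - r)))"
    using sums_mult[OF geometric_sums[of r], of C] r C by (intro suminf_ennreal_eq) auto
  finally show "(\<integral>\<^sup>+\<omega>. ennreal (?R \<omega>) \<partial>M) < \<infinity>"
    by (simp add: ennreal_mult_less_top order_le_less_trans)
qed

section \<open>Brownian excursions between two windows\<close>

lemma three_increments_indep:
  assumes "prob_space M" and ind: "indep_increments M X" and m: "\<And>t. 0 \<le> t \<Longrightarrow> X t \<in> borel_measurable M"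
    and t: "0 \<le> t0" "t0 < t1" "t1 < t2" "t2 < t3"
    and A: "A \<in> sets borel" "B \<in> sets borel" "C \<in> sets borel"
  shows "measure M {\<omega> \<in> space M. X t1 \<omega> - X t0 \<omega> \<in> A \<and> X t2 \<omega> - X t1 \<omega> \<in> B \<and> X t3 \<omega> - X t2 \<omega> \<in> C} =
    measure M {\<omega> \<in> space M. X t1 \<omega> - X t0 \<omega> \<in> A} * measure M {\<omega> \<in> space M. X t2 \<omega> - X t1 \<omega> \<in> B} *
    measure M {\<omega> \<in> space M. X t3 \<omega> - X t2 \<omega> \<in> C}"
proof -
  interpret prob_space M by fact
  define t where "t = (\<lambda>i::nat. [t0, t1, t2, t3] ! i)"
  define E where "E = (\<lambda>i::nat. [A, B, C] ! i)"
  let ?D = "\<lambda>i \<omega>. X (t (Suc i)) \<omega> - X (t i) \<omega>"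
  have l3: "{..<3::nat} = {0, 1, 2}" by auto
  have "indep_vars (\<lambda>_. borel) ?D {..<3}"
    using ind[unfolded indep_increments_def, rule_format, of t 3] t
    by (auto simp: t_def numeral_3_eq_3 less_Suc_eq)
  moreover have "E i \<in> sets borel" if "i \<in> {..<3}" for i
    using A that unfolding l3 by (auto simp: E_def numeral_2_eq_2)
  ultimately have "prob (\<Inter>i\<in>{..<3}. ?D i -` E i \<inter> space M) = (\<Prod>i<3. prob (?D i -` E i \<inter> space M))"
    by (intro indep_varsD_finite) (auto simp: l3)
  moreover have "(\<Inter>i\<in>{..<3}. ?D i -` E i \<inter> space M) =
      {\<omega> \<in> space M. X t1 \<omega> - X t0 \<omega> \<in> A \<and> X t2 \<omega> - X t1 \<omega> \<in> B \<and> X t3 \<omega> - X t2 \<omega> \<in> C}"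
    unfolding l3 by (auto simp: E_def t_def numeral_2_eq_2)
  moreover have "?D 0 -` E 0 \<inter> space M = {\<omega> \<in> space M. X t1 \<omega> - X t0 \<omega> \<in> A}"
    "?D 1 -` E 1 \<inter> space M = {\<omega> \<in> space M. X t2 \<omega> - X t1 \<omega> \<in> B}"
    "?D 2 -` E 2 \<inter> space M = {\<omega> \<in> space M. X t3 \<omega> - X t2 \<omega> \<in> C}"
    by (auto simp: E_def t_def numeral_2_eq_2)
  ultimately show ?thesis unfolding l3 by simp
qed

definition normal_tail :: real where
  "normal_tail = measure (density lborel std_normal_density) {1<..}"

lemma normal_tail_pos: "0 < normal_tail"
proof -
  interpret prob_space "density lborel std_normal_density"
    by (rule prob_space_normal_density) simp
  have "{1<..} \<notin> null_sets (density lborel std_normal_density)"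
  proof
    assume "{1<..} \<in> null_sets (density lborel std_normal_density)"
    then have "AE x in lborel. x \<in> {1<..} \<longrightarrow> ennreal (std_normal_density x) = 0"
      by (subst (asm) null_sets_density_iff) auto
    then have "AE x in lborel. x \<notin> {1<..(2::real)}"
    proof eventually_elim
      case (elim x)
      then show ?case using normal_density_pos[of 1 0 x] by (auto simp: ennreal_eq_0_iff)
    qed
    then have "emeasure lborel {1<..(2::real)} = 0"
      by (subst (asm) AE_iff_measurable[where N="{1<..2}"]) auto
    then show False by simp
  qed
  then have "measure (density lborel std_normal_density) {1<..} \<noteq> 0"
    by (auto simp: null_sets_def emeasure_eq_measure)
  then show ?thesis by (simp add: normal_tail_def zero_less_measure_iff)
qed

text \<open>Rescaling to a standard normal variable gives a bound that is uniform over all standard deviations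
  \<open>\<sigma> \<ge> 1\<close>.\<close>

lemma normal_tail_le:
  assumes "prob_space M" and D: "distributed M lborel X (normal_density 0 \<sigma>)" and \<sigma>: "1 \<le> \<sigma>"
  shows "normal_tail \<le> measure M {\<omega> \<in> space M. X \<omega> \<in> {1<..}}"
    and "normal_tail \<le> measure M {\<omega> \<in> space M. X \<omega> \<in> {..<-1}}"
proof -
  interpret prob_space M by fact
  have X: "X \<in> borel_measurable M" using distributed_measurable[OF D] by simp
  have gen: "normal_tail \<le> measure M {\<omega> \<in> space M. X \<omega> \<in> A}"
    if c: "\<bar>c\<bar> = 1 / \<sigma>" and A: "A \<in> sets borel" "\<And>x. 1 < c * x \<Longrightarrow> x \<in> A" for c A
  proof -
    have "distributed M lborel (\<lambda>\<omega>. 0 + c * X \<omega>) (normal_density (0 + c * 0) (\<bar>c\<bar> * \<sigma>))"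
      using c \<sigma> by (intro normal_density_affine[OF D]) auto
    then have D': "distributed M lborel (\<lambda>\<omega>. c * X \<omega>) std_normal_density"
      using c \<sigma> by simp
    have "normal_tail = measure (distr M lborel (\<lambda>\<omega>. c * X \<omega>)) {1<..}"
      unfolding normal_tail_def distributed_distr_eq_density[OF D'] ..
    also have "\<dots> = measure M ((\<lambda>\<omega>. c * X \<omega>) -` {1<..} \<inter> space M)"
      using X by (intro measure_distr) auto
    also have "\<dots> \<le> measure M {\<omega> \<in> space M. X \<omega> \<in> A}"
    proof (rule finite_measure_mono)
      show "{\<omega> \<in> space M. X \<omega> \<in> A} \<in> sets M"
        using measurable_sets[OF X A(1)] by (simp add: vimage_def Int_def conj_commute)
    qed (use A in auto)
    finally show ?thesis .
  qed
  show "normal_tail \<le> measure M {\<omega> \<in> space M. X \<omega> \<in> {1<..}}"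
  proof (rule gen[of "1 / \<sigma>" "{1<..}"])
    fix x assume "1 < 1 / \<sigma> * x"
    then have "\<sigma> < x" using \<sigma> by (simp add: field_simps)
    then show "x \<in> {1<..}" using \<sigma> by simp
  qed (use \<sigma> in auto)
  show "normal_tail \<le> measure M {\<omega> \<in> space M. X \<omega> \<in> {..<-1}}"
  proof (rule gen[of "- 1 / \<sigma>" "{..<-1}"])
    fix x assume "1 < - 1 / \<sigma> * x"
    then have "\<sigma> < - x" using \<sigma> by (simp add: field_simps)
    then show "x \<in> {..<-1}" using \<sigma> by simp
  qed (use \<sigma> in auto)
qed

text \<open>When such a path is continuous and starts at \<open>0\<close>, its value at time \<open>1\<close> exceeds all values on the windows \<open>[0, u]\<close> and
  \<open>[v, v + 2 * u]\<close>: on the first they are at most \<open>1\<close>, on the second at most \<open>w v + 1 < w 1\<close>. Bounding the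
  oscillation on the windows by \<open>chain_bound\<close> makes this a measurable set of paths.\<close>

definition excursion_paths :: "real \<Rightarrow> real \<Rightarrow> (real \<Rightarrow> real) set" where
  "excursion_paths u v = {w \<in> space path_space. w 1 - w 0 \<in> {1<..} \<and> w v - w 1 \<in> {..<-1} \<and>
     chain_bound u w \<le> 1 \<and> chain_bound (2 * u) (\<lambda>h. w (v + h) - w v) \<le> 1}"

lemma sets_excursion_paths:
  assumes "0 < u" "0 \<le> v"
  shows "excursion_paths u v \<in> sets path_space"
proof -
  have ev: "(\<lambda>w. w t) \<in> borel_measurable path_space" if "0 \<le> t" for t :: real
    using that by (intro measurable_component_singleton) auto
  have [measurable]: "(\<lambda>w. w 1) \<in> borel_measurable path_space" "(\<lambda>w. w 0) \<in> borel_measurable path_space"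
    "(\<lambda>w. w v) \<in> borel_measurable path_space"
    using assms by (auto intro: ev)
  have [measurable]: "chain_bound u \<in> borel_measurable path_space"
    using assms by (intro measurable_chain_bound)
  have [measurable]: "(\<lambda>w. chain_bound (2 * u) (\<lambda>h. w (v + h) - w v)) \<in> borel_measurable path_space"
    using assms by (intro measurable_chain_bound_process borel_measurable_diff ev) auto
  show ?thesis unfolding excursion_paths_def by measurable
qed

lemma chain_bound_exceed:
  assumes "prob_space M" and W: "brownian_motion M 0 W" and v: "0 < v"
  shows "measure M {\<omega> \<in> space M. \<not> chain_bound v (\<lambda>t. W t \<omega>) \<le> 1} \<le> chain_const * sqrt v"
proof -
  interpret prob_space M by fact
  have m: "(\<lambda>\<omega>. chain_bound v (\<lambda>t. W t \<omega>)) \<in> borel_measurable M"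
    using W by (intro measurable_chain_bound_process v) (auto simp: brownian_motion_def)
  have "emeasure M {\<omega> \<in> space M. \<not> chain_bound v (\<lambda>t. W t \<omega>) \<le> 1} \<le>
      emeasure M {\<omega> \<in> space M. 1 \<le> 1 * chain_bound v (\<lambda>t. W t \<omega>)}"
  proof (rule emeasure_mono)
    show "{\<omega> \<in> space M. 1 \<le> 1 * chain_bound v (\<lambda>t. W t \<omega>)} \<in> sets M"
      using m by measurable
  qed auto
  also have "\<dots> \<le> 1 * (\<integral>\<^sup>+\<omega>. chain_bound v (\<lambda>t. W t \<omega>) * indicator (space M) \<omega> \<partial>M)"
    using nn_integral_Markov_inequality[OF _ , of "\<lambda>\<omega>. chain_bound v (\<lambda>t. W t \<omega>)" "space M" M 1] m by simp
  also have "\<dots> = (\<integral>\<^sup>+\<omega>. chain_bound v (\<lambda>t. W t \<omega>) \<partial>M)"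
    by (subst mult_1, rule nn_integral_cong) (simp add: indicator_def)
  also have "\<dots> \<le> ennreal (chain_const * sqrt v)"
    by (rule expected_chain_bound[OF assms])
  finally show ?thesis
    using chain_const_pos v by (simp add: emeasure_eq_measure ennreal_le_iff)
qed

text \<open>The two large increments are independent and have probability bounded below, uniformly in \<open>v\<close>. The
  oscillation on short windows is controlled by Markov's inequality and subtracted.\<close>

lemma excursion_probability:
  assumes "prob_space M" and W: "brownian_motion M 0 W" and u: "0 < u" and v: "2 \<le> v"
  shows "normal_tail\<^sup>2 - chain_const * sqrt u - chain_const * sqrt (2 * u) \<le>
     measure M {\<omega> \<in> space M. (\<lambda>t\<in>{0..}. W t \<omega>) \<in> excursion_paths u v}"
proof -
  interpret prob_space M by fact
  have m: "\<And>t. 0 \<le> t \<Longrightarrow> W t \<in> borel_measurable M" and ind: "indep_increments M W"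
    and nrm: "\<And>s t. 0 \<le> s \<Longrightarrow> s < t \<Longrightarrow>
       distributed M lborel (\<lambda>\<omega>. W t \<omega> - W s \<omega>) (normal_density 0 (sqrt (2 * (t - s))))"
    using W by (auto simp: brownian_motion_def)
  let ?A = "{\<omega> \<in> space M. W 1 \<omega> - W 0 \<omega> \<in> {1<..} \<and> W v \<omega> - W 1 \<omega> \<in> {..<-1} \<and> W (v + 1) \<omega> - W v \<omega> \<in> UNIV}"
  let ?B = "{\<omega> \<in> space M. \<not> chain_bound u (\<lambda>t. W t \<omega>) \<le> 1}"
  let ?C = "{\<omega> \<in> space M. \<not> chain_bound (2 * u) (\<lambda>t. W (v + t) \<omega> - W v \<omega>) \<le> 1}"
  let ?G = "{\<omega> \<in> space M. (\<lambda>t\<in>{0..}. W t \<omega>) \<in> excursion_paths u v}"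
  have pA: "normal_tail\<^sup>2 \<le> prob ?A"
  proof -
    have "prob ?A = prob {\<omega> \<in> space M. W 1 \<omega> - W 0 \<omega> \<in> {1<..}} * prob {\<omega> \<in> space M. W v \<omega> - W 1 \<omega> \<in> {..<-1}}
        * prob {\<omega> \<in> space M. W (v + 1) \<omega> - W v \<omega> \<in> UNIV}"
      by (rule three_increments_indep[OF assms(1) ind m]) (use v in auto)
    moreover have "normal_tail \<le> prob {\<omega> \<in> space M. W 1 \<omega> - W 0 \<omega> \<in> {1<..}}"
      by (rule normal_tail_le(1)[OF assms(1) nrm]) auto
    moreover have "normal_tail \<le> prob {\<omega> \<in> space M. W v \<omega> - W 1 \<omega> \<in> {..<-1}}"
      by (rule normal_tail_le(2)[OF assms(1) nrm]) (use v in auto)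
    ultimately show ?thesis
      using normal_tail_pos by (auto simp: prob_space power2_eq_square intro!: mult_mono)
  qed
  have W': "brownian_motion M 0 (\<lambda>t \<omega>. W (v + t) \<omega> - W v \<omega>)"
    using brownian_motion_shift[OF assms(1) W, of v] v by simp
  have pB: "prob ?B \<le> chain_const * sqrt u" by (rule chain_bound_exceed[OF assms(1) W u])
  have pC: "prob ?C \<le> chain_const * sqrt (2 * u)"
    using chain_bound_exceed[OF assms(1) W', of "2 * u"] u by simp
  have pW: "(\<lambda>\<omega>. \<lambda>t\<in>{0..}. W t \<omega>) \<in> measurable M path_space"
    by (rule measurable_restrict) (simp add: m)
  have mG: "?G \<in> events"
    using measurable_sets[OF pW sets_excursion_paths[of u v]] u v by (simp add: vimage_def Int_def conj_commute)
  have mB: "?B \<in> events"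
  proof -
    have "(\<lambda>\<omega>. chain_bound u (\<lambda>t. W t \<omega>)) \<in> borel_measurable M"
      by (intro measurable_chain_bound_process u m)
    then show ?thesis by measurable
  qed
  have mC: "?C \<in> events"
  proof -
    have "(\<lambda>\<omega>. chain_bound (2 * u) (\<lambda>t. W (v + t) \<omega> - W v \<omega>)) \<in> borel_measurable M"
      using u v by (intro measurable_chain_bound_process borel_measurable_diff m) auto
    then show ?thesis by measurable
  qed
  have sub: "?A \<subseteq> ?G \<union> (?B \<union> ?C)"
  proof
    fix \<omega> assume \<omega>: "\<omega> \<in> ?A"
    have "chain_bound u (restrict (\<lambda>t. W t \<omega>) {0..}) = chain_bound u (\<lambda>t. W t \<omega>)"
      by (rule chain_bound_restrict[OF u])
    moreover have "chain_bound (2 * u) (\<lambda>h. (\<lambda>t\<in>{0..}. W t \<omega>) (v + h) - (\<lambda>t\<in>{0..}. W t \<omega>) v) =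
        chain_bound (2 * u) (\<lambda>t. W (v + t) \<omega> - W v \<omega>)"
      using u v by (simp add: chain_bound_def chain_term_def)
    ultimately show "\<omega> \<in> ?G \<union> (?B \<union> ?C)"
      using \<omega> v by (auto simp: excursion_paths_def space_PiM)
  qed
  have "prob ?A \<le> prob (?G \<union> (?B \<union> ?C))"
    using mG mB mC by (intro finite_measure_mono sub) auto
  also have "\<dots> \<le> prob ?G + prob (?B \<union> ?C)"
    using mG mB mC by (intro measure_Un_le) auto
  also have "prob (?B \<union> ?C) \<le> prob ?B + prob ?C"
    using mB mC by (intro measure_Un_le) auto
  finally show ?thesis using pA pB pC by linarith
qed

section \<open>One large jump of the subordinator\<close>

lemma half_le_one_minus_exp:
  fixes y :: real assumes "0 \<le> y" "y \<le> 1" shows "y / 2 \<le> 1 - exp (- y)"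
proof -
  have "exp (- y) \<le> 1 / (1 + y)"
    using assms exp_ge_add_one_self[of y] by (simp add: exp_minus field_simps)
  also have "\<dots> \<le> 1 - y / 2"
  proof -
    have "y * y \<le> y" using assms by (simp add: mult_left_le)
    then show ?thesis using assms by (simp add: field_simps)
  qed
  finally show ?thesis by simp
qed

text \<open>Pointwise \<open>1 - exp (- l * S h)\<close> is at most the indicator of \<open>c < S h\<close> plus
  \<open>2 * l * c * (1 - exp (- S h / c))\<close>. Taking means, the left side is of order \<open>h * l powr \<beta>\<close> and the last
  term of order \<open>h * l\<close> for fixed \<open>c\<close>. As \<open>\<beta> < 1\<close>, the former dominates for small \<open>l\<close>, which leaves a
  multiple of \<open>h\<close> for the probability of a large value.\<close>

lemma subordinator_large_jump_rate:
  assumes "prob_space M" and S: "stable_subordinator M \<beta> S" and \<beta>: "0 < \<beta>" "\<beta> < 1" and c: "1 \<le> c"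
  obtains r where "0 < r"
    "\<And>h. 0 < h \<Longrightarrow> h \<le> 1 \<Longrightarrow> r * h \<le> measure M {\<omega> \<in> space M. c < S h \<omega>}"
proof -
  interpret prob_space M by fact
  \<comment> \<open>With \<open>l = y / c\<close>, the error term \<open>2 * l * c * h * (1 / c) powr \<beta>\<close> is half of the leading term \<open>h * l powr \<beta> / 2\<close>.\<close>
  define y where "y = (1 / 8 :: real) powr (1 / (1 - \<beta>))"
  have y: "0 < y" "y \<le> 1" "y powr (1 - \<beta>) = 1 / 8"
    using \<beta> by (auto simp: y_def powr_powr powr_le1)
  define l where "l = y / c"
  have l: "0 < l" "l \<le> 1" using y c by (auto simp: l_def)
  have lb: "0 < l powr \<beta>" "l powr \<beta> \<le> 1" using l \<beta> by (auto intro: powr_le1)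
  have bound: "l powr \<beta> / 4 * h \<le> measure M {\<omega> \<in> space M. c < S h \<omega>}" if h: "0 < h" "h \<le> 1" for h
  proof -
    let ?A = "{\<omega> \<in> space M. c < S h \<omega>}"
    have [measurable]: "S h \<in> borel_measurable M"
      using S h by (auto simp: stable_subordinator_def levy_process_def)
    have A: "?A \<in> events" by measurable
    note int = integrable_subordinator_laplace[OF assms(1) S]
    have i1: "integrable M (\<lambda>\<omega>. exp (- (l * S h \<omega>)))" "integrable M (\<lambda>\<omega>. exp (- (1 / c * S h \<omega>)))"
      using int[of l h] int[of "1 / c" h] l c h by auto
    have iA: "integrable M (indicator ?A :: _ \<Rightarrow> real)"
      using A by (intro integrable_real_indicator) (auto simp: emeasure_eq_measure)
    have "h * l powr \<beta> / 2 \<le> 1 - exp (- (h * l powr \<beta>))"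
      using h lb by (intro half_le_one_minus_exp) (auto intro: mult_le_one)
    also have "\<dots> = (\<integral>\<omega>. 1 - exp (- (l * S h \<omega>)) \<partial>M)"
      using i1 subordinator_laplace[OF S, of l h] l h by (simp add: prob_space)
    also have "\<dots> \<le> (\<integral>\<omega>. indicator ?A \<omega> + 2 * (l * c) * (1 - exp (- (1 / c * S h \<omega>))) \<partial>M)"
    proof (rule integral_mono_AE)
      show "AE \<omega> in M. 1 - exp (- (l * S h \<omega>)) \<le> indicator ?A \<omega> + 2 * (l * c) * (1 - exp (- (1 / c * S h \<omega>)))"
        using subordinator_nonneg[OF S less_imp_le[OF h(1)]] AE_space
      proof eventually_elim
        case (elim \<omega>)
        show ?case
        proof (cases "c < S h \<omega>")
          case True
          have "0 \<le> 2 * (l * c) * (1 - exp (- (1 / c * S h \<omega>)))"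
            using elim l c by (intro mult_nonneg_nonneg) auto
          moreover have "indicator ?A \<omega> = (1 :: real)" using True elim by simp
          ultimately show ?thesis using exp_ge_zero[of "- (l * S h \<omega>)"] by linarith
        next
          case False
          define z where "z = 1 / c * S h \<omega>"
          have z: "0 \<le> z" "z \<le> 1" "l * S h \<omega> = l * c * z"
            using False elim c by (auto simp: z_def)
          have "1 - exp (- (l * S h \<omega>)) \<le> l * S h \<omega>"
            using exp_ge_add_one_self[of "- (l * S h \<omega>)"] by linarith
          also have "\<dots> = 2 * (l * c) * (z / 2)" by (simp add: z(3))
          also have "\<dots> \<le> 2 * (l * c) * (1 - exp (- z))"
            using l c z half_le_one_minus_exp[of z] by (intro mult_left_mono) auto
          finally show ?thesis using False by (simp add: z_def indicator_def)
        qed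
      qed
    qed (use i1 iA in auto)
    also have "\<dots> = prob ?A + 2 * (l * c) * (1 - exp (- (h * (1 / c) powr \<beta>)))"
      using i1 iA A subordinator_laplace[OF S, of "1 / c" h] c h by (simp add: prob_space)
    also have "\<dots> \<le> prob ?A + 2 * (l * c) * (h * (1 / c) powr \<beta>)"
      using exp_ge_add_one_self[of "- (h * (1 / c) powr \<beta>)"] l c by (intro add_left_mono mult_left_mono) auto
    also have "2 * (l * c) * (h * (1 / c) powr \<beta>) = h * l powr \<beta> / 4"
    proof -
      have lc: "l * c = y" using c by (simp add: l_def)
      have "l powr \<beta> = y powr \<beta> * (1 / c) powr \<beta>"
        using y c by (simp add: l_def powr_mult[symmetric])
      moreover have "y = y powr \<beta> * y powr (1 - \<beta>)"
        using y by (simp add: powr_add[symmetric])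
      ultimately show ?thesis using lc y(3) by simp
    qed
    finally have "h * l powr \<beta> / 2 \<le> prob ?A + h * l powr \<beta> / 4" .
    moreover have "l powr \<beta> / 4 * h = h * l powr \<beta> / 4" by simp
    ultimately show ?thesis by linarith
  qed
  show thesis
    by (rule that[of "l powr \<beta> / 4"]) (use lb bound in auto)
qed

text \<open>If \<open>S 1 > u\<close> held almost surely, the Laplace transform would decay at least like \<open>exp (- l * u)\<close>, too fast
  for \<open>exp (- (l powr \<beta>))\<close> with \<open>\<beta> < 1\<close>.\<close>

lemma subordinator_small_value:
  assumes "prob_space M" and S: "stable_subordinator M \<beta> S" and \<beta>: "\<beta> < 1" and u: "0 < u"
  shows "0 < measure M {\<omega> \<in> space M. S 1 \<omega> \<le> u}"
proof (rule ccontr)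
  interpret prob_space M by fact
  have [measurable]: "S 1 \<in> borel_measurable M"
    using S by (auto simp: stable_subordinator_def levy_process_def)
  assume "\<not> 0 < measure M {\<omega> \<in> space M. S 1 \<omega> \<le> u}"
  then have "prob {\<omega> \<in> space M. S 1 \<omega> \<le> u} = 0" by (simp add: zero_less_measure_iff)
  then have "AE \<omega> in M. \<omega> \<notin> {\<omega> \<in> space M. S 1 \<omega> \<le> u}"
    by (subst prob_eq_0[symmetric]) auto
  then have big: "AE \<omega> in M. u \<le> S 1 \<omega>"
    using AE_space by eventually_elim auto
  \<comment> \<open>Chosen such that \<open>l * u = 2 * l powr \<beta>\<close>.\<close>
  define l where "l = (2 / u) powr (1 / (1 - \<beta>))"
  have l: "0 < l" "l powr (1 - \<beta>) = 2 / u"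
    using u \<beta> by (auto simp: l_def powr_powr)
  have "exp (- (1 * l powr \<beta>)) = (\<integral>\<omega>. exp (- (l * S 1 \<omega>)) \<partial>M)"
    using l by (intro subordinator_laplace[OF S, symmetric]) auto
  also have "\<dots> \<le> (\<integral>\<omega>. exp (- (l * u)) \<partial>M)"
    using integrable_subordinator_laplace[OF assms(1) S l(1), of 1] l
    by (intro integral_mono_AE) (use big in auto)
  also have "\<dots> = exp (- (l * u))" by (simp add: prob_space)
  finally have "l * u \<le> l powr \<beta>" by simp
  moreover have "l * u = 2 * l powr \<beta>"
  proof -
    have "l = l powr \<beta> * l powr (1 - \<beta>)" using l(1) by (simp add: powr_add[symmetric])
    then have "l = l powr \<beta> * (2 / u)" using l(2) by simp
    then show ?thesis using u by (metis (no_types, opaque_lifting) mult.commute mult.left_commute nonzero_mult_div_cancel_left times_divide_eq_right less_irrefl)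
  qed
  moreover have "0 < l powr \<beta>" using l by simp
  ultimately show False by simp
qed

text \<open>All but one step of the dyadic grid of level \<open>n\<close> advance \<open>s\<close> by little in total: at most \<open>u\<close> before the
  step with index \<open>k\<close>, at most \<open>u\<close> after it, and more than \<open>c\<close> during it.\<close>

definition jump_at :: "real \<Rightarrow> real \<Rightarrow> nat \<Rightarrow> nat \<Rightarrow> (real \<Rightarrow> real) \<Rightarrow> bool" where
  "jump_at c u n k s \<longleftrightarrow> s (real k / 2 ^ n) - s 0 \<in> {..u} \<and>
     s (real (Suc k) / 2 ^ n) - s (real k / 2 ^ n) \<in> {c<..} \<and> s 1 - s (real (Suc k) / 2 ^ n) \<in> {..u}"

text \<open>Such a step is required on infinitely many grids, because no single grid shows that \<open>s\<close> jumps over an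
  interval rather than running through it.\<close>

definition one_jump_paths :: "real \<Rightarrow> real \<Rightarrow> (real \<Rightarrow> real) set" where
  "one_jump_paths c u = {s \<in> space path_space. \<forall>m. \<exists>n\<ge>m. \<exists>k\<in>{1..<2 ^ n - 1}. jump_at c u n k s}"

lemma measurable_jump_at:
  assumes "\<And>t. 0 \<le> t \<Longrightarrow> (\<lambda>x. f x t) \<in> borel_measurable M"
  shows "Measurable.pred M (\<lambda>x. jump_at c u n k (f x))"
proof -
  have [measurable]: "(\<lambda>x. f x 0) \<in> borel_measurable M" "(\<lambda>x. f x 1) \<in> borel_measurable M"
    "(\<lambda>x. f x (real k / 2 ^ n)) \<in> borel_measurable M" "(\<lambda>x. f x (real (Suc k) / 2 ^ n)) \<in> borel_measurable M"
    by (auto intro!: assms)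
  show ?thesis unfolding jump_at_def by measurable
qed

lemma sets_one_jump_paths: "one_jump_paths c u \<in> sets path_space"
proof -
  have [measurable]: "Measurable.pred path_space (\<lambda>s. jump_at c u n k s)" for n k
    by (rule measurable_jump_at) (auto intro: measurable_component_singleton)
  show ?thesis unfolding one_jump_paths_def by measurable
qed

text \<open>After one step larger than \<open>c \<ge> u\<close> the path is above \<open>u\<close>, so no later step can satisfy the condition.\<close>

lemma jump_at_unique:
  assumes reg: "regular_pair w s" and uc: "u \<le> c" and k: "Suc k \<le> 2 ^ n" "Suc l \<le> 2 ^ n"
    and "jump_at c u n k s" "jump_at c u n l s"
  shows "k = l"
proof -
  have s0: "s 0 = 0" using reg by (simp add: regular_pair_def)
  have False if "i < j" "jump_at c u n i s" "jump_at c u n j s" for i j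
  proof -
    have "s (real (Suc i) / 2 ^ n) \<le> s (real j / 2 ^ n)"
      using that(1) by (intro regular_pair_bounds(2)[OF reg]) (auto simp: divide_right_mono)
    moreover have "0 \<le> s (real i / 2 ^ n)" by (rule regular_pair_bounds(1)[OF reg]) simp
    ultimately show False using that uc s0 by (auto simp: jump_at_def)
  qed
  then show ?thesis using assms(5,6) by (meson linorder_neqE_nat)
qed

text \<open>On the grid of level \<open>n\<close> there are about \<open>2 ^ n\<close> possible positions of the large step. They almost surely
  exclude each other, and each has probability at least a multiple of \<open>1 / 2 ^ n\<close>. The resulting lower bound does not
  depend on \<open>n\<close>, so it passes to the event that infinitely many grids show a large step.\<close>

lemma one_jump_probability:
  assumes std: "standard_pair M \<beta> W S" and \<beta>: "0 < \<beta>" "\<beta> < 1" and u: "0 < u" "u \<le> c" and c: "1 \<le> c"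
  shows "0 < measure M {\<omega> \<in> space M. (\<lambda>t\<in>{0..}. S t \<omega>) \<in> one_jump_paths c u}"
proof -
  have M: "prob_space M" and S: "stable_subordinator M \<beta> S" using std by (auto simp: standard_pair_def)
  interpret prob_space M by fact
  have m: "\<And>t. 0 \<le> t \<Longrightarrow> S t \<in> borel_measurable M" and ind: "indep_increments M S"
    and stat: "\<And>s t. 0 \<le> s \<Longrightarrow> s < t \<Longrightarrow>
       distr M borel (\<lambda>\<omega>. S t \<omega> - S s \<omega>) = distr M borel (S (t - s))"
    using S by (auto simp: stable_subordinator_def levy_process_def)
  have law: "prob {\<omega> \<in> space M. S t \<omega> - S s \<omega> \<in> A} = prob {\<omega> \<in> space M. S (t - s) \<omega> \<in> A}"
    if "0 \<le> s" "s < t" "A \<in> sets borel" for s t A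
  proof -
    have "measure (distr M borel (\<lambda>\<omega>. S t \<omega> - S s \<omega>)) A = measure (distr M borel (S (t - s))) A"
      using stat[OF that(1,2)] by simp
    then show ?thesis using that m[of t] m[of s] m[of "t - s"]
      by (simp add: measure_distr vimage_def Int_def conj_commute)
  qed
  define a where "a = prob {\<omega> \<in> space M. S 1 \<omega> \<le> u}"
  have a: "0 < a" unfolding a_def by (rule subordinator_small_value[OF M S \<beta>(2) u(1)])
  have small: "a \<le> prob {\<omega> \<in> space M. S h \<omega> \<in> {..u}}" if "0 \<le> h" "h \<le> 1" for h
    unfolding a_def
  proof (rule finite_measure_mono_AE)
    show "AE \<omega> in M. \<omega> \<in> {\<omega> \<in> space M. S 1 \<omega> \<le> u} \<longrightarrow> \<omega> \<in> {\<omega> \<in> space M. S h \<omega> \<in> {..u}}"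
      using AE_regular_pair[OF std]
    proof eventually_elim
      case (elim \<omega>)
      then show ?case using regular_pair_bounds(2)[OF elim that] by auto
    qed
    have [measurable]: "S h \<in> borel_measurable M" using m that by auto
    show "{\<omega> \<in> space M. S h \<omega> \<in> {..u}} \<in> events" by measurable
  qed
  obtain r where r: "0 < r" "\<And>h. 0 < h \<Longrightarrow> h \<le> 1 \<Longrightarrow> r * h \<le> prob {\<omega> \<in> space M. c < S h \<omega>}"
    using subordinator_large_jump_rate[OF M S \<beta> c] by blast
  define J where "J n k = {\<omega> \<in> space M. jump_at c u n k (\<lambda>t. S t \<omega>)}" for n k
  have J[measurable]: "J n k \<in> events" for n k
    unfolding J_def using measurable_jump_at[of "\<lambda>\<omega> t. S t \<omega>" M] m by (auto intro!: predE)
  have pJ: "a\<^sup>2 * r / 2 ^ n \<le> prob (J n k)" if k: "k \<in> {1..<2 ^ n - 1}" for n k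
  proof -
    define t1 where "t1 = real k / 2 ^ n"
    define t2 where "t2 = real (Suc k) / 2 ^ n"
    have "Suc k < 2 ^ n" using k by auto
    then have "real (Suc k) < 2 ^ n" by (metis of_nat_less_iff of_nat_numeral of_nat_power)
    then have t: "0 < t1" "t1 < t2" "t2 < 1" "t2 - t1 = 1 / 2 ^ n"
      using k by (auto simp: t1_def t2_def field_simps)
    have "prob (J n k) = prob {\<omega> \<in> space M. S t1 \<omega> - S 0 \<omega> \<in> {..u}} *
        prob {\<omega> \<in> space M. S t2 \<omega> - S t1 \<omega> \<in> {c<..}} * prob {\<omega> \<in> space M. S 1 \<omega> - S t2 \<omega> \<in> {..u}}"
      unfolding J_def jump_at_def t1_def[symmetric] t2_def[symmetric]
      by (rule three_increments_indep[OF M ind m]) (use t in auto)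
    also have "\<dots> = prob {\<omega> \<in> space M. S t1 \<omega> \<in> {..u}} *
        prob {\<omega> \<in> space M. S (1 / 2 ^ n) \<omega> \<in> {c<..}} * prob {\<omega> \<in> space M. S (1 - t2) \<omega> \<in> {..u}}"
      using law[of 0 t1 "{..u}"] law[of t1 t2 "{c<..}"] law[of t2 1 "{..u}"] t by simp
    finally have eq: "prob (J n k) = prob {\<omega> \<in> space M. S t1 \<omega> \<in> {..u}} *
        prob {\<omega> \<in> space M. S (1 / 2 ^ n) \<omega> \<in> {c<..}} * prob {\<omega> \<in> space M. S (1 - t2) \<omega> \<in> {..u}}" .
    have "a * (r * (1 / 2 ^ n)) * a \<le> prob (J n k)"
      unfolding eq using small[of t1] small[of "1 - t2"] r(2)[of "1 / 2 ^ n"] a r(1) t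
      by (intro mult_mono) auto
    then show ?thesis by (simp add: power2_eq_square mult_ac)
  qed
  define E where "E n = (\<Union>k\<in>{1..<2 ^ n - 1}. J n k)" for n
  have E[measurable]: "E n \<in> events" for n unfolding E_def by auto
  have pE: "a\<^sup>2 * r / 2 \<le> prob (E n)" if n: "2 \<le> n" for n
  proof -
    let ?K = "{1..<2 ^ n - 1 :: nat}"
    have four: "(4::nat) \<le> 2 ^ n" using power_increasing[OF n, of "2::nat"] by simp
    then have "(4::real) \<le> 2 ^ n" by (metis of_nat_le_iff of_nat_numeral of_nat_power)
    moreover have "real (card ?K) = 2 ^ n - 2" using four by (simp add: of_nat_diff)
    ultimately have card: "2 ^ n / 2 \<le> real (card ?K)" by simp
    have "a\<^sup>2 * r / 2 = 2 ^ n / 2 * (a\<^sup>2 * r / 2 ^ n)" by simp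
    also have "\<dots> \<le> real (card ?K) * (a\<^sup>2 * r / 2 ^ n)"
      using card r a by (intro mult_right_mono) auto
    also have "\<dots> = (\<Sum>k\<in>?K. a\<^sup>2 * r / 2 ^ n)" by simp
    also have "\<dots> \<le> (\<Sum>k\<in>?K. prob (J n k))" by (intro sum_mono pJ)
    also have "\<dots> = (\<integral>\<omega>. (\<Sum>k\<in>?K. indicator (J n k) \<omega>) \<partial>M)"
      by (subst Bochner_Integration.integral_sum) (auto simp: emeasure_eq_measure intro!: integrable_real_indicator)
    also have "\<dots> \<le> (\<integral>\<omega>. indicator (E n) \<omega> \<partial>M)"
    proof (rule integral_mono_AE)
      show "AE \<omega> in M. (\<Sum>k\<in>?K. indicator (J n k) \<omega>) \<le> (indicator (E n) \<omega> :: real)"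
        using AE_regular_pair[OF std]
      proof eventually_elim
        case (elim \<omega>)
        show ?case
        proof (cases "\<omega> \<in> E n")
          case True
          then obtain k where k: "k \<in> ?K" "\<omega> \<in> J n k" by (auto simp: E_def)
          have "(\<Sum>i\<in>?K. indicator (J n i) \<omega>) = (\<Sum>i\<in>?K. if i = k then 1 else 0 :: real)"
          proof (rule sum.cong)
            fix i assume i: "i \<in> ?K"
            have le: "Suc i \<le> 2 ^ n" "Suc k \<le> 2 ^ n" using i k by auto
            show "indicator (J n i) \<omega> = (if i = k then 1 else 0 :: real)"
            proof (cases "\<omega> \<in> J n i")
              case True
              then have "i = k"
                using k by (intro jump_at_unique[OF elim u(2) le]) (simp_all add: J_def)
              then show ?thesis using k by simp
            next
              case False
              then have "i \<noteq> k" using k by blast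
              then show ?thesis using False by simp
            qed
          qed simp
          then show ?thesis using True k by simp
        next
          case False
          then have "\<And>k. k \<in> ?K \<Longrightarrow> \<omega> \<notin> J n k" by (auto simp: E_def)
          then show ?thesis by (simp add: indicator_def)
        qed
      qed
    qed (auto simp: emeasure_eq_measure intro!: integrable_real_indicator Bochner_Integration.integrable_sum)
    finally show ?thesis by simp
  qed
  define G where "G i = (\<Union>n\<in>{i..}. E n)" for i
  have G[measurable]: "G i \<in> events" for i unfolding G_def by auto
  have "decseq G" unfolding G_def decseq_def by (intro allI impI UN_mono) auto
  then have "(\<lambda>i. prob (G i)) \<longlonglongrightarrow> prob (\<Inter>i. G i)"
    by (intro finite_Lim_measure_decseq) auto
  moreover have "a\<^sup>2 * r / 2 \<le> prob (G i)" for i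
  proof -
    have "a\<^sup>2 * r / 2 \<le> prob (E (max i 2))" by (rule pE) simp
    also have "\<dots> \<le> prob (G i)" by (rule finite_measure_mono) (auto simp: G_def intro!: bexI[of _ "max i 2"])
    finally show ?thesis .
  qed
  ultimately have "a\<^sup>2 * r / 2 \<le> prob (\<Inter>i. G i)"
    by (intro LIMSEQ_le_const) auto
  moreover have "(\<Inter>i. G i) = {\<omega> \<in> space M. (\<lambda>t\<in>{0..}. S t \<omega>) \<in> one_jump_paths c u}"
  proof -
    have "jump_at c u n k (\<lambda>t\<in>{0..}. S t \<omega>) = jump_at c u n k (\<lambda>t. S t \<omega>)" for n k \<omega>
      by (simp add: jump_at_def)
    then show ?thesis
      by (auto simp: G_def E_def J_def one_jump_paths_def space_PiM) blast+
  qed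
  moreover have "0 < a\<^sup>2 * r / 2" using a r by simp
  ultimately show ?thesis by simp
qed

text \<open>A dyadic time belongs to all sufficiently fine grids, in particular to one with a large step, and lies
  on one side of that step.\<close>

lemma one_jump_path_gap:
  assumes reg: "regular_pair w s" and u: "0 < u" and s: "restrict s {0..} \<in> one_jump_paths c u"
  shows "c < s 1" and "s (dyadic_unit p) \<le> u \<or> s 1 - u \<le> s (dyadic_unit p)"
proof -
  have s0: "s 0 = 0" using reg by (simp add: regular_pair_def)
  obtain n k where n: "snd p \<le> n" and k: "k \<in> {1..<2 ^ n - 1}" "jump_at c u n k (restrict s {0..})"
    using s unfolding one_jump_paths_def by blast
  then have J: "s (real k / 2 ^ n) \<le> u" "c < s (real (Suc k) / 2 ^ n) - s (real k / 2 ^ n)"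
    "s 1 - u \<le> s (real (Suc k) / 2 ^ n)"
    using s0 by (auto simp: jump_at_def)
  have "Suc k \<le> 2 ^ n" using k by auto
  then have "real (Suc k) \<le> 2 ^ n" by (metis of_nat_le_iff of_nat_numeral of_nat_power)
  then have "s (real (Suc k) / 2 ^ n) \<le> s 1"
    by (intro regular_pair_bounds(2)[OF reg]) (auto simp: field_simps)
  moreover have "0 \<le> s (real k / 2 ^ n)" by (rule regular_pair_bounds(1)[OF reg]) simp
  ultimately show "c < s 1" using J by linarith
  define j where "j = min (2 ^ n) (fst p * 2 ^ (n - snd p))"
  have cancel: "real (fst p * 2 ^ (n - snd p)) / 2 ^ n = real (fst p) / 2 ^ snd p"
  proof -
    obtain d where d: "n = snd p + d" using n le_iff_add by blast
    show ?thesis unfolding d by (simp add: power_add)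
  qed
  have "real j / 2 ^ n = min 1 (real (fst p * 2 ^ (n - snd p)) / 2 ^ n)"
    by (simp add: j_def of_nat_min min_divide_distrib_right)
  then have j: "dyadic_unit p = real j / 2 ^ n"
    by (simp only: cancel dyadic_unit_def)
  show "s (dyadic_unit p) \<le> u \<or> s 1 - u \<le> s (dyadic_unit p)"
  proof (cases "j \<le> k")
    case True
    then have "s (real j / 2 ^ n) \<le> s (real k / 2 ^ n)"
      by (intro regular_pair_bounds(2)[OF reg]) (auto simp: divide_right_mono)
    then show ?thesis using J j by simp
  next
    case False
    then have "s (real (Suc k) / 2 ^ n) \<le> s (real j / 2 ^ n)"
      by (intro regular_pair_bounds(2)[OF reg]) (auto simp: divide_right_mono)
    then show ?thesis using J j by simp
  qed
qed

section \<open>Comparison of the mean ranges\<close>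

lemma visited_range_le_elapsed_range:
  assumes reg: "regular_pair w s"
  shows "fst (extremes elapsed_times (w, s)) \<le> fst (extremes visited_times (w, s))"
    and "snd (extremes visited_times (w, s)) \<le> snd (extremes elapsed_times (w, s))"
proof -
  have "w (visited_times s p) \<in> {fst (extremes elapsed_times (w, s))..snd (extremes elapsed_times (w, s))}" for p
    using path_times_bounds[OF reg, of visited_times p] by (intro elapsed_extremes_bound[OF reg]) simp
  then show "fst (extremes elapsed_times (w, s)) \<le> fst (extremes visited_times (w, s))"
    "snd (extremes visited_times (w, s)) \<le> snd (extremes elapsed_times (w, s))"
    by (auto intro!: extremes_bounds(3,4)[OF reg])
qed

text \<open>The subordinate path only sees the Brownian path on the windows \<open>[0, u]\<close> and \<open>[v, v + 2 * u]\<close>, where it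
  stays below \<open>w 1\<close>.\<close>

lemma excursion_missed_by_jump:
  assumes reg: "regular_pair w s" and u: "0 < u" "u \<le> 1 / 2" and v: "0 \<le> v"
    and s: "restrict s {0..} \<in> one_jump_paths 3 u" and s1: "v + u \<le> s 1" "s 1 < v + 2 * u"
    and w: "restrict w {0..} \<in> excursion_paths u v"
  shows "snd (extremes visited_times (w, s)) < snd (extremes elapsed_times (w, s))"
proof -
  have c: "continuous_on {0..} w" and w0: "w 0 = 0" using reg by (auto simp: regular_pair_def)
  have w1: "1 < w 1" and wv: "w v - w 1 < - 1"
    using w v w0 by (auto simp: excursion_paths_def)
  have cb: "chain_bound u w \<le> 1" and cb2: "chain_bound (2 * u) (\<lambda>h. w (v + h) - w v) \<le> 1"
  proof -
    show "chain_bound u w \<le> 1"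
      using w chain_bound_restrict[OF u(1), of w] by (simp add: excursion_paths_def)
    have "chain_bound (2 * u) (\<lambda>h. restrict w {0..} (v + h) - restrict w {0..} v) =
        chain_bound (2 * u) (\<lambda>h. w (v + h) - w v)"
      using u v by (simp add: chain_bound_def chain_term_def)
    then show "chain_bound (2 * u) (\<lambda>h. w (v + h) - w v) \<le> 1"
      using w by (simp add: excursion_paths_def)
  qed
  have early: "\<bar>w h\<bar> \<le> 1" if "0 \<le> h" "h \<le> u" for h
    using order_trans[OF abs_le_chain_bound[OF u(1) w0 c that] cb] by simp
  have late: "\<bar>w (v + h) - w v\<bar> \<le> 1" if h: "0 \<le> h" "h \<le> 2 * u" for h
  proof -
    have "continuous_on {0..} (\<lambda>h. w (v + h))"
      by (rule continuous_on_compose2[OF c]) (use v in \<open>auto intro!: continuous_intros\<close>)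
    then have "continuous_on {0..} (\<lambda>h. w (v + h) - w v)"
      by (intro continuous_intros)
    then have "ennreal \<bar>w (v + h) - w v\<bar> \<le> chain_bound (2 * u) (\<lambda>h. w (v + h) - w v)"
      using u h by (intro abs_le_chain_bound[where w="\<lambda>h. w (v + h) - w v"]) auto
    then show ?thesis using order_trans[OF _ cb2] by fastforce
  qed
  have "w (visited_times s p) \<le> max 1 (w v + 1)" for p
  proof -
    have nn: "0 \<le> s (dyadic_unit p)" "s (dyadic_unit p) \<le> s 1"
      using path_times_bounds[OF reg, of visited_times p] by (auto simp: visited_times_def)
    consider "s (dyadic_unit p) \<le> u" | "v \<le> s (dyadic_unit p)"
      using one_jump_path_gap(2)[OF reg u(1) s, of p] s1 by linarith
    then show ?thesis
    proof cases
      case 1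
      then show ?thesis using early[OF nn(1)] by (auto simp: visited_times_def)
    next
      case 2
      then show ?thesis using late[of "s (dyadic_unit p) - v"] nn s1 by (auto simp: visited_times_def)
    qed
  qed
  then have "snd (extremes visited_times (w, s)) \<le> max 1 (w v + 1)"
    by (intro extremes_bounds(4)[OF reg]) auto
  also have "\<dots> < w 1" using w1 wv by simp
  also have "w 1 \<le> snd (extremes elapsed_times (w, s))"
    using elapsed_extremes_bound[OF reg, of 1] one_jump_path_gap(1)[OF reg u(1) s] by simp
  finally show ?thesis .
qed

lemma small_window_exists:
  obtains u where "0 < u" "u \<le> 1 / 2"
    "0 < normal_tail\<^sup>2 - chain_const * sqrt u - chain_const * sqrt (2 * u)"
proof -
  \<comment> \<open>If \<open>sqrt u \<le> r\<close>, the two subtracted terms are at most a quarter and a half of \<open>normal_tail\<^sup>2\<close>.\<close>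
  define r where "r = normal_tail\<^sup>2 / (4 * chain_const)"
  define u where "u = min (1 / 2) (r\<^sup>2)"
  have r: "0 < r" using normal_tail_pos chain_const_pos by (simp add: r_def)
  have u: "0 < u" "u \<le> 1 / 2" using r by (auto simp: u_def)
  have "sqrt u \<le> sqrt (r\<^sup>2)" by (rule real_sqrt_le_mono) (simp add: u_def)
  then have su: "sqrt u \<le> r" using r by simp
  have "sqrt (2 * u) \<le> sqrt (4 * u)" using u by (intro real_sqrt_le_mono) auto
  also have "\<dots> = 2 * sqrt u" by (simp add: real_sqrt_mult)
  finally have "chain_const * sqrt (2 * u) \<le> chain_const * (2 * r)"
    using su chain_const_pos by (intro mult_left_mono) auto
  moreover have "chain_const * sqrt u \<le> chain_const * r"
    using su chain_const_pos by (intro mult_left_mono) auto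
  moreover have "chain_const * (2 * r) + chain_const * r = 3 / 4 * normal_tail\<^sup>2"
    using chain_const_pos by (simp add: r_def field_simps)
  moreover have "0 < normal_tail\<^sup>2" using normal_tail_pos by simp
  ultimately have "0 < normal_tail\<^sup>2 - chain_const * sqrt u - chain_const * sqrt (2 * u)"
    by linarith
  then show thesis using that u by blast
qed

text \<open>The end point \<open>S 1\<close> is random, but a window of length \<open>2 * u\<close> around it can be chosen from countably
  many. One of these choices has positive probability, and for it the conditions on \<open>S\<close> and on \<open>W\<close>
  concern the two processes separately.\<close>

lemma mean_visited_range_less:
  assumes std: "standard_pair M \<beta> W S" and \<beta>: "1 / 2 < \<beta>" "\<beta> < 1"
  defines "R \<equiv> \<lambda>g \<omega>. snd (extremes g (\<lambda>t. W t \<omega>, \<lambda>t. S t \<omega>)) - fst (extremes g (\<lambda>t. W t \<omega>, \<lambda>t. S t \<omega>))"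
  shows "integrable M (R visited_times)" and "integrable M (R elapsed_times)"
    and "(\<integral>\<omega>. R visited_times \<omega> \<partial>M) < (\<integral>\<omega>. R elapsed_times \<omega> \<partial>M)"
proof -
  have M: "prob_space M" and W: "brownian_motion M 0 W" and S: "stable_subordinator M \<beta> S"
    and ind: "indep_processes M W S"
    using std by (auto simp: standard_pair_def)
  interpret prob_space M by fact
  note reg = AE_regular_pair[OF std]
  have rm: "R g \<in> borel_measurable M" if "g = visited_times \<or> g = elapsed_times" for g
  proof -
    have [measurable]: "(\<lambda>\<omega>. extremes g (\<lambda>t. W t \<omega>, \<lambda>t. S t \<omega>)) \<in> measurable M (borel \<Otimes>\<^sub>M borel)"
      using extremes_random_variable(1)[OF std that] by (simp add: borel_prod)
    show ?thesis unfolding R_def by measurable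
  qed
  show iA: "integrable M (R elapsed_times)"
    unfolding R_def by (rule integrable_brownian_range[OF std \<beta>(1)])
  have le: "AE \<omega> in M. R visited_times \<omega> \<le> R elapsed_times \<omega>"
    using reg
  proof eventually_elim
    case (elim \<omega>)
    then show ?case using visited_range_le_elapsed_range[OF elim] by (simp add: R_def)
  qed
  have nn: "AE \<omega> in M. 0 \<le> R visited_times \<omega>"
    using reg
  proof eventually_elim
    case (elim \<omega>)
    then show ?case using extremes_bounds(1,2)[OF elim, of visited_times undefined] by (simp add: R_def)
  qed
  show iJ: "integrable M (R visited_times)"
  proof (rule Bochner_Integration.integrable_bound[OF iA rm])
    show "AE \<omega> in M. norm (R visited_times \<omega>) \<le> norm (R elapsed_times \<omega>)"
      using le nn by eventually_elim auto
  qed simp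
  obtain u where u: "0 < u" "u \<le> 1 / 2"
    and pu: "0 < normal_tail\<^sup>2 - chain_const * sqrt u - chain_const * sqrt (2 * u)"
    by (rule small_window_exists)
  let ?W = "\<lambda>\<omega>. \<lambda>t\<in>{0..}. W t \<omega>" and ?S = "\<lambda>\<omega>. \<lambda>t\<in>{0..}. S t \<omega>"
  have pW: "?W \<in> measurable M path_space" and pS: "?S \<in> measurable M path_space"
    using ind unfolding indep_processes_def by (auto dest: indep_var_rv1 indep_var_rv2)
  define F where "F j = {s \<in> one_jump_paths 3 u. s 1 \<in> {of_int j * u..<(of_int j + 1) * u}}" for j :: int
  have F: "F j \<in> sets path_space" for j
  proof -
    have "(\<lambda>s. s 1) \<in> borel_measurable path_space" by (intro measurable_component_singleton) auto
    then have "(\<lambda>s. s 1) -` {of_int j * u..<(of_int j + 1) * u} \<inter> space path_space \<in> sets path_space"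
      by (rule measurable_sets) simp
    moreover have "F j = one_jump_paths 3 u \<inter> ((\<lambda>s. s 1) -` {of_int j * u..<(of_int j + 1) * u} \<inter> space path_space)"
      by (auto simp: F_def one_jump_paths_def)
    ultimately show ?thesis using sets_one_jump_paths by simp
  qed
  define A where "A j = ?S -` F j \<inter> space M" for j
  have A: "A j \<in> events" for j unfolding A_def by (rule measurable_sets[OF pS F])
  have "\<exists>j. A j \<notin> null_sets M"
  proof (rule ccontr)
    assume "\<nexists>j. A j \<notin> null_sets M"
    then have "(\<Union>j. A j) \<in> null_sets M" by (intro null_sets_UN') auto
    moreover have "(\<Union>j. A j) = {\<omega> \<in> space M. ?S \<omega> \<in> one_jump_paths 3 u}"
    proof -
      have "\<exists>j::int. of_int j * u \<le> x \<and> x < (of_int j + 1) * u" for x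
      proof -
        have "of_int \<lfloor>x / u\<rfloor> \<le> x / u" "x / u < of_int \<lfloor>x / u\<rfloor> + 1" by linarith+
        then show ?thesis using u(1) by (auto simp only: pos_le_divide_eq pos_divide_less_eq)
      qed
      then show ?thesis by (simp add: A_def F_def set_eq_iff) blast
    qed
    ultimately have "measure M {\<omega> \<in> space M. ?S \<omega> \<in> one_jump_paths 3 u} = 0"
      by (simp add: measure_eq_0_null_sets)
    moreover have "0 < measure M {\<omega> \<in> space M. ?S \<omega> \<in> one_jump_paths 3 u}"
      using u \<beta> by (intro one_jump_probability[OF std]) auto
    ultimately show False by simp
  qed
  then obtain j where j: "A j \<notin> null_sets M" by blast
  then have pA: "0 < prob (A j)"
    using A[of j] by (auto simp: null_sets_def emeasure_eq_measure zero_less_measure_iff)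
  \<comment> \<open>The late window starts one step early, since the path may be as low as \<open>S 1 - u\<close> after the jump.\<close>
  define v where "v = (of_int j - 1) * u"
  have v: "2 \<le> v"
  proof (rule ccontr)
    assume nv: "\<not> 2 \<le> v"
    have "AE \<omega> in M. \<omega> \<notin> A j"
      using reg
    proof eventually_elim
      case (elim \<omega>)
      show ?case
      proof
        assume "\<omega> \<in> A j"
        then have "?S \<omega> \<in> one_jump_paths 3 u" "S 1 \<omega> < v + 2 * u"
          by (auto simp: A_def F_def v_def algebra_simps)
        then show False using one_jump_path_gap(1)[OF elim u(1)] nv u by fastforce
      qed
    qed
    then have "A j \<in> null_sets M" using A by (simp add: AE_iff_null_sets)
    then show False using j by simp
  qed
  define E where "E = (\<lambda>\<omega>. (?W \<omega>, ?S \<omega>)) -` (excursion_paths u v \<times> F j) \<inter> space M"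
  have G: "excursion_paths u v \<in> sets path_space" using u v by (intro sets_excursion_paths) auto
  have E: "E \<in> events"
    unfolding E_def by (rule measurable_sets[OF measurable_Pair[OF pW pS]]) (use G F in auto)
  have "prob E = prob (?W -` excursion_paths u v \<inter> space M) * prob (A j)"
    unfolding E_def A_def by (rule indep_varD[OF ind[unfolded indep_processes_def] G F])
  moreover have "0 < prob (?W -` excursion_paths u v \<inter> space M)"
    using excursion_probability[OF M W u(1) v] pu by (simp add: vimage_def Int_def conj_commute)
  ultimately have pE: "0 < prob E" using pA by simp
  show "(\<integral>\<omega>. R visited_times \<omega> \<partial>M) < (\<integral>\<omega>. R elapsed_times \<omega> \<partial>M)"
  proof (rule integral_less_AE[OF iJ iA _ E _ le])
    show "emeasure M E \<noteq> 0" using pE by (simp add: emeasure_eq_measure)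
    show "AE \<omega> in M. \<omega> \<in> E \<longrightarrow> R visited_times \<omega> \<noteq> R elapsed_times \<omega>"
      using reg
    proof eventually_elim
      case (elim \<omega>)
      show ?case
      proof
        assume "\<omega> \<in> E"
        then have w: "?W \<omega> \<in> excursion_paths u v" and s: "?S \<omega> \<in> one_jump_paths 3 u"
          and s1: "v + u \<le> S 1 \<omega>" "S 1 \<omega> < v + 2 * u"
          by (auto simp: E_def F_def v_def algebra_simps)
        have "0 \<le> v" using v by simp
        from excursion_missed_by_jump[OF elim u this s s1 w] visited_range_le_elapsed_range(1)[OF elim]
        show "R visited_times \<omega> \<noteq> R elapsed_times \<omega>" by (simp add: R_def)
      qed
    qed
  qed
qed

section \<open>The limits\<close>

text \<open>After division by \<open>t powr e\<close> the truncation level tends to infinity; \<open>R\<close> dominates.\<close>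

lemma truncated_mean_tendsto:
  fixes R :: "'b \<Rightarrow> real"
  assumes R: "integrable M R" and nn: "AE x in M. 0 \<le> R x" and c: "0 < c" and e: "0 < e"
  shows "((\<lambda>t. (\<integral>x. min c (t powr e * R x) \<partial>M) / t powr e) \<longlongrightarrow> (\<integral>x. R x \<partial>M)) (at_right 0)"
proof (rule tendsto_at_right_sequentially)
  show "(0::real) < 1" by simp
  fix T :: "nat \<Rightarrow> real"
  assume T: "\<And>n. 0 < T n" "T \<longlonglongrightarrow> 0"
  have [measurable]: "R \<in> borel_measurable M" using R by simp
  have p: "0 < T n powr e" for n using T(1)[of n] by simp
  have p0: "(\<lambda>n. T n powr e) \<longlonglongrightarrow> 0"
    using tendsto_powr2[OF T(2) tendsto_const[of e] _ e] T(1) e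
    by (auto intro!: always_eventually less_imp_le)
  have "(\<lambda>n. \<integral>x. min c (T n powr e * R x) / T n powr e \<partial>M) \<longlonglongrightarrow> (\<integral>x. R x \<partial>M)"
  proof (rule integral_dominated_convergence[where w=R])
    show "AE x in M. (\<lambda>n. min c (T n powr e * R x) / T n powr e) \<longlonglongrightarrow> R x"
    proof (rule AE_I2, rule tendsto_eventually)
      fix x
      have "(\<lambda>n. T n powr e * R x) \<longlonglongrightarrow> 0 * R x" by (intro tendsto_mult_right p0)
      then have "\<forall>\<^sub>F n in sequentially. T n powr e * R x < c"
        using c by (intro order_tendstoD(2)) auto
      then show "\<forall>\<^sub>F n in sequentially. min c (T n powr e * R x) / T n powr e = R x"
        by eventually_elim (use p in \<open>simp add: min_def less_imp_neq[symmetric]\<close>)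
    qed
    show "AE x in M. norm (min c (T n powr e * R x) / T n powr e) \<le> R x" for n
      using nn
    proof eventually_elim
      case (elim x)
      have "0 \<le> min c (T n powr e * R x)" using elim c p[of n] by simp
      moreover have "min c (T n powr e * R x) \<le> T n powr e * R x" by simp
      ultimately show ?case using p[of n] by (simp add: pos_divide_le_eq mult.commute)
    qed
  qed (use R in auto)
  then show "(\<lambda>n. (\<integral>x. min c (T n powr e * R x) \<partial>M) / T n powr e) \<longlonglongrightarrow> (\<integral>x. R x \<partial>M)"
    by simp
qed

theorem proposition3p5:
  fixes M :: "'a measure" and P :: "real \<Rightarrow> 'a measure"
    and W S :: "real \<Rightarrow> 'a \<Rightarrow> real"
    and \<alpha> a b :: real and D :: "real set"
  assumes "1 < \<alpha>" and "\<alpha> < 2"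
    and "a < b" and "D = {a<..<b}"
    and "\<And>x. prob_space (P x)" and "\<And>x. sets (P x) = sets M"
    and "\<And>x. brownian_motion (P x) x W"
    and "\<And>x. stable_subordinator (P x) (\<alpha> / 2) S"
    and "\<And>x. indep_processes (P x) W S"
  shows "\<exists>L L' :: real.
     ((\<lambda>t. (measure lebesgue D - spectral_heat_content P W S D t) / t powr (1 / \<alpha>)) \<longlongrightarrow> L)
       (at_right 0) \<and>
     ((\<lambda>t. (measure lebesgue D - killed_spectral_heat_content P W S D t) / t powr (1 / \<alpha>)) \<longlongrightarrow> L')
       (at_right 0) \<and>
     L < L'"
proof -
  have std: "standard_pair (P 0) (\<alpha> / 2) W S"
    using assms by (simp add: standard_pair_def)
  define R where "R g \<omega> = snd (extremes g (\<lambda>t. W t \<omega>, \<lambda>t. S t \<omega>)) - fst (extremes g (\<lambda>t. W t \<omega>, \<lambda>t. S t \<omega>))"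
    for g and \<omega> :: 'a
  have R: "integrable (P 0) (R visited_times)" "integrable (P 0) (R elapsed_times)"
    "(\<integral>\<omega>. R visited_times \<omega> \<partial>P 0) < (\<integral>\<omega>. R elapsed_times \<omega> \<partial>P 0)"
    using mean_visited_range_less[OF std] assms(1,2) unfolding R_def by simp_all
  have nn: "AE \<omega> in P 0. 0 \<le> R g \<omega>" if "g = visited_times \<or> g = elapsed_times" for g
    using AE_regular_pair[OF std]
  proof eventually_elim
    case (elim \<omega>)
    then show ?case using extremes_bounds(1,2)[OF elim that, of undefined] by (simp add: R_def)
  qed
  have law: "(\<integral>r. min (b - a) (k * (snd r - fst r)) \<partial>extremes_law (P 0) W S g) = (\<integral>\<omega>. min (b - a) (k * R g \<omega>) \<partial>P 0)"
    if "g = visited_times \<or> g = elapsed_times" for g k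
  proof -
    have "(\<lambda>r::real \<times> real. min (b - a) (k * (snd r - fst r))) \<in> borel_measurable borel"
      unfolding borel_prod[symmetric] by measurable
    then show ?thesis
      unfolding extremes_law_def R_def by (rule integral_distr[OF extremes_random_variable(1)[OF std that]])
  qed
  note formula = heat_content_formula[OF _ \<open>a < b\<close> assms(5,7,8,9), folded \<open>D = {a<..<b}\<close>]
  have lim: "((\<lambda>t. Q t / t powr (1 / \<alpha>)) \<longlongrightarrow> (\<integral>\<omega>. R g \<omega> \<partial>P 0)) (at_right 0)"
    if g: "g = visited_times \<or> g = elapsed_times" and i: "integrable (P 0) (R g)"
      and Q: "\<And>t. 0 < t \<Longrightarrow> Q t = (\<integral>r. min (b - a) (t powr (1 / \<alpha>) * (snd r - fst r)) \<partial>extremes_law (P 0) W S g)"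
    for g Q
  proof (rule Lim_transform_eventually)
    show "((\<lambda>t. (\<integral>\<omega>. min (b - a) (t powr (1 / \<alpha>) * R g \<omega>) \<partial>P 0) / t powr (1 / \<alpha>)) \<longlongrightarrow> (\<integral>\<omega>. R g \<omega> \<partial>P 0)) (at_right 0)"
      using assms(1,3) by (intro truncated_mean_tendsto[OF i nn[OF g]]) auto
    show "\<forall>\<^sub>F t in at_right 0. (\<integral>\<omega>. min (b - a) (t powr (1 / \<alpha>) * R g \<omega>) \<partial>P 0) / t powr (1 / \<alpha>) = Q t / t powr (1 / \<alpha>)"
      using eventually_at_right_less[of 0] by eventually_elim (simp add: Q law[OF g])
  qed
  have "((\<lambda>t. (measure lebesgue D - spectral_heat_content P W S D t) / t powr (1 / \<alpha>)) \<longlongrightarrow> (\<integral>\<omega>. R visited_times \<omega> \<partial>P 0)) (at_right 0)"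
    using assms(1) by (intro lim R(1) formula(1)) auto
  moreover have "((\<lambda>t. (measure lebesgue D - killed_spectral_heat_content P W S D t) / t powr (1 / \<alpha>)) \<longlongrightarrow> (\<integral>\<omega>. R elapsed_times \<omega> \<partial>P 0)) (at_right 0)"
    using assms(1) by (intro lim R(2) formula(2)) auto
  ultimately show ?thesis using R(3) by blast
qed

end
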